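(* Let $d,m\in\mathbb{N}$ and let $T_1,\ldots,T_m$ be invertible $d\times d$ real matrices with $\|T_i\|<1/2$ for $1\le i\le m$. Suppose that $t(T_1,\ldots,T_m)>d$, where $$t(T_1,\ldots,T_m)=\inf\Big\{t\ge 0:\ \sup_{n\ge 1}\ \sum_{I\in\Sigma_n}\alpha_d(T_I)^t\,|\det(T_I)|\le 1\Big\}.$$ Then for $\mathcal{L}^{md}$-a.e. $\mathbf{a}=(a_1,\ldots,a_m)\in\mathbb{R}^{md}$, the self-affine set $K^{\mathbf{a}}$ generated by the iterated function system $\{T_ix+a_i\}_{i=1}^m$ on $\mathbb{R}^d$ has non-empty interior.
   Context: $\|\cdot\|$ is the operator norm induced by the Euclidean norm on $\mathbb{R}^d$. For a $d\times d$ real matrix $A$, $\alpha_1(A)\ge\cdots\ge\alpha_d(A)$ are the singular values of $A$ (square roots of the eigenvalues of $A^*A$, with $A^*$ the transpose), so $\alpha_d(A)$ is the smallest singular value. $\Sigma_n=\{1,\ldots,m\}^n$, and $T_I=T_{i_1}\cdots T_{i_n}$ for $I=i_1\ldots i_n\in\Sigma_n$. For $\mathbf{a}=(a_1,\ldots,a_m)\in\mathbb{R}^{md}$ (each $a_i\in\mathbb{R}^d$), $K^{\mathbf{a}}$ is the unique non-empty compact set $K\subset\mathbb{R}^d$ with $K=\bigcup_{i=1}^m (T_iK+a_i)$. $\mathcal{L}^{md}$ is Lebesgue measure on $\mathbb{R}^{md}$. *)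

theory Defs
  imports "HOL-Analysis.Analysis"
begin

definition eigenvalue :: "real ^ 'n ^ 'n \<Rightarrow> real \<Rightarrow> bool" where
  "eigenvalue A l \<longleftrightarrow> (\<exists>v. v \<noteq> 0 \<and> A *v v = l *\<^sub>R v)"

definition singular_values :: "real ^ 'n ^ 'n \<Rightarrow> real set" where
  "singular_values A = {sqrt l | l. eigenvalue (transpose A ** A) l}"

(* The last entry alpha_d(A) of the decreasing list of singular values; multiplicities do not
   affect it. The matrix A^* A is symmetric, so the set is finite and nonempty. *)
definition smallest_singular_value :: "real ^ 'n ^ 'n \<Rightarrow> real" where
  "smallest_singular_value A = Min (singular_values A)"

definition words :: "nat \<Rightarrow> 'm list set" where
  "words n = {I. length I = n}"

fun word_matrix :: "('m \<Rightarrow> real ^ 'd ^ 'd) \<Rightarrow> 'm list \<Rightarrow> real ^ 'd ^ 'd" where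
  "word_matrix T [] = mat 1"
| "word_matrix T (i # I) = T i ** word_matrix T I"

(* The supremum over n may be infinite for small t, hence extended reals. *)
definition critical_exponent :: "('m::finite \<Rightarrow> real ^ 'd ^ 'd) \<Rightarrow> ereal" where
  "critical_exponent T = Inf {ereal t | t. t \<ge> 0 \<and>
     (SUP n\<in>{1..}. ereal (\<Sum>I\<in>words n.
        smallest_singular_value (word_matrix T I) powr t * \<bar>det (word_matrix T I)\<bar>)) \<le> 1}"

(* Meaningful when every x \<mapsto> T i x + a i is a contraction: then the set is unique. *)
definition self_affine_set ::
    "('m::finite \<Rightarrow> real ^ 'd ^ 'd) \<Rightarrow> real ^ 'd ^ 'm \<Rightarrow> (real ^ 'd) set" where
  "self_affine_set T a =
     (THE K. K \<noteq> {} \<and> compact K \<and> K = (\<Union>i. (\<lambda>x. T i *v x + a $ i) ` K))"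

end

theory Submission
  imports Defs
begin

text \<open>
Write \<open>d\<close> for the dimension, \<open>\<phi> A = \<alpha>\<^sub>d(A) powr t * \<bar>det A\<bar>\<close>, and \<open>\<pi>(I)\<close> for the image of \<open>0\<close>
under the composition of affine maps along the word \<open>I\<close>; \<open>\<pi>(I)\<close> is linear in \<open>a\<close>. Fix
\<open>d < t \<le> d + 1\<close> below the critical exponent. Then \<open>\<phi>\<close> is supermultiplicative, and on some level
\<open>N\<close> the sum \<open>S\<close> of \<open>\<phi>(T\<^sub>I)\<close> over the words of length \<open>N\<close> exceeds \<open>1\<close>. The weights \<open>\<phi>(T\<^sub>I) / S\<close>,
multiplied along sequences of such words (blocks), give probabilities \<open>P(X)\<close> with
\<open>P(X) \<le> \<phi>(T\<^sub>X) / S^n\<close> for \<open>n\<close> blocks. Put mass \<open>P(X)\<close> at \<open>\<pi>(X)\<close> and mollify on the scale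
\<open>2^-k\<close>, with \<open>n\<close> proportional to \<open>k\<close>. If these densities converge uniformly, the limit is
continuous and, having positive values, is positive on a nonempty open set; every point of that set is
a limit of points of the attractor, which is closed and so contains the set
(\<open>interior_nonempty_of_uniform_limit\<close>).

Uniform convergence is shown for almost every \<open>a\<close>. The mollifier is the correlation of a kernel with
itself, so consecutive scales \<open>r\<close> and \<open>r / 2\<close> differ by the correlation of a band kernel with a kernel
of squared \<open>L\<^sup>2\<close> norm \<open>O(r^-d)\<close>; by the Cauchy-Schwarz inequality the difference is
uniformly controlled by the energy, which is the squared \<open>L\<^sup>2\<close> norm of the
point masses smoothed by the band kernel (\<open>smoother_difference_le_energy\<close>). It suffices that the energy
has expectation \<open>O(r^t)\<close> when \<open>a\<close> carries a Gaussian density, since \<open>t > d\<close>. In Fourier terms, this is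
an estimate of a Sobolev norm of order \<open>t / 2 > d / 2\<close>.

The energy is a sum over pairs \<open>X\<close>, \<open>Y\<close> of a kernel evaluated at \<open>\<pi>(Y) - \<pi>(X)\<close>. Let \<open>J\<close> be the
common prefix and \<open>i \<noteq> j\<close> the next letters. Shifting \<open>a\<^sub>j\<close> by \<open>v\<close> and \<open>a\<^sub>i\<close> by \<open>-v\<close> moves
\<open>\<pi>(Y) - \<pi>(X)\<close> by \<open>T\<^sub>J B v\<close>, where \<open>B\<close> is \<open>2\<close> times the identity plus an error that is uniformly
smaller than \<open>2\<close> because the norms of the \<open>T\<^sub>i\<close> stay below \<open>1/2\<close> (\<open>transversality\<close>). Invariance of
Lebesgue measure under this shift gives two bounds. Averaging over \<open>v\<close>, the law of \<open>\<pi>(Y) - \<pi>(X)\<close> has a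
density \<open>O(1 / \<bar>det T\<^sub>J\<bar>)\<close>. Moreover, the band kernel acts by differences of order \<open>d + 1\<close> with steps at most
\<open>r\<close>; these can be transferred to the Gaussian, where their steps are \<open>O(r / \<alpha>\<^sub>d(T\<^sub>J))\<close>. Together the
expected kernel is \<open>O(r^t / \<phi>(T\<^sub>J))\<close> (\<open>gaussian_average_fdiff\<close>, \<open>pair_average\<close>). Summed over all pairs, this
is at most a multiple of the sum of \<open>P(J)\<^sup>2 / \<phi>(T\<^sub>J) \<le> P(J) / S^n\<close> over all prefixes of \<open>n\<close> blocks
and all \<open>n\<close>, a convergent geometric series (\<open>sum_split_weight\<close>, \<open>expected_energy\<close>).
\<close>

section \<open>Linear changes of variables\<close>

lemma nn_integral_lborel_shift:
  fixes h :: "'a::euclidean_space \<Rightarrow> ennreal"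
  assumes [measurable]: "h \<in> borel_measurable borel"
  shows "(\<integral>\<^sup>+x. h (x + c) \<partial>lborel) = (\<integral>\<^sup>+x. h x \<partial>lborel)"
proof -
  have "(\<integral>\<^sup>+x. h x \<partial>lborel) = (\<integral>\<^sup>+x. h x \<partial>(distr lborel borel ((+) c)))"
    by (simp add: lborel_distr_plus)
  also have "\<dots> = (\<integral>\<^sup>+x. h (c + x) \<partial>lborel)"
    by (subst nn_integral_distr) auto
  finally show ?thesis by (simp add: add.commute)
qed

lemma integral_lborel_shift:
  fixes h :: "'a::euclidean_space \<Rightarrow> real"
  assumes [measurable]: "h \<in> borel_measurable borel"
  shows "(LBINT x. h (x + c)) = (LBINT x. h x)"
proof -
  have "(LBINT x. h x) = (\<integral>x. h x \<partial>(distr lborel borel ((+) c)))"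
    by (simp add: lborel_distr_plus)
  also have "\<dots> = (LBINT x. h (c + x))"
    by (subst integral_distr) auto
  finally show ?thesis by (simp add: add.commute)
qed

text \<open>Averaging over an auxiliary translation by \<open>s\<close> along the axis \<open>m\<close>, with \<open>s\<close> uniform on the unit interval,
changes nothing. After it the shear is only a translation of the variable \<open>s\<close>, by an amount that
depends on \<open>x $ n\<close> and hence is not affected by the translation of \<open>x\<close>.\<close>

lemma nn_integral_shear:
  fixes h :: "real ^ 'n \<Rightarrow> ennreal"
  assumes [measurable]: "h \<in> borel_measurable borel" and "m \<noteq> n"
  shows "(\<integral>\<^sup>+x. h (x + (c * x $ n) *\<^sub>R axis m 1) \<partial>lborel) = (\<integral>\<^sup>+x. h x \<partial>lborel)"
proof -
  let ?e = "axis m 1 :: real ^ 'n"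
  let ?g = "indicator {0..1} :: real \<Rightarrow> ennreal"
  have e: "?e $ n = 0" using \<open>m \<noteq> n\<close> by (simp add: axis_def)
  have [measurable]: "(\<lambda>x::real^'n. x $ n) \<in> borel_measurable borel"
    by (intro borel_measurable_continuous_onI continuous_intros)
  have g1: "(\<integral>\<^sup>+s. ?g (s - b) \<partial>lborel) = 1" for b
    using nn_integral_lborel_shift[of ?g "-b"] by simp
  have "(\<integral>\<^sup>+x. h (x + (c * x $ n) *\<^sub>R ?e) \<partial>lborel)
      = (\<integral>\<^sup>+s. ?g s * (\<integral>\<^sup>+x. h (x + (c * x $ n) *\<^sub>R ?e) \<partial>lborel) \<partial>lborel)"
    by (subst nn_integral_multc) (auto)
  also have "\<dots> = (\<integral>\<^sup>+s. ?g s * (\<integral>\<^sup>+x. h (x + s *\<^sub>R ?e + (c * x $ n) *\<^sub>R ?e) \<partial>lborel) \<partial>lborel)"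
  proof (rule nn_integral_cong)
    fix s
    show "?g s * (\<integral>\<^sup>+x. h (x + (c * x $ n) *\<^sub>R ?e) \<partial>lborel)
        = ?g s * (\<integral>\<^sup>+x. h (x + s *\<^sub>R ?e + (c * x $ n) *\<^sub>R ?e) \<partial>lborel)"
      using nn_integral_lborel_shift[of "\<lambda>x. h (x + (c * x $ n) *\<^sub>R ?e)" "s *\<^sub>R ?e"]
      by (simp add: e)
  qed
  also have "\<dots> = (\<integral>\<^sup>+s. (\<integral>\<^sup>+x. ?g s * h (x + (s + c * x $ n) *\<^sub>R ?e) \<partial>lborel) \<partial>lborel)"
    by (subst nn_integral_cmult[symmetric]) (auto simp: algebra_simps)
  also have "\<dots> = (\<integral>\<^sup>+x. (\<integral>\<^sup>+s. ?g s * h (x + (s + c * x $ n) *\<^sub>R ?e) \<partial>lborel) \<partial>lborel)"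
    by (rule lborel_pair.Fubini') measurable
  also have "\<dots> = (\<integral>\<^sup>+x. (\<integral>\<^sup>+s. ?g (s - c * x $ n) * h (x + s *\<^sub>R ?e) \<partial>lborel) \<partial>lborel)"
  proof (rule nn_integral_cong)
    fix x :: "real ^ 'n"
    show "(\<integral>\<^sup>+s. ?g s * h (x + (s + c * x $ n) *\<^sub>R ?e) \<partial>lborel)
        = (\<integral>\<^sup>+s. ?g (s - c * x $ n) * h (x + s *\<^sub>R ?e) \<partial>lborel)"
      using nn_integral_lborel_shift[of "\<lambda>s. ?g (s - c * x $ n) * h (x + s *\<^sub>R ?e)" "c * x $ n"]
      by simp
  qed
  also have "\<dots> = (\<integral>\<^sup>+s. (\<integral>\<^sup>+x. ?g (s - c * x $ n) * h (x + s *\<^sub>R ?e) \<partial>lborel) \<partial>lborel)"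
    by (rule lborel_pair.Fubini') measurable
  also have "\<dots> = (\<integral>\<^sup>+s. (\<integral>\<^sup>+x. ?g (s - c * x $ n) * h x \<partial>lborel) \<partial>lborel)"
  proof (rule nn_integral_cong)
    fix s
    show "(\<integral>\<^sup>+x. ?g (s - c * x $ n) * h (x + s *\<^sub>R ?e) \<partial>lborel)
        = (\<integral>\<^sup>+x. ?g (s - c * x $ n) * h x \<partial>lborel)"
      using nn_integral_lborel_shift[of "\<lambda>x. ?g (s - c * x $ n) * h x" "s *\<^sub>R ?e"]
      by (simp add: e)
  qed
  also have "\<dots> = (\<integral>\<^sup>+x. (\<integral>\<^sup>+s. ?g (s - c * x $ n) * h x \<partial>lborel) \<partial>lborel)"
    by (rule lborel_pair.Fubini') measurable
  also have "\<dots> = (\<integral>\<^sup>+x. h x \<partial>lborel)"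
    by (subst nn_integral_multc) (auto simp: g1)
  finally show ?thesis .
qed

lemma nn_integral_diagonal:
  fixes h :: "real ^ 'n \<Rightarrow> ennreal"
  assumes [measurable]: "h \<in> borel_measurable borel" and c: "\<And>i. c i \<noteq> 0"
  shows "ennreal \<bar>\<Prod>i\<in>UNIV. c i\<bar> * (\<integral>\<^sup>+x. h (\<chi> i. c i * x $ i) \<partial>lborel) = (\<integral>\<^sup>+x. h x \<partial>lborel)"
proof -
  define k where "k = (\<lambda>b::real^'n. c (SOME i. b = axis i 1))"
  have k: "k (axis i 1) = c i" for i
  proof -
    have "(SOME j. (axis i 1 :: real^'n) = axis j 1) = i"
      by (rule some_equality) (auto simp: axis_eq_axis)
    then show ?thesis by (simp add: k_def)
  qed
  have B: "(Basis :: (real^'n) set) = range (\<lambda>i. axis i 1)"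
    by (auto simp: Basis_vec_def)
  have inj: "inj (\<lambda>i. axis i 1 :: real^'n)"
    by (auto simp: inj_on_def axis_eq_axis)
  have f: "(\<Sum>b\<in>Basis. (k b * (x \<bullet> b)) *\<^sub>R b) = (\<chi> i. c i * x $ i)" for x :: "real^'n"
  proof -
    have "(\<Sum>b\<in>Basis. (k b * (x \<bullet> b)) *\<^sub>R b) = (\<Sum>i\<in>UNIV. (c i * x $ i) *\<^sub>R axis i 1)"
      unfolding B by (subst sum.reindex[OF inj]) (simp add: k inner_axis)
    also have "\<dots> = (\<chi> i. c i * x $ i)"
      by (simp add: vec_eq_iff axis_def if_distrib[of "\<lambda>x. _ * x"] cong: if_cong)
    finally show ?thesis .
  qed
  have p: "(\<Prod>b\<in>Basis. \<bar>k b\<bar>) = \<bar>\<Prod>i\<in>UNIV. c i\<bar>"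
    unfolding B by (subst prod.reindex[OF inj]) (simp add: k abs_prod)
  have m[measurable]: "(\<lambda>x. \<chi> i. c i * x $ i) \<in> borel_measurable (borel :: (real^'n) measure)"
    by (intro borel_measurable_continuous_onI continuous_intros)
  have "lborel = density (distr lborel borel (\<lambda>x. 0 + (\<Sum>b\<in>Basis. (k b * (x \<bullet> b)) *\<^sub>R b)))
         (\<lambda>_. (\<Prod>b\<in>(Basis::(real^'n) set). \<bar>k b\<bar>))"
    by (rule lborel_affine_euclidean) (auto simp: B k c)
  then have *: "lborel = density (distr lborel borel (\<lambda>x. \<chi> i. c i * x $ i)) (\<lambda>_. ennreal \<bar>\<Prod>i\<in>UNIV. c i\<bar>)"
    by (simp add: f p)
  have "(\<integral>\<^sup>+x. h x \<partial>lborel) = (\<integral>\<^sup>+x. h x \<partial>density (distr lborel borel (\<lambda>x. \<chi> i. c i * x $ i)) (\<lambda>_. ennreal \<bar>\<Prod>i\<in>UNIV. c i\<bar>))"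
    using * by simp
  also have "\<dots> = ennreal \<bar>\<Prod>i\<in>UNIV. c i\<bar> * (\<integral>\<^sup>+x. h (\<chi> i. c i * x $ i) \<partial>lborel)"
    by (subst nn_integral_density; (subst nn_integral_distr)?; (subst nn_integral_cmult)?) auto
  finally show ?thesis by simp
qed

lemma lborel_distr_permute:
  fixes p :: "'n::finite \<Rightarrow> 'n"
  assumes "p permutes UNIV"
  shows "distr lborel borel (\<lambda>x::real^'n. \<chi> i. x $ p i) = lborel"
proof (rule sym, rule lborel_eqI)
  have m[measurable]: "(\<lambda>x::real^'n. \<chi> i. x $ p i) \<in> borel_measurable borel"
    by (intro borel_measurable_continuous_onI continuous_intros)
  fix l u :: "real ^ 'n"
  assume lu: "\<And>b. b \<in> Basis \<Longrightarrow> l \<bullet> b \<le> u \<bullet> b"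
  have lu': "l $ i \<le> u $ i" for i
    using lu[of "axis i 1"] by (simp add: inner_axis)
  let ?q = "inv p"
  have pq: "p (?q i) = i" "?q (p i) = i" for i
    using permutes_inverses[OF assms] by auto
  have pre: "(\<lambda>x. \<chi> i. x $ p i) -` box l u = box (\<chi> i. l $ ?q i) (\<chi> i. u $ ?q i)"
    by (auto simp: mem_box_cart) (metis pq)+
  have inj: "inj (\<lambda>i. axis i 1 :: real^'n)"
    by (auto simp: inj_on_def axis_eq_axis)
  have B: "(Basis :: (real^'n) set) = range (\<lambda>i. axis i 1)"
    by (auto simp: Basis_vec_def)
  have "emeasure (distr lborel borel (\<lambda>x. \<chi> i. x $ p i)) (box l u)
      = emeasure lborel (box (\<chi> i. l $ ?q i) (\<chi> i. u $ ?q i))"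
    by (subst emeasure_distr) (auto simp: pre)
  also have "\<dots> = ennreal (\<Prod>b\<in>Basis. ((\<chi> i. u $ ?q i) - (\<chi> i. l $ ?q i)) \<bullet> b)"
    by (subst emeasure_lborel_box) (auto simp: B inner_axis lu')
  also have "(\<Prod>b\<in>Basis. ((\<chi> i. u $ ?q i) - (\<chi> i. l $ ?q i)) \<bullet> b) = (\<Prod>i\<in>UNIV. u $ ?q i - l $ ?q i)"
    unfolding B by (subst prod.reindex[OF inj]) (simp add: inner_axis)
  also have "\<dots> = (\<Prod>i\<in>UNIV. u $ i - l $ i)"
    using prod.permute[OF permutes_inv[OF assms], of "\<lambda>i. u $ i - l $ i"] by (simp add: o_def)
  also have "\<dots> = (\<Prod>b\<in>Basis. (u - l) \<bullet> b)"
    unfolding B by (subst prod.reindex[OF inj]) (simp add: inner_axis)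
  finally show "emeasure (distr lborel borel (\<lambda>x. \<chi> i. x $ p i)) (box l u)
      = ennreal (\<Prod>b\<in>Basis. (u - l) \<bullet> b)" .
qed simp

text \<open>The identity is preserved under products of matrices, so elementary matrices suffice: diagonal
matrices, transpositions of coordinates, and shears.\<close>

theorem nn_integral_matrix_vector_mult:
  fixes A :: "real ^ 'n ^ 'n" and h :: "real ^ 'n \<Rightarrow> ennreal"
  assumes "det A \<noteq> 0" and "h \<in> borel_measurable borel"
  shows "ennreal \<bar>det A\<bar> * (\<integral>\<^sup>+v. h (A *v v) \<partial>lborel) = (\<integral>\<^sup>+v. h v \<partial>lborel)"
  using assms
proof (induction A arbitrary: h rule: induct_matrix_elementary)
  case (1 A B)
  note [measurable] = \<open>h \<in> borel_measurable borel\<close>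
  have [measurable]: "(\<lambda>v. C *v v) \<in> borel_measurable borel" for C :: "real^'n^'n"
    by (intro borel_measurable_continuous_onI linear_continuous_on matrix_vector_mul_bounded_linear)
  from 1 have d: "det A \<noteq> 0" "det B \<noteq> 0" by (auto simp: det_mul)
  have "ennreal \<bar>det (A ** B)\<bar> * (\<integral>\<^sup>+v. h ((A ** B) *v v) \<partial>lborel)
     = ennreal \<bar>det A\<bar> * (ennreal \<bar>det B\<bar> * (\<integral>\<^sup>+v. h (A *v (B *v v)) \<partial>lborel))"
    by (simp add: det_mul abs_mult ennreal_mult matrix_vector_mul_assoc mult.assoc)
  also have "ennreal \<bar>det B\<bar> * (\<integral>\<^sup>+v. h (A *v (B *v v)) \<partial>lborel) = (\<integral>\<^sup>+v. h (A *v v) \<partial>lborel)"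
    by (rule 1(2)[OF d(2), of "\<lambda>v. h (A *v v)"]) measurable
  also have "ennreal \<bar>det A\<bar> * (\<integral>\<^sup>+v. h (A *v v) \<partial>lborel) = (\<integral>\<^sup>+v. h v \<partial>lborel)"
    by (rule 1(1)[OF d(1)]) measurable
  finally show ?case .
next
  case (2 A i)
  have "det A = 0" by (rule det_zero_row[of i]) (use 2 in auto)
  with 2 show ?case by simp
next
  case (3 A)
  have dA: "det A = (\<Prod>i\<in>UNIV. A $ i $ i)"
    by (rule det_diagonal) (use 3 in auto)
  with 3 have nz: "A $ i $ i \<noteq> 0" for i by auto
  have "A *v v = (\<chi> i. A $ i $ i * v $ i)" for v
  proof -
    have "(\<Sum>j\<in>UNIV. A $ i $ j * v $ j) = (\<Sum>j\<in>UNIV. if j = i then A $ i $ i * v $ i else 0)" for i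
      by (rule sum.cong) (use 3(1) in auto)
    then show ?thesis by (simp add: matrix_vector_mult_def)
  qed
  then show ?case
    using nn_integral_diagonal[OF 3(3), of "\<lambda>i. A $ i $ i"] nz dA by simp
next
  case (4 m n)
  let ?p = "Transposition.transpose m n"
  let ?A = "(\<chi> i j. mat 1 $ i $ ?p j) :: real^'n^'n"
  have pp: "?p permutes UNIV" by (simp add: permutes_swap_id)
  have Av: "?A *v v = (\<chi> i. v $ ?p i)" for v :: "real^'n"
  proof -
    have "(\<Sum>j\<in>UNIV. mat 1 $ i $ ?p j * v $ j) = (\<Sum>j\<in>UNIV. if j = ?p i then v $ j else 0)" for i
      by (rule sum.cong) (auto simp: mat_def)
    then show ?thesis by (simp add: matrix_vector_mult_def)
  qed
  have m[measurable]: "(\<lambda>x::real^'n. \<chi> i. x $ ?p i) \<in> borel_measurable borel"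
    by (intro borel_measurable_continuous_onI continuous_intros)
  have "det ?A = of_int (sign ?p)"
    using det_permute_columns[OF pp, of "mat 1 :: real^'n^'n"] by simp
  then have "\<bar>det ?A\<bar> = 1" by (simp add: sign_def)
  moreover have "(\<integral>\<^sup>+v. h (\<chi> i. v $ ?p i) \<partial>lborel) = (\<integral>\<^sup>+v. h v \<partial>lborel)"
    using nn_integral_distr[OF _ , of "\<lambda>x::real^'n. \<chi> i. x $ ?p i" lborel borel h] m 4
    by (simp add: lborel_distr_permute[OF pp])
  ultimately show ?case by (simp add: Av)
next
  case (5 m n c)
  let ?A = "(\<chi> i j. if i = m \<and> j = n then c else of_bool (i = j)) :: real^'n^'n"
  have Ar: "?A = (\<chi> k. if k = m then row m (mat 1) + c *s row n (mat 1) else row k (mat 1))"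
    using \<open>m \<noteq> n\<close> by (auto simp: vec_eq_iff row_def mat_def)
  have "det ?A = 1"
    unfolding Ar by (subst det_row_operation) (use \<open>m \<noteq> n\<close> in auto)
  moreover have "?A *v v = v + (c * v $ n) *\<^sub>R axis m 1" for v
  proof -
    have "(\<Sum>j\<in>UNIV. ?A $ i $ j * v $ j) = v $ i + (if i = m then c * v $ n else 0)" for i
    proof -
      have "(\<Sum>j\<in>UNIV. ?A $ i $ j * v $ j)
          = (\<Sum>j\<in>UNIV. (if j = i then v $ i else 0) + (if j = n then if i = m then c * v $ n else 0 else 0))"
        by (rule sum.cong) (use \<open>m \<noteq> n\<close> in auto)
      then show ?thesis by (simp add: sum.distrib)
    qed
    then show ?thesis by (simp add: matrix_vector_mult_def vec_eq_iff axis_def)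
  qed
  ultimately show ?case
    using nn_integral_shear[OF 5(3) \<open>m \<noteq> n\<close>] by simp
qed

text \<open>The preimage of the unit ball under \<open>B\<close> is contained in the ball of radius \<open>1 / c\<close>; compare volumes.\<close>

lemma abs_det_ge_power:
  fixes B :: "real ^ 'n ^ 'n"
  assumes "c > 0" and B: "\<And>v. c * norm v \<le> norm (B *v v)"
  shows "c ^ CARD('n) \<le> \<bar>det B\<bar>"
proof -
  have "inj ((*v) B)"
  proof (rule injI)
    fix x y assume "B *v x = B *v y"
    then have "B *v (x - y) = 0" by (simp add: matrix_vector_mult_diff_distrib)
    with B[of "x - y"] \<open>c > 0\<close> show "x = y" by (simp add: mult_le_0_iff)
  qed
  then have d: "det B \<noteq> 0"
    by (metis det_nz_iff_inj matrix_of_matrix_vector_mul matrix_vector_mul_linear)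
  let ?V = "\<lambda>r. measure lborel (ball (0::real^'n) r)"
  have V: "emeasure lborel (ball (0::real^'n) r) = ennreal (?V r)" for r
    using emeasure_lborel_ball_finite[of "0::real^'n" r] by (simp add: emeasure_eq_ennreal_measure)
  have Vs: "?V (1 / c) = (1 / c) ^ CARD('n) * ?V 1"
    using content_ball_conv_unit_ball[of "1 / c" "0::real^'n"] \<open>c > 0\<close> by simp
  have V1: "?V 1 > 0" using content_ball_pos[of 1 "0::real^'n"] by simp
  have m[measurable]: "(\<lambda>v. B *v v) \<in> borel_measurable borel"
    by (intro borel_measurable_continuous_onI linear_continuous_on matrix_vector_mul_bounded_linear)
  have "ennreal (?V 1) = (\<integral>\<^sup>+v. indicator (ball 0 1) v \<partial>(lborel :: (real^'n) measure))"
    by (simp add: V)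
  also have "\<dots> = ennreal \<bar>det B\<bar> * (\<integral>\<^sup>+v. indicator (ball 0 1) (B *v v) \<partial>lborel)"
    by (rule nn_integral_matrix_vector_mult[OF d, symmetric]) (intro borel_measurable_indicator, simp)
  also have "\<dots> \<le> ennreal \<bar>det B\<bar> * (\<integral>\<^sup>+v. indicator (ball 0 (1 / c)) v \<partial>(lborel :: (real^'n) measure))"
  proof (intro mult_left_mono nn_integral_mono)
    fix v
    show "indicator (ball 0 1) (B *v v) \<le> (indicator (ball 0 (1 / c)) v :: ennreal)"
      using B[of v] \<open>c > 0\<close> by (auto simp: indicator_def field_simps)
  qed simp
  also have "\<dots> = ennreal (\<bar>det B\<bar> * ((1 / c) ^ CARD('n) * ?V 1))"
    using \<open>c > 0\<close> by (simp add: V Vs ennreal_mult)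
  finally have "?V 1 \<le> \<bar>det B\<bar> * ((1 / c) ^ CARD('n) * ?V 1)"
    using \<open>c > 0\<close> by (simp add: ennreal_le_iff)
  then show ?thesis using V1 \<open>c > 0\<close> by (simp add: field_simps)
qed

section \<open>The smallest singular value\<close>

lemma inner_transpose_mult:
  fixes A :: "real ^ 'n ^ 'n"
  shows "((transpose A ** A) *v v) \<bullet> w = (A *v v) \<bullet> (A *v w)"
  by (simp add: matrix_vector_mul_assoc[symmetric] transpose_matrix_vector dot_lmul_matrix)

lemma eigenvalue_transpose_mult:
  fixes A :: "real ^ 'n ^ 'n"
  assumes "(transpose A ** A) *v v = l *\<^sub>R v"
  shows "(A *v v) \<bullet> (A *v w) = l * (v \<bullet> w)"
  using inner_transpose_mult[of A v w] assms by simp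

text \<open>Eigenvectors for distinct eigenvalues are orthogonal, hence independent. Finiteness makes the minimum in
the definition of the smallest singular value meaningful.\<close>

lemma finite_eigenvalues_transpose_mult:
  fixes A :: "real ^ 'n ^ 'n"
  shows "finite {l. eigenvalue (transpose A ** A) l}"
proof -
  let ?E = "{l. eigenvalue (transpose A ** A) l}"
  define e where "e l = (SOME v. v \<noteq> 0 \<and> (transpose A ** A) *v v = l *\<^sub>R v)" for l
  have e: "e l \<noteq> 0 \<and> (transpose A ** A) *v e l = l *\<^sub>R e l" if "l \<in> ?E" for l
    unfolding e_def by (rule someI_ex) (use that in \<open>simp add: eigenvalue_def\<close>)
  have orth: "l = l' \<or> e l \<bullet> e l' = 0" if "l \<in> ?E" "l' \<in> ?E" for l l'
  proof -
    have "l * (e l \<bullet> e l') = (A *v e l) \<bullet> (A *v e l')" "l' * (e l' \<bullet> e l) = (A *v e l') \<bullet> (A *v e l)"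
      using eigenvalue_transpose_mult e that by metis+
    then have "(l - l') * (e l \<bullet> e l') = 0" by (simp add: inner_commute algebra_simps)
    then show ?thesis by simp
  qed
  have inj: "inj_on e ?E"
    using orth e by (metis inj_onI inner_eq_zero_iff)
  have "pairwise orthogonal (e ` ?E)"
    unfolding pairwise_def orthogonal_def using orth by blast
  moreover have "0 \<notin> e ` ?E" using e by force
  ultimately have "independent (e ` ?E)" by (rule pairwise_orthogonal_independent)
  then have "finite (e ` ?E)" by (rule independent_imp_finite)
  then show ?thesis using inj by (rule finite_imageD)
qed

text \<open>The smallest singular value is the minimum of \<open>norm (A *v v)\<close> over the unit sphere; this variational
description is the only property of it that is used below.\<close>

lemma smallest_singular_value_attained:
  fixes A :: "real ^ 'n ^ 'n"
  obtains v where "norm v = 1" and "norm (A *v v) = smallest_singular_value A"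
    and "\<And>w. smallest_singular_value A * norm w \<le> norm (A *v w)"
proof -
  have "compact (sphere (0::real^'n) 1)" by simp
  moreover have "sphere (0::real^'n) 1 \<noteq> {}" by simp
  moreover have "continuous_on (sphere 0 1) (\<lambda>v. norm (A *v v))"
    by (intro continuous_on_norm linear_continuous_on matrix_vector_mul_bounded_linear)
  ultimately obtain v where v1: "v \<in> sphere 0 1"
    and vmin: "\<And>w. w \<in> sphere 0 1 \<Longrightarrow> norm (A *v v) \<le> norm (A *v w)"
    using continuous_attains_inf by metis
  define m where "m = norm (A *v v)"
  have v: "norm v = 1" using v1 by simp
  have m: "m * norm w \<le> norm (A *v w)" for w
  proof (cases "w = 0")
    case False
    have "m \<le> norm (A *v ((1 / norm w) *\<^sub>R w))"
      unfolding m_def by (rule vmin) (use False in simp)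
    also have "\<dots> = norm (A *v w) / norm w"
      using False by (simp add: matrix_vector_mult_scaleR)
    finally show ?thesis using False by (simp add: field_simps)
  qed simp
  have m0: "m \<ge> 0" by (simp add: m_def)
  \<comment> \<open>The quadratic form \<open>|A w|\<^sup>2 - m\<^sup>2 |w|\<^sup>2\<close> is nonnegative and vanishes at \<open>v\<close>, hence so does
     its gradient there: \<open>v\<close> is an eigenvector.\<close>
  have crit: "(A *v v) \<bullet> (A *v w) = m\<^sup>2 * (v \<bullet> w)" for w
  proof (rule ccontr)
    define b where "b = (A *v v) \<bullet> (A *v w) - m\<^sup>2 * (v \<bullet> w)"
    define c where "c = (A *v w) \<bullet> (A *v w) - m\<^sup>2 * (w \<bullet> w)"
    assume "(A *v v) \<bullet> (A *v w) \<noteq> m\<^sup>2 * (v \<bullet> w)"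
    then have b: "b \<noteq> 0" by (simp add: b_def)
    have q: "2 * s * b + s\<^sup>2 * c \<ge> 0" for s
    proof -
      have "(m * norm (v + s *\<^sub>R w))\<^sup>2 \<le> (norm (A *v (v + s *\<^sub>R w)))\<^sup>2"
        by (rule power_mono[OF m]) (simp add: m0)
      moreover have "(norm (A *v (v + s *\<^sub>R w)))\<^sup>2
          = m\<^sup>2 + 2 * s * ((A *v v) \<bullet> (A *v w)) + s\<^sup>2 * ((A *v w) \<bullet> (A *v w))"
        unfolding power2_norm_eq_inner matrix_vector_right_distrib matrix_vector_mult_scaleR m_def
        by (simp add: algebra_simps inner_commute power2_eq_square)
      moreover have "(m * norm (v + s *\<^sub>R w))\<^sup>2
          = m\<^sup>2 * (1 + 2 * s * (v \<bullet> w) + s\<^sup>2 * (w \<bullet> w))"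
        using v unfolding power_mult_distrib power2_norm_eq_inner norm_eq_1
        by (simp add: algebra_simps inner_commute power2_eq_square)
      ultimately show ?thesis by (simp add: b_def c_def algebra_simps)
    qed
    define k where "k = \<bar>c\<bar> + 1"
    have k: "k > 0" by (simp add: k_def)
    define s where "s = - b / k"
    have "s\<^sup>2 * c \<le> s\<^sup>2 * k" by (intro mult_left_mono) (auto simp: k_def)
    moreover have "s\<^sup>2 * k = - (s * b)"
      unfolding s_def using k by (simp add: power2_eq_square)
    moreover have "s * b < 0"
    proof -
      have "s * b = - (b\<^sup>2 / k)" by (simp add: s_def power2_eq_square)
      then show ?thesis using b k by simp
    qed
    ultimately show False using q[of s] by linarith
  qed
  have "((transpose A ** A) *v v - m\<^sup>2 *\<^sub>R v) \<bullet> w = 0" for w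
    using crit[of w] by (simp add: inner_diff_left inner_transpose_mult)
  then have "(transpose A ** A) *v v = m\<^sup>2 *\<^sub>R v"
    by (metis eq_iff_diff_eq_0 inner_eq_zero_iff)
  moreover have "v \<noteq> 0" using v by force
  ultimately have ev: "eigenvalue (transpose A ** A) (m\<^sup>2)"
    unfolding eigenvalue_def by blast
  have "singular_values A = sqrt ` {l. eigenvalue (transpose A ** A) l}"
    unfolding singular_values_def by auto
  then have fin: "finite (singular_values A)"
    by (simp only: finite_imageI[OF finite_eigenvalues_transpose_mult])
  have "smallest_singular_value A = m"
    unfolding smallest_singular_value_def
  proof (rule Min_eqI[OF fin])
    show "m \<in> singular_values A"
      unfolding singular_values_def using ev m0 by (force intro!: exI[of _ "m\<^sup>2"])
  next
    fix y assume "y \<in> singular_values A"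
    then obtain l where y: "y = sqrt l" and "eigenvalue (transpose A ** A) l"
      unfolding singular_values_def by auto
    then obtain u where u: "u \<noteq> 0" "(transpose A ** A) *v u = l *\<^sub>R u"
      unfolding eigenvalue_def by auto
    have "(m * norm u)\<^sup>2 \<le> (norm (A *v u))\<^sup>2"
      by (rule power_mono[OF m]) (simp add: m0)
    also have "\<dots> = l * (norm u)\<^sup>2"
      using eigenvalue_transpose_mult[OF u(2), of u] by (simp add: power2_norm_eq_inner)
    finally have "m\<^sup>2 \<le> l" using u(1) by (simp add: power_mult_distrib)
    then show "m \<le> y" unfolding y by (rule real_le_rsqrt)
  qed
  then show thesis using that[of v] v m by (simp add: m_def)
qed

lemma smallest_singular_value_le:
  "smallest_singular_value A * norm w \<le> norm (A *v w)"
  using smallest_singular_value_attained by metis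

lemma smallest_singular_value_greatest:
  fixes A :: "real ^ 'n ^ 'n"
  assumes "\<And>v. c * norm v \<le> norm (A *v v)"
  shows "c \<le> smallest_singular_value A"
  by (metis assms mult_1_right smallest_singular_value_attained)

lemma smallest_singular_value_nonneg: "smallest_singular_value A \<ge> 0"
  by (metis norm_ge_zero smallest_singular_value_attained)

lemma smallest_singular_value_pos:
  assumes "invertible A"
  shows "smallest_singular_value A > 0"
proof -
  obtain v where v: "norm v = 1" "norm (A *v v) = smallest_singular_value A"
    using smallest_singular_value_attained by metis
  obtain B where "B ** A = mat 1" using assms invertible_def by blast
  then have "B *v (A *v v) = v" by (simp add: matrix_vector_mul_assoc)
  with v(1) have "A *v v \<noteq> 0" by force
  then show ?thesis using v(2) by (metis zero_less_norm_iff)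
qed

lemma smallest_singular_value_mult:
  fixes A B :: "real ^ 'n ^ 'n"
  shows "smallest_singular_value A * smallest_singular_value B \<le> smallest_singular_value (A ** B)"
proof (rule smallest_singular_value_greatest)
  fix v
  have "smallest_singular_value A * (smallest_singular_value B * norm v)
      \<le> smallest_singular_value A * norm (B *v v)"
    by (intro mult_left_mono smallest_singular_value_le smallest_singular_value_nonneg)
  also have "\<dots> \<le> norm (A *v (B *v v))" by (rule smallest_singular_value_le)
  finally show "smallest_singular_value A * smallest_singular_value B * norm v \<le> norm ((A ** B) *v v)"
    by (simp add: matrix_vector_mul_assoc mult.assoc)
qed

definition singular_weight :: "real \<Rightarrow> real ^ 'n ^ 'n \<Rightarrow> real" where
  "singular_weight t A = smallest_singular_value A powr t * \<bar>det A\<bar>"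

lemma singular_weight_nonneg: "singular_weight t A \<ge> 0"
  by (simp add: singular_weight_def)

lemma singular_weight_pos: "invertible A \<Longrightarrow> singular_weight t A > 0"
  unfolding singular_weight_def
  using smallest_singular_value_pos[of A] invertible_det_nz[of A] by simp

text \<open>Supermultiplicativity of the terms of the sums that define the critical exponent.\<close>

lemma singular_weight_mult:
  assumes "t \<ge> 0"
  shows "singular_weight t A * singular_weight t B \<le> singular_weight t (A ** B)"
proof -
  have "smallest_singular_value A powr t * smallest_singular_value B powr t
      = (smallest_singular_value A * smallest_singular_value B) powr t"
    by (simp add: powr_mult smallest_singular_value_nonneg)
  also have "\<dots> \<le> smallest_singular_value (A ** B) powr t"
    by (intro powr_mono2 assms smallest_singular_value_mult mult_nonneg_nonneg smallest_singular_value_nonneg)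
  finally have "smallest_singular_value A powr t * smallest_singular_value B powr t * (\<bar>det A\<bar> * \<bar>det B\<bar>)
      \<le> smallest_singular_value (A ** B) powr t * (\<bar>det A\<bar> * \<bar>det B\<bar>)"
    by (rule mult_right_mono) simp
  then show ?thesis
    unfolding singular_weight_def det_mul abs_mult by (simp only: ac_simps)
qed

section \<open>Finite differences of a Gaussian\<close>

text \<open>The sign is such that the value at \<open>z\<close> itself has coefficient \<open>1\<close>.\<close>

definition fdiff :: "nat \<Rightarrow> 'a::real_vector \<Rightarrow> ('a \<Rightarrow> real) \<Rightarrow> 'a \<Rightarrow> real" where
  "fdiff M w f z = (\<Sum>j\<le>M. (-1) ^ j * real (M choose j) * f (z + real j *\<^sub>R w))"

lemma fdiff_0 [simp]: "fdiff 0 w f z = f z"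
  by (simp add: fdiff_def)

lemma fdiff_Suc: "fdiff (Suc M) w f z = fdiff M w f z - fdiff M w f (z + w)"
proof -
  let ?t = "\<lambda>c j. (-1) ^ j * real c * f (z + real j *\<^sub>R w)"
  have "fdiff (Suc M) w f z = ?t 1 0 + (\<Sum>j\<le>M. ?t (Suc M choose Suc j) (Suc j))"
    unfolding fdiff_def by (subst sum.atMost_Suc_shift) simp
  also have "(\<Sum>j\<le>M. ?t (Suc M choose Suc j) (Suc j))
      = (\<Sum>j\<le>M. ?t (M choose Suc j) (Suc j)) + (\<Sum>j\<le>M. ?t (M choose j) (Suc j))"
    unfolding sum.distrib[symmetric] by (rule sum.cong) (simp_all add: algebra_simps)
  also have "(\<Sum>j\<le>M. ?t (M choose j) (Suc j)) = - fdiff M w f (z + w)"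
    unfolding fdiff_def sum_negf[symmetric] by (rule sum.cong) (auto simp: algebra_simps)
  also have "(\<Sum>j\<le>M. ?t (M choose Suc j) (Suc j)) = (\<Sum>j\<le>Suc M. ?t (M choose j) j) - ?t 1 0"
    by (subst sum.atMost_Suc_shift) simp
  also have "(\<Sum>j\<le>Suc M. ?t (M choose j) j) = fdiff M w f z"
    by (simp add: fdiff_def)
  finally show ?thesis by simp
qed

lemma fdiff_diff: "fdiff M w (\<lambda>z. f z - g z) z = fdiff M w f z - fdiff M w g z"
  by (simp add: fdiff_def sum_subtractf right_diff_distrib)

lemma fdiff_shift: "fdiff M w (\<lambda>z. f (z + u)) z = fdiff M w f (z + u)"
  by (simp add: fdiff_def algebra_simps)

text \<open>The mean value theorem, iterated: a difference of order \<open>Suc M\<close> of \<open>g 0\<close> is a difference of order \<open>M\<close> of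
the increment of \<open>g 0\<close>, and the derivatives of the increment are the increments of the derivatives.\<close>

lemma fdiff_mean_value:
  fixes g :: "nat \<Rightarrow> real \<Rightarrow> real"
  assumes "\<And>k x. (g k has_real_derivative g (Suc k) x) (at x)" and "h > 0"
  shows "\<exists>\<xi>\<in>{x..x + M * h}. fdiff M h (g 0) x = (- h) ^ M * g M \<xi>"
  using assms(1)
proof (induction M arbitrary: g)
  case 0
  then show ?case by simp
next
  case (Suc M)
  define G where "G k x = g k x - g k (x + h)" for k x
  have "(G k has_real_derivative G (Suc k) x) (at x)" for k x
    unfolding G_def
    by (intro DERIV_diff Suc.prems) (use Suc.prems[of k "x + h"] in \<open>simp add: DERIV_shift\<close>)
  then obtain \<xi> where \<xi>: "\<xi> \<in> {x..x + M * h}" "fdiff M h (G 0) x = (- h) ^ M * G M \<xi>"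
    using Suc.IH by metis
  have "\<exists>z>\<xi>. z < \<xi> + h \<and> g M (\<xi> + h) - g M \<xi> = (\<xi> + h - \<xi>) * g (Suc M) z"
    using \<open>h > 0\<close> by (intro MVT2) (auto intro: Suc.prems)
  then obtain z where z: "\<xi> < z" "z < \<xi> + h" "G M \<xi> = - h * g (Suc M) z"
    unfolding G_def by auto
  have "fdiff (Suc M) h (g 0) x = fdiff M h (G 0) x"
    unfolding fdiff_Suc G_def fdiff_diff by (simp add: fdiff_shift[symmetric])
  then have "fdiff (Suc M) h (g 0) x = (- h) ^ Suc M * g (Suc M) z"
    using \<xi>(2) z(3) by simp
  moreover have "z \<in> {x..x + Suc M * h}"
    using \<xi>(1) z(1,2) by (auto simp: algebra_simps)
  ultimately show ?case by blast
qed

text \<open>Each degree is paid for by half of the Gaussian, which is why \<open>c\<close> varies in the induction.\<close>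

lemma poly_mult_gaussian_bounded:
  fixes p :: "real poly"
  assumes "c > 0"
  shows "\<exists>C. \<forall>x. \<bar>poly p x\<bar> * exp (- c * x\<^sup>2) \<le> C"
  using assms
proof (induction p arbitrary: c)
  case 0
  then show ?case by auto
next
  case (pCons a p)
  obtain C where C: "\<And>x. \<bar>poly p x\<bar> * exp (- (c/2) * x\<^sup>2) \<le> C"
    using pCons.IH[of "c/2"] pCons.prems by auto
  have "\<bar>poly (pCons a p) x\<bar> * exp (- c * x\<^sup>2) \<le> \<bar>a\<bar> + (1 + 2 / c) * C" for x
  proof -
    define E where "E = exp (- (c/2) * x\<^sup>2)"
    have E: "exp (- c * x\<^sup>2) = E * E" "E > 0" "E \<le> 1"
      using \<open>c > 0\<close> by (auto simp: E_def exp_add[symmetric])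
    have "\<bar>x\<bar> \<le> 1 + x\<^sup>2"
    proof -
      have "0 \<le> (\<bar>x\<bar> - 1)\<^sup>2" "0 \<le> \<bar>x\<bar>" by auto
      then show ?thesis unfolding power2_diff power2_abs by simp
    qed
    also have "x\<^sup>2 \<le> 2 / c * exp ((c/2) * x\<^sup>2)"
      using exp_ge_add_one_self[of "(c/2) * x\<^sup>2"] \<open>c > 0\<close> by (simp add: field_simps)
    finally have "\<bar>x\<bar> * E \<le> (1 + 2 / c * exp ((c/2) * x\<^sup>2)) * E"
      using E by (intro mult_right_mono) auto
    also have "\<dots> = E + 2 / c" by (simp add: E_def algebra_simps exp_minus)
    also have "\<dots> \<le> 1 + 2 / c" using E by simp
    finally have xE: "\<bar>x\<bar> * E \<le> 1 + 2 / c" .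
    have "\<bar>poly (pCons a p) x\<bar> * exp (- c * x\<^sup>2) \<le> (\<bar>a\<bar> + \<bar>x\<bar> * \<bar>poly p x\<bar>) * (E * E)"
      unfolding E(1) poly_pCons abs_mult[symmetric] using E by (intro mult_right_mono abs_triangle_ineq) auto
    also have "\<dots> = \<bar>a\<bar> * (E * E) + (\<bar>x\<bar> * E) * (\<bar>poly p x\<bar> * E)" by (simp add: algebra_simps)
    also have "\<dots> \<le> \<bar>a\<bar> * 1 + (1 + 2 / c) * C"
      using E C[of x] xE \<open>c > 0\<close> unfolding E_def[symmetric]
      by (intro add_mono mult_mono) (auto intro: mult_le_one)
    finally show ?thesis by simp
  qed
  then show ?case by blast
qed

lemma gaussian_derivatives:
  obtains p :: "nat \<Rightarrow> real poly" where "p 0 = 1"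
    and "\<And>k x. ((\<lambda>x. poly (p k) x * exp (- x\<^sup>2)) has_real_derivative
            poly (p (Suc k)) x * exp (- x\<^sup>2)) (at x)"
proof -
  define p where "p = rec_nat (1::real poly) (\<lambda>_ q. pderiv q - [:0, 2:] * q)"
  have "((\<lambda>x. poly (p k) x * exp (- x\<^sup>2)) has_real_derivative
            poly (p (Suc k)) x * exp (- x\<^sup>2)) (at x)" for k x
    unfolding p_def by (auto intro!: derivative_eq_intros simp: algebra_simps)
  moreover have "p 0 = 1" by (simp add: p_def)
  ultimately show thesis using that by blast
qed

text \<open>Along the line through \<open>a\<close> in direction \<open>h\<close> the Gaussian is a one-dimensional Gaussian times a factor
that is constant on the line. Weakening the coefficient in the exponent from \<open>1\<close> to \<open>1/4\<close> absorbs both the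
polynomial factor of the derivative and the displacement, at most \<open>1\<close>, of the intermediate point.\<close>

lemma fdiff_gaussian_bound:
  obtains C where "C \<ge> 0" and "\<And>a h :: 'p::euclidean_space. real M * norm h \<le> 1 \<Longrightarrow>
     \<bar>fdiff M h (\<lambda>a. exp (- (norm a)\<^sup>2)) a\<bar> \<le> C * norm h ^ M * exp (- (norm a)\<^sup>2 / 4)"
proof -
  obtain p :: "nat \<Rightarrow> real poly" where p0: "p 0 = 1"
    and p: "\<And>k x. ((\<lambda>x. poly (p k) x * exp (- x\<^sup>2)) has_real_derivative
            poly (p (Suc k)) x * exp (- x\<^sup>2)) (at x)"
    using gaussian_derivatives by metis
  obtain K where K: "\<And>x. \<bar>poly (p M) x\<bar> * exp (- (1/2) * x\<^sup>2) \<le> K"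
    using poly_mult_gaussian_bounded[of "1/2" "p M"] by auto
  have K0: "K \<ge> 0" using K[of 0] by (meson abs_ge_zero exp_ge_zero mult_nonneg_nonneg order_trans)
  have "\<bar>fdiff M h (\<lambda>a. exp (- (norm a)\<^sup>2)) a\<bar> \<le> max 1 (K * exp (1/2)) * norm h ^ M * exp (- (norm a)\<^sup>2 / 4)"
    if h: "real M * norm h \<le> 1" for a h :: 'p
  proof (cases "h = 0")
    case True
    show ?thesis
    proof (cases M)
      case 0
      then show ?thesis by (auto intro!: order_trans[OF _ mult_right_mono[OF max.cobounded1]])
    next
      case (Suc n)
      then show ?thesis using True by (simp add: fdiff_Suc)
    qed
  next
    case False
    define e where "e = (1 / norm h) *\<^sub>R h"
    define \<tau> where "\<tau> = a \<bullet> e"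
    have e: "norm e = 1" "h = norm h *\<^sub>R e" using False by (auto simp: e_def)
    have sq: "(norm (a + s *\<^sub>R h))\<^sup>2 = ((norm a)\<^sup>2 - \<tau>\<^sup>2) + (\<tau> + s * norm h)\<^sup>2" for s
    proof -
      have "(norm (a + (s * norm h) *\<^sub>R e))\<^sup>2 = (norm a)\<^sup>2 + 2 * (s * norm h) * \<tau> + (s * norm h)\<^sup>2"
        using e(1) unfolding power2_norm_eq_inner norm_eq_1 \<tau>_def
        by (simp add: algebra_simps inner_commute power2_eq_square)
      moreover have "(s * norm h) *\<^sub>R e = s *\<^sub>R h" by (subst e(2)) simp
      ultimately show ?thesis by (simp add: power2_sum algebra_simps)
    qed
    have \<tau>: "\<tau>\<^sup>2 \<le> (norm a)\<^sup>2"
      unfolding \<tau>_def using Cauchy_Schwarz_ineq2[of a e] e(1)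
      by (metis abs_le_square_iff abs_norm_cancel mult.right_neutral)
    define g where "g k x = poly (p k) x * exp (- x\<^sup>2)" for k x
    obtain \<xi> where \<xi>: "\<xi> \<in> {\<tau>..\<tau> + M * norm h}" "fdiff M (norm h) (g 0) \<tau> = (- norm h) ^ M * g M \<xi>"
      using fdiff_mean_value[of g "norm h" \<tau> M] p False unfolding g_def by auto
    have "fdiff M h (\<lambda>a. exp (- (norm a)\<^sup>2)) a = exp (- ((norm a)\<^sup>2 - \<tau>\<^sup>2)) * fdiff M (norm h) (g 0) \<tau>"
      unfolding fdiff_def sq g_def p0 sum_distrib_left
      by (rule sum.cong) (simp_all add: exp_add[symmetric] mult_ac)
    then have "\<bar>fdiff M h (\<lambda>a. exp (- (norm a)\<^sup>2)) a\<bar>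
        = norm h ^ M * (exp (- ((norm a)\<^sup>2 - \<tau>\<^sup>2)) * \<bar>g M \<xi>\<bar>)"
      by (simp add: \<xi>(2) abs_mult power_abs)
    also have "\<bar>g M \<xi>\<bar> = (\<bar>poly (p M) \<xi>\<bar> * exp (- (1/2) * \<xi>\<^sup>2)) * exp (- (1/2) * \<xi>\<^sup>2)"
      by (simp add: g_def abs_mult mult.assoc exp_add[symmetric])
    also have "\<dots> \<le> K * exp (- (1/2) * \<xi>\<^sup>2)" by (intro mult_right_mono K) simp
    also have "\<dots> \<le> K * exp (1/2 - \<tau>\<^sup>2 / 4)"
    proof -
      have "\<bar>\<xi> - \<tau>\<bar> \<le> 1" using \<xi>(1) h by auto
      then have "(\<xi> - \<tau>)\<^sup>2 \<le> 1" by (simp add: abs_square_le_1)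
      moreover have "\<tau>\<^sup>2 \<le> 2 * \<xi>\<^sup>2 + 2 * (\<xi> - \<tau>)\<^sup>2"
        using zero_le_power2[of "2 * \<xi> - \<tau>"] by (simp add: power2_eq_square algebra_simps)
      ultimately have "- (1/2) * \<xi>\<^sup>2 \<le> 1/2 - \<tau>\<^sup>2 / 4" by simp
      then show ?thesis using K0 by (intro mult_left_mono) auto
    qed
    finally have "\<bar>fdiff M h (\<lambda>a. exp (- (norm a)\<^sup>2)) a\<bar>
        \<le> norm h ^ M * (exp (- ((norm a)\<^sup>2 - \<tau>\<^sup>2)) * (K * exp (1/2 - \<tau>\<^sup>2 / 4)))"
      by (simp add: mult_left_mono)
    also have "\<dots> = norm h ^ M * (K * exp (1/2) * exp (- ((norm a)\<^sup>2 - \<tau>\<^sup>2) - \<tau>\<^sup>2 / 4))"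
      by (simp add: exp_add[symmetric] exp_diff exp_minus field_simps)
    also have "\<dots> \<le> norm h ^ M * (max 1 (K * exp (1/2)) * exp (- (norm a)\<^sup>2 / 4))"
      using \<tau> K0 by (intro mult_left_mono mult_mono) auto
    finally show ?thesis by (simp add: mult_ac)
  qed
  then show thesis using that[of "max 1 (K * exp (1/2))"] by auto
qed

lemma nn_integral_exp_minus_abs: "(\<integral>\<^sup>+x. ennreal (exp (- \<bar>x\<bar>)) \<partial>(lborel :: real measure)) < \<infinity>"
proof -
  let ?f = "\<lambda>x::real. ennreal (exp (- x)) * indicator {0..} x"
  have 1: "(\<integral>\<^sup>+x. ?f x \<partial>lborel) = ennreal 1"
    by (rule nn_integral_has_integral_lebesgue') 
       (use has_integral_exp_minus_to_infinity[of 1 0] in auto)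
  have "(\<integral>\<^sup>+x. ?f (- x) \<partial>lborel) = (\<integral>\<^sup>+x. ?f x \<partial>lborel)"
    using nn_integral_distr[of uminus lborel borel ?f] by (simp add: lborel_distr_uminus)
  moreover have "(\<integral>\<^sup>+x. ennreal (exp (- \<bar>x\<bar>)) \<partial>lborel) \<le> (\<integral>\<^sup>+x. ?f x + ?f (- x) \<partial>lborel)"
    by (rule nn_integral_mono) (auto simp: indicator_def)
  ultimately show ?thesis
    using 1 by (simp add: nn_integral_add ennreal_add_less_top less_le_trans order.strict_trans1 del: ennreal_1)
qed

lemma nn_integral_gaussian_finite:
  assumes "c > 0"
  shows "(\<integral>\<^sup>+a. ennreal (exp (- c * (norm a)\<^sup>2)) \<partial>(lborel :: 'p::euclidean_space measure)) < \<infinity>"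
proof -
  have 1: "(\<integral>\<^sup>+x. ennreal (exp (- c * x\<^sup>2)) \<partial>(lborel :: real measure)) < \<infinity>"
  proof -
    have le: "exp (- c * x\<^sup>2) \<le> exp (1 / (4 * c)) * exp (- \<bar>x\<bar>)" for x :: real
    proof -
      have "0 \<le> (2 * c * \<bar>x\<bar> - 1)\<^sup>2 / (4 * c)" using assms by simp
      also have "\<dots> = c * x\<^sup>2 - \<bar>x\<bar> + 1 / (4 * c)"
        using assms by (simp add: power2_diff power_mult_distrib field_simps power2_eq_square)
      finally have "exp (- c * x\<^sup>2) \<le> exp (1 / (4 * c) + - \<bar>x\<bar>)" by simp
      then show ?thesis by (simp only: exp_add)
    qed
    have "(\<integral>\<^sup>+x. ennreal (exp (- c * x\<^sup>2)) \<partial>(lborel :: real measure))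
        \<le> (\<integral>\<^sup>+x. ennreal (exp (1 / (4 * c))) * ennreal (exp (- \<bar>x\<bar>)) \<partial>(lborel :: real measure))"
      by (rule nn_integral_mono) (use le in \<open>simp add: ennreal_mult[symmetric]\<close>)
    also have "\<dots> < \<infinity>"
      by (subst nn_integral_cmult) (auto simp: ennreal_mult_less_top nn_integral_exp_minus_abs[simplified])
    finally show ?thesis .
  qed
  have n: "(norm a)\<^sup>2 = (\<Sum>b\<in>Basis. (a \<bullet> b)\<^sup>2)" for a :: 'p
    unfolding power2_norm_eq_inner by (subst euclidean_inner) (simp add: power2_eq_square)
  have "(\<integral>\<^sup>+a. ennreal (exp (- c * (norm a)\<^sup>2)) \<partial>(lborel :: 'p measure))
      = (\<integral>\<^sup>+a. (\<Prod>b\<in>Basis. ennreal (exp (- c * (a \<bullet> b)\<^sup>2))) \<partial>(lborel :: 'p measure))"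
    by (rule nn_integral_cong) (simp add: n sum_distrib_left exp_sum prod_ennreal sum_negf[symmetric])
  also have "\<dots> = (\<Prod>b\<in>(Basis::'p set). (\<integral>\<^sup>+x. ennreal (exp (- c * x\<^sup>2)) \<partial>lborel))"
    by (rule nn_integral_lborel_prod) auto
  also have "\<dots> < \<infinity>"
  proof -
    obtain r where "r \<ge> 0" "(\<integral>\<^sup>+x. ennreal (exp (- c * x\<^sup>2)) \<partial>(lborel :: real measure)) = ennreal r"
      using 1 by (cases "\<integral>\<^sup>+x. ennreal (exp (- c * x\<^sup>2)) \<partial>(lborel :: real measure)") auto
    then show ?thesis by (simp add: ennreal_power)
  qed
  finally show ?thesis .
qed

section \<open>Test functions\<close>

definition test_function :: "('a::euclidean_space \<Rightarrow> real) \<Rightarrow> bool" where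
  "test_function h \<longleftrightarrow> continuous_on UNIV h \<and> (\<exists>R. \<forall>u. R < norm u \<longrightarrow> h u = 0)"

lemma test_function_continuous: "test_function h \<Longrightarrow> continuous_on UNIV h"
  by (simp add: test_function_def)

lemma test_function_measurable: "test_function h \<Longrightarrow> h \<in> borel_measurable borel"
  by (intro borel_measurable_continuous_onI test_function_continuous)

lemma test_function_bounded:
  assumes "test_function h"
  obtains B where "B \<ge> 0" and "\<And>u. \<bar>h u\<bar> \<le> B"
proof -
  obtain R where R: "\<And>u. R < norm u \<Longrightarrow> h u = 0" and c: "continuous_on UNIV h"
    using assms by (auto simp: test_function_def)
  have "compact (h ` cball 0 R)"
    by (intro compact_continuous_image continuous_on_subset[OF c]) auto
  then obtain B where B: "\<And>u. u \<in> cball 0 R \<Longrightarrow> \<bar>h u\<bar> \<le> B"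
    using compact_imp_bounded bounded_real by (metis (no_types, lifting) imageI)
  have "\<bar>h u\<bar> \<le> max B 0" for u
    using B[of u] R[of u] by (cases "norm u \<le> R") auto
  then show thesis using that[of "max B 0"] by auto
qed

lemma test_function_support:
  assumes "test_function h"
  obtains R where "R > 0" and "\<And>u. R < norm u \<Longrightarrow> h u = 0"
proof -
  obtain R where R: "\<And>u. R < norm u \<Longrightarrow> h u = 0" 
    using assms by (auto simp: test_function_def)
  show thesis by (rule that[of "max R 1"]) (auto intro: R)
qed

lemma test_function_integrable:
  assumes "test_function h"
  shows "integrable lborel h"
proof -
  obtain R where R: "\<And>u. R < norm u \<Longrightarrow> h u = 0" and c: "continuous_on UNIV h"
    using assms by (auto simp: test_function_def)
  have "set_integrable lborel (cball 0 R) h"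
    unfolding set_integrable_def
    by (rule borel_integrable_compact) (auto intro: continuous_on_subset[OF c])
  moreover have "(\<lambda>u. indicator (cball 0 R) u *\<^sub>R h u) = h"
    using R by (auto simp: indicator_def fun_eq_iff)
  ultimately show ?thesis by (simp add: set_integrable_def)
qed

lemma test_function_diff: "test_function f \<Longrightarrow> test_function g \<Longrightarrow> test_function (\<lambda>u. f u - g u)"
  unfolding test_function_def
  by (auto intro!: continuous_on_diff) (metis diff_self max_less_iff_conj)

lemma test_function_add: "test_function f \<Longrightarrow> test_function g \<Longrightarrow> test_function (\<lambda>u. f u + g u)"
  unfolding test_function_def
  by (auto intro!: continuous_on_add) (metis add_0 max_less_iff_conj)

lemma test_function_mult:
  "test_function f \<Longrightarrow> continuous_on UNIV g \<Longrightarrow> test_function (\<lambda>u. f u * g u)"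
  unfolding test_function_def by (auto intro!: continuous_on_mult)

lemma test_function_cmult: "test_function f \<Longrightarrow> test_function (\<lambda>u. c * f u)"
  unfolding test_function_def by (auto intro!: continuous_intros)

lemma test_function_sum:
  assumes "finite A" "\<And>i. i \<in> A \<Longrightarrow> test_function (f i)"
  shows "test_function (\<lambda>u. \<Sum>i\<in>A. f i u)"
  using assms
proof (induction A rule: finite_induct)
  case empty
  then show ?case by (simp add: test_function_def)
next
  case (insert x F)
  then show ?case by (simp add: test_function_add)
qed

lemma test_function_abs: "test_function f \<Longrightarrow> test_function (\<lambda>u. \<bar>f u\<bar>)"
  unfolding test_function_def by (auto intro!: continuous_intros)

lemma test_function_shift:
  assumes "test_function f"
  shows "test_function (\<lambda>u. f (u + c))"
proof -
  obtain R where R: "\<And>u. R < norm u \<Longrightarrow> f u = 0" and c: "continuous_on UNIV f"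
    using assms by (auto simp: test_function_def)
  have "f (u + c) = 0" if "R + norm c < norm u" for u
    by (rule R) (use that norm_triangle_ineq4[of "u + c" c] in simp)
  moreover have "continuous_on UNIV (\<lambda>u. f (u + c))"
    by (rule continuous_on_compose2[OF c]) (auto intro!: continuous_intros)
  ultimately show ?thesis unfolding test_function_def by blast
qed

lemma test_function_scale:
  assumes "test_function f" "c \<noteq> 0"
  shows "test_function (\<lambda>u. f (c *\<^sub>R u))"
proof -
  obtain R where R: "\<And>u. R < norm u \<Longrightarrow> f u = 0" and k: "continuous_on UNIV f"
    using assms by (auto simp: test_function_def)
  have "f (c *\<^sub>R u) = 0" if "R / \<bar>c\<bar> < norm u" for u
    by (rule R) (use that assms(2) in \<open>simp add: field_simps\<close>)
  moreover have "continuous_on UNIV (\<lambda>u. f (c *\<^sub>R u))"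
    by (rule continuous_on_compose2[OF k]) (auto intro!: continuous_intros)
  ultimately show ?thesis unfolding test_function_def by blast
qed

section \<open>Averages over a transversal family of linear maps\<close>

text \<open>Think of \<open>\<zeta>\<close> as a random vector that depends linearly on the parameter, and of \<open>\<iota>\<close> as directions in which
the parameter can be moved so that \<open>\<zeta>\<close> moves by the invertible matrix \<open>S\<close>. Any absolute constant could
take the place of \<open>2\<close>; this one fits the shifts used for self-affine sets.\<close>

definition transversal ::
    "('p::euclidean_space \<Rightarrow> real ^ 'n) \<Rightarrow> (real ^ 'n \<Rightarrow> 'p) \<Rightarrow> real ^ 'n ^ 'n \<Rightarrow> bool" where
  "transversal \<zeta> \<iota> S \<longleftrightarrow> linear \<zeta> \<and> linear \<iota> \<and> (\<forall>v. norm (\<iota> v) \<le> 2 * norm v) \<and>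
     (\<forall>v. \<zeta> (\<iota> v) = S *v v) \<and> det S \<noteq> 0"

lemma borel_measurable_linear:
  fixes f :: "'a::euclidean_space \<Rightarrow> 'b::euclidean_space"
  shows "linear f \<Longrightarrow> f \<in> borel_measurable borel"
  by (intro borel_measurable_continuous_onI linear_continuous_on linear_conv_bounded_linear[THEN iffD1])

text \<open>If the parameter has a Gaussian density, then \<open>\<zeta>\<close> has a density bounded by \<open>C / \<bar>det S\<bar>\<close>. Replacing
\<open>a\<close> by \<open>a + \<iota> v\<close> does not change the integral; averaging over \<open>v\<close> in the unit ball and bounding the shifted
Gaussian by a wider one that is independent of \<open>v\<close>, the integral over \<open>v\<close> becomes a linear
change of variables by \<open>S\<close>. The order of the quantifiers matters: \<open>C\<close> is uniform in \<open>\<zeta>\<close>, \<open>\<iota>\<close> and \<open>S\<close>.\<close>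

lemma gaussian_average_density:
  obtains C where "C \<ge> 0" and "\<And>(\<zeta> :: 'p::euclidean_space \<Rightarrow> real ^ 'n) \<iota> S h.
    transversal \<zeta> \<iota> S \<Longrightarrow> h \<in> borel_measurable borel \<Longrightarrow>
    (\<integral>\<^sup>+a. ennreal (exp (- (norm a)\<^sup>2 / 4)) * h (\<zeta> a) \<partial>lborel)
       \<le> ennreal (C / \<bar>det S\<bar>) * (\<integral>\<^sup>+v. h v \<partial>lborel)"
proof -
  let ?G8 = "\<lambda>a::'p. exp (- (1/8) * (norm a)\<^sup>2)"
  define V where "V = measure lborel (ball (0::real^'n) 1)"
  have V: "emeasure lborel (ball (0::real^'n) 1) = ennreal V"
    using emeasure_lborel_ball_finite[of "0::real^'n" 1] by (simp add: emeasure_eq_ennreal_measure V_def)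
  have V0: "V > 0" using content_ball_pos[of 1 "0::real^'n"] by (simp add: V_def)
  define I where "I = enn2real (\<integral>\<^sup>+a. ennreal (?G8 a) \<partial>lborel)"
  have I: "(\<integral>\<^sup>+a. ennreal (?G8 a) \<partial>lborel) = ennreal I"
    using nn_integral_gaussian_finite[of "1/8", where 'p='p] by (simp add: I_def less_top)
  have I0: "I \<ge> 0" by (simp add: I_def)
  have "(\<integral>\<^sup>+a. ennreal (exp (- (norm a)\<^sup>2 / 4)) * h (\<zeta> a) \<partial>lborel)
       \<le> ennreal (exp 1 * I / V / \<bar>det S\<bar>) * (\<integral>\<^sup>+v. h v \<partial>lborel)"
    if tr: "transversal \<zeta> \<iota> S" and h[measurable]: "h \<in> borel_measurable borel"
    for \<zeta> :: "'p \<Rightarrow> real ^ 'n" and \<iota> S h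
  proof -
    let ?G = "\<lambda>a::'p. ennreal (exp (- (norm a)\<^sup>2 / 4))"
    have \<zeta>: "linear \<zeta>" "\<And>v. \<zeta> (\<iota> v) = S *v v" and \<iota>: "linear \<iota>" "\<And>v. norm (\<iota> v) \<le> 2 * norm v"
      and S: "det S \<noteq> 0" using tr by (auto simp: transversal_def)
    have m[measurable]: "\<zeta> \<in> borel_measurable borel" "\<iota> \<in> borel_measurable borel" "(\<lambda>v. S *v v) \<in> borel_measurable borel"
      by (intro borel_measurable_linear \<zeta> \<iota> matrix_vector_mul_linear)+
    have ind[measurable]: "(indicator (ball 0 1) :: real^'n \<Rightarrow> ennreal) \<in> borel_measurable borel"
      by (intro borel_measurable_indicator) simp
    have lin: "(\<integral>\<^sup>+v. h (z + S *v v) \<partial>lborel) = ennreal (1 / \<bar>det S\<bar>) * (\<integral>\<^sup>+v. h v \<partial>lborel)" for z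
    proof -
      have "ennreal \<bar>det S\<bar> * (\<integral>\<^sup>+v. h (z + S *v v) \<partial>lborel) = (\<integral>\<^sup>+v. h (z + v) \<partial>lborel)"
        by (rule nn_integral_matrix_vector_mult[OF S, of "\<lambda>v. h (z + v)"]) measurable
      also have "\<dots> = (\<integral>\<^sup>+v. h v \<partial>lborel)"
        using nn_integral_lborel_shift[OF h, of z] by (simp add: add.commute)
      finally have "ennreal (1 / \<bar>det S\<bar>) * (\<integral>\<^sup>+v. h v \<partial>lborel)
          = ennreal (1 / \<bar>det S\<bar>) * ennreal \<bar>det S\<bar> * (\<integral>\<^sup>+v. h (z + S *v v) \<partial>lborel)"
        by (simp add: mult.assoc)
      also have "ennreal (1 / \<bar>det S\<bar>) * ennreal \<bar>det S\<bar> = 1"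
        using S by (simp add: ennreal_mult[symmetric])
      finally show ?thesis by simp
    qed
    have G8: "indicator (ball 0 1) v * ?G (a + \<iota> v) \<le> ennreal (exp 1 * ?G8 a)" for a and v :: "real^'n"
    proof (cases "norm v < 1")
      case True
      have "norm a \<le> norm (a + \<iota> v) + norm (\<iota> v)" using norm_triangle_ineq4[of "a + \<iota> v" "\<iota> v"] by simp
      also have "\<dots> \<le> norm (a + \<iota> v) + 2" using True \<iota>(2)[of v] by simp
      finally have "(norm a)\<^sup>2 \<le> (norm (a + \<iota> v) + 2)\<^sup>2" by (rule power_mono) simp
      also have "\<dots> \<le> 2 * (norm (a + \<iota> v))\<^sup>2 + 8"
        using zero_le_power2[of "norm (a + \<iota> v) - 2"] by (simp add: power2_sum power2_diff)
      finally have "- (norm (a + \<iota> v))\<^sup>2 / 4 \<le> 1 + - (1/8) * (norm a)\<^sup>2" by simp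
      then have "exp (- (norm (a + \<iota> v))\<^sup>2 / 4) \<le> exp (1 + - (1/8) * (norm a)\<^sup>2)" by (simp only: exp_le_cancel_iff)
      then show ?thesis using True by (simp only: exp_add) simp
    qed simp
    have "ennreal V * (\<integral>\<^sup>+a. ?G a * h (\<zeta> a) \<partial>lborel)
        = (\<integral>\<^sup>+v. indicator (ball 0 1) v * (\<integral>\<^sup>+a. ?G a * h (\<zeta> a) \<partial>lborel) \<partial>(lborel :: (real^'n) measure))"
      by (subst nn_integral_multc) (auto simp: V)
    also have "\<dots> = (\<integral>\<^sup>+v. (\<integral>\<^sup>+a. indicator (ball 0 1) v * (?G (a + \<iota> v) * h (\<zeta> a + S *v v)) \<partial>lborel) \<partial>lborel)"
    proof (rule nn_integral_cong)
      fix v :: "real ^ 'n"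
      have "(\<integral>\<^sup>+a. ?G a * h (\<zeta> a) \<partial>lborel) = (\<integral>\<^sup>+a. ?G (a + \<iota> v) * h (\<zeta> (a + \<iota> v)) \<partial>lborel)"
        by (rule nn_integral_lborel_shift[symmetric]) measurable
      then show "indicator (ball 0 1) v * (\<integral>\<^sup>+a. ?G a * h (\<zeta> a) \<partial>lborel)
          = (\<integral>\<^sup>+a. indicator (ball 0 1) v * (?G (a + \<iota> v) * h (\<zeta> a + S *v v)) \<partial>lborel)"
        by (subst nn_integral_cmult) (auto simp: linear_add[OF \<zeta>(1)] \<zeta>(2))
    qed
    also have "\<dots> \<le> (\<integral>\<^sup>+v. (\<integral>\<^sup>+a. ennreal (exp 1 * ?G8 a) * h (\<zeta> a + S *v v) \<partial>lborel) \<partial>lborel)"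
      unfolding mult.assoc[symmetric] by (intro nn_integral_mono mult_right_mono G8) simp
    also have "\<dots> = (\<integral>\<^sup>+a. (\<integral>\<^sup>+v. ennreal (exp 1 * ?G8 a) * h (\<zeta> a + S *v v) \<partial>lborel) \<partial>lborel)"
      by (rule lborel_pair.Fubini') measurable
    also have "\<dots> = (\<integral>\<^sup>+a. ennreal (?G8 a) * (ennreal (exp 1) * (ennreal (1 / \<bar>det S\<bar>) * (\<integral>\<^sup>+v. h v \<partial>lborel))) \<partial>lborel)"
      by (intro nn_integral_cong, subst nn_integral_cmult) (auto simp: lin ennreal_mult mult_ac)
    also have "\<dots> = ennreal I * (ennreal (exp 1) * (ennreal (1 / \<bar>det S\<bar>) * (\<integral>\<^sup>+v. h v \<partial>lborel)))"
      using I by (subst nn_integral_multc) auto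
    finally have le: "ennreal V * (\<integral>\<^sup>+a. ?G a * h (\<zeta> a) \<partial>lborel)
       \<le> ennreal I * (ennreal (exp 1) * (ennreal (1 / \<bar>det S\<bar>) * (\<integral>\<^sup>+v. h v \<partial>lborel)))" .
    have "(\<integral>\<^sup>+a. ?G a * h (\<zeta> a) \<partial>lborel) = ennreal (1 / V) * (ennreal V * (\<integral>\<^sup>+a. ?G a * h (\<zeta> a) \<partial>lborel))"
      unfolding mult.assoc[symmetric] using V0 by (simp add: ennreal_mult[symmetric])
    also have "\<dots> \<le> ennreal (1 / V) * (ennreal I * (ennreal (exp 1) * (ennreal (1 / \<bar>det S\<bar>) * (\<integral>\<^sup>+v. h v \<partial>lborel))))"
      by (rule mult_left_mono[OF le]) simp
    also have "\<dots> = ennreal (exp 1 * I / V / \<bar>det S\<bar>) * (\<integral>\<^sup>+v. h v \<partial>lborel)"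
      unfolding mult.assoc[symmetric] using V0 I0 by (simp add: ennreal_mult[symmetric] mult.commute[of I])
    finally show ?thesis .
  qed
  moreover have "exp 1 * I / V \<ge> 0" using I0 V0 by simp
  ultimately show thesis using that by blast
qed

lemma integrable_gaussian:
  assumes "c > 0"
  shows "integrable lborel (\<lambda>a::'p::euclidean_space. exp (- c * (norm a)\<^sup>2))"
  by (rule integrableI_nonneg) (use nn_integral_gaussian_finite[OF assms, where 'p='p] in auto)

lemma integrable_gaussian_mult:
  fixes f :: "'p::euclidean_space \<Rightarrow> real"
  assumes "c > 0" and "f \<in> borel_measurable borel" and "\<And>a. \<bar>f a\<bar> \<le> B"
  shows "integrable lborel (\<lambda>a. exp (- c * (norm a)\<^sup>2) * f a)"
proof (rule Bochner_Integration.integrable_bound)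
  show "integrable lborel (\<lambda>a::'p. exp (- c * (norm a)\<^sup>2) * B)"
    using integrable_gaussian[OF assms(1)] by (rule integrable_mult_left)
  show "(\<lambda>a. exp (- c * (norm a)\<^sup>2) * f a) \<in> borel_measurable lborel"
    using assms(2) by measurable
  show "AE a in lborel. norm (exp (- c * (norm a)\<^sup>2) * f a) \<le> norm (exp (- c * (norm a)\<^sup>2) * B)"
    using assms(3) by (auto simp: abs_mult intro!: mult_left_mono order_trans[OF assms(3)])
qed

lemma gaussian_average_abs:
  obtains C where "C \<ge> 0" and "\<And>(\<zeta> :: 'p::euclidean_space \<Rightarrow> real ^ 'n) \<iota> S h.
    transversal \<zeta> \<iota> S \<Longrightarrow> test_function h \<Longrightarrow>
    (LBINT a. exp (- (1/4) * (norm a)\<^sup>2) * \<bar>h (\<zeta> a)\<bar>) \<le> C / \<bar>det S\<bar> * (LBINT v. \<bar>h v\<bar>)"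
proof -
  obtain C where C: "C \<ge> 0" and den: "\<And>(\<zeta> :: 'p::euclidean_space \<Rightarrow> real ^ 'n) \<iota> S h.
    transversal \<zeta> \<iota> S \<Longrightarrow> h \<in> borel_measurable borel \<Longrightarrow>
    (\<integral>\<^sup>+a. ennreal (exp (- (norm a)\<^sup>2 / 4)) * h (\<zeta> a) \<partial>lborel)
       \<le> ennreal (C / \<bar>det S\<bar>) * (\<integral>\<^sup>+v. h v \<partial>lborel)"
    using gaussian_average_density[where 'p='p and 'n='n] by blast
  have "(LBINT a. exp (- (1/4) * (norm a)\<^sup>2) * \<bar>h (\<zeta> a)\<bar>) \<le> C / \<bar>det S\<bar> * (LBINT v. \<bar>h v\<bar>)"
    if a: "transversal \<zeta> \<iota> S" and h: "test_function h"
    for \<zeta> :: "'p \<Rightarrow> real ^ 'n" and \<iota> S h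
  proof -
    obtain B where B: "\<And>u. \<bar>h u\<bar> \<le> B" using test_function_bounded[OF h] by metis
    have m[measurable]: "\<zeta> \<in> borel_measurable borel" "h \<in> borel_measurable borel"
      using a test_function_measurable[OF h] by (auto simp: transversal_def intro: borel_measurable_linear)
    have i1: "integrable lborel (\<lambda>a. exp (- (1/4) * (norm a)\<^sup>2) * \<bar>h (\<zeta> a)\<bar>)"
      by (rule integrable_gaussian_mult[where B=B]) (auto simp: B)
    have i2: "integrable lborel (\<lambda>v. \<bar>h v\<bar>)"
      by (intro test_function_integrable test_function_abs h)
    have "ennreal (LBINT a. exp (- (1/4) * (norm a)\<^sup>2) * \<bar>h (\<zeta> a)\<bar>)
        = (\<integral>\<^sup>+a. ennreal (exp (- (norm a)\<^sup>2 / 4)) * ennreal \<bar>h (\<zeta> a)\<bar> \<partial>lborel)"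
      by (subst nn_integral_eq_integral[OF i1, symmetric]) (auto simp: ennreal_mult)
    also have "\<dots> \<le> ennreal (C / \<bar>det S\<bar>) * (\<integral>\<^sup>+v. ennreal \<bar>h v\<bar> \<partial>lborel)"
      by (rule den[OF a]) measurable
    also have "\<dots> = ennreal (C / \<bar>det S\<bar> * (LBINT v. \<bar>h v\<bar>))"
      using C by (subst nn_integral_eq_integral[OF i2]) (auto simp: ennreal_mult[symmetric] integral_nonneg_AE)
    finally show ?thesis using C by (subst (asm) ennreal_le_iff) (auto simp: integral_nonneg_AE)
  qed
  then show thesis using C that by blast
qed

lemma test_function_fdiff:
  assumes "test_function h"
  shows "test_function (fdiff M w h)"
  unfolding fdiff_def[abs_def]
  by (intro test_function_sum test_function_cmult test_function_shift assms) simp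

lemma sum_choose_real: "(\<Sum>j\<le>M. real (M choose j)) = 2 ^ M"
proof -
  have "real (\<Sum>j\<le>M. M choose j) = real (2 ^ M)" by (simp only: choose_row_sum)
  then show ?thesis by simp
qed

text \<open>A step \<open>w = S v\<close> in the argument of \<open>h\<close> is a step \<open>\<iota> v\<close> of the parameter, and by translation invariance
the differences move from \<open>h\<close>, which need not be smooth, to the Gaussian. There they gain the factor
\<open>(r / \<sigma>) ^ M\<close>, where \<open>\<sigma>\<close> is the smallest singular value of \<open>S\<close>. When \<open>r / \<sigma>\<close> is not small, the density
bound alone suffices. Together this gives every exponent \<open>t\<close> between \<open>0\<close> and \<open>M\<close>.\<close>

lemma gaussian_average_fdiff:
  assumes "M \<ge> 1"
  obtains C where "C \<ge> 0" and "\<And>(\<zeta> :: 'p::euclidean_space \<Rightarrow> real ^ 'n) \<iota> S h (t::real) w r.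
    transversal \<zeta> \<iota> S \<Longrightarrow> test_function h \<Longrightarrow>
    0 \<le> t \<Longrightarrow> t \<le> real M \<Longrightarrow> norm w \<le> r \<Longrightarrow> r > 0 \<Longrightarrow>
    \<bar>LBINT a. exp (- 1 * (norm a)\<^sup>2) * fdiff M w h (\<zeta> a)\<bar>
      \<le> C * r powr t / singular_weight t S * (LBINT v. \<bar>h v\<bar>)"
proof -
  obtain C1 where C1: "C1 \<ge> 0" and den: "\<And>(\<zeta> :: 'p::euclidean_space \<Rightarrow> real ^ 'n) \<iota> S h.
    transversal \<zeta> \<iota> S \<Longrightarrow> test_function h \<Longrightarrow>
    (LBINT a. exp (- (1/4) * (norm a)\<^sup>2) * \<bar>h (\<zeta> a)\<bar>) \<le> C1 / \<bar>det S\<bar> * (LBINT v. \<bar>h v\<bar>)"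
    using gaussian_average_abs[where 'p='p and 'n='n] by blast
  obtain C2 where C2: "C2 \<ge> 0" and fd: "\<And>a h :: 'p. real M * norm h \<le> 1 \<Longrightarrow>
     \<bar>fdiff M h (\<lambda>a. exp (- (norm a)\<^sup>2)) a\<bar> \<le> C2 * norm h ^ M * exp (- (norm a)\<^sup>2 / 4)"
    using fdiff_gaussian_bound[where 'p='p and M=M] by blast
  define C where "C = C1 * (2 ^ M * (2 * real M) ^ M + C2 * 2 ^ M)"
  have C0: "C \<ge> 0" using C1 C2 by (simp add: C_def)
  have "\<bar>LBINT a. exp (- 1 * (norm a)\<^sup>2) * fdiff M w h (\<zeta> a)\<bar>
      \<le> C * r powr t / singular_weight t S * (LBINT v. \<bar>h v\<bar>)"
    if tr: "transversal \<zeta> \<iota> S" and h: "test_function h"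
      and t: "0 \<le> t" "t \<le> real M" and w: "norm w \<le> r" "r > 0"
    for \<zeta> :: "'p \<Rightarrow> real ^ 'n" and \<iota> S h and t :: real and w r
  proof -
    have a: "linear \<zeta>" "\<And>v. \<zeta> (\<iota> v) = S *v v" "linear \<iota>" "\<And>v. norm (\<iota> v) \<le> 2 * norm v" "det S \<noteq> 0"
      using tr by (auto simp: transversal_def)
    define \<sigma> where "\<sigma> = smallest_singular_value S"
    have \<sigma>: "\<sigma> > 0" "\<And>v. \<sigma> * norm v \<le> norm (S *v v)"
      unfolding \<sigma>_def using a(5)
      by (auto intro!: smallest_singular_value_pos smallest_singular_value_le simp: invertible_det_nz)
    let ?\<psi> = "\<lambda>a::'p. exp (- 1 * (norm a)\<^sup>2)"
    let ?I = "LBINT v. \<bar>h v\<bar>"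
    have I0: "?I \<ge> 0" by (simp add: integral_nonneg_AE)
    have m\<zeta>[measurable]: "\<zeta> \<in> borel_measurable borel"
      by (rule borel_measurable_linear[OF a(1)])
    have mh[measurable]: "g \<in> borel_measurable borel" if "test_function g" for g :: "real^'n \<Rightarrow> real"
      using that by (rule test_function_measurable)
    note [measurable] = mh[OF h]
    have int: "integrable lborel (\<lambda>a. exp (- c * (norm a)\<^sup>2) * g (\<zeta> a))"
      if g: "test_function g" and "c > 0" for g :: "real^'n \<Rightarrow> real" and c
    proof -
      obtain B where B: "\<And>u. \<bar>g u\<bar> \<le> B" using test_function_bounded[OF g] by metis
      note [measurable] = mh[OF g]
      show ?thesis by (rule integrable_gaussian_mult[where B=B]) (auto simp: B \<open>c > 0\<close>)
    qed
    have "\<bar>LBINT a. ?\<psi> a * fdiff M w h (\<zeta> a)\<bar> \<le> C * (r / \<sigma>) powr t / \<bar>det S\<bar> * ?I"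
    proof (cases "2 * real M * (r / \<sigma>) \<le> 1")
      case False
      \<comment> \<open>The steps are too large for cancellation; each of the translates of \<open>h\<close> is estimated separately.\<close>
      have sh: "(LBINT v. \<bar>h (v + c)\<bar>) = ?I" for c
        using integral_lborel_shift[of "\<lambda>v. \<bar>h v\<bar>" c] by simp
      have "\<bar>LBINT a. ?\<psi> a * fdiff M w h (\<zeta> a)\<bar>
          \<le> (LBINT a. (\<Sum>j\<le>M. real (M choose j) * (exp (- (1/4) * (norm a)\<^sup>2) * \<bar>h (\<zeta> a + real j *\<^sub>R w)\<bar>)))"
      proof (rule integral_abs_bound[THEN order_trans], rule integral_mono)
        show "integrable lborel (\<lambda>a. \<bar>?\<psi> a * fdiff M w h (\<zeta> a)\<bar>)"
          by (intro integrable_abs int test_function_fdiff h) simp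
        show "integrable lborel (\<lambda>a. \<Sum>j\<le>M. real (M choose j) * (exp (- (1/4) * (norm a)\<^sup>2) * \<bar>h (\<zeta> a + real j *\<^sub>R w)\<bar>))"
          by (intro Bochner_Integration.integrable_sum integrable_mult_right int[of "\<lambda>z. \<bar>h (z + _)\<bar>"] test_function_abs test_function_shift h) simp
        show "\<bar>?\<psi> a * fdiff M w h (\<zeta> a)\<bar> \<le> (\<Sum>j\<le>M. real (M choose j) * (exp (- (1/4) * (norm a)\<^sup>2) * \<bar>h (\<zeta> a + real j *\<^sub>R w)\<bar>))" for a
        proof -
          have "\<bar>?\<psi> a * fdiff M w h (\<zeta> a)\<bar> \<le> (\<Sum>j\<le>M. ?\<psi> a * (real (M choose j) * \<bar>h (\<zeta> a + real j *\<^sub>R w)\<bar>))"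
            unfolding fdiff_def sum_distrib_left
            by (rule order_trans[OF sum_abs]) (simp add: abs_mult power_abs)
          also have "\<dots> \<le> (\<Sum>j\<le>M. exp (- (1/4) * (norm a)\<^sup>2) * (real (M choose j) * \<bar>h (\<zeta> a + real j *\<^sub>R w)\<bar>))"
            by (intro sum_mono mult_right_mono) auto
          finally show ?thesis by (simp only: mult.left_commute)
        qed
      qed
      also have "\<dots> = (\<Sum>j\<le>M. real (M choose j) * (LBINT a. exp (- (1/4) * (norm a)\<^sup>2) * \<bar>h (\<zeta> a + real j *\<^sub>R w)\<bar>))"
        by (subst Bochner_Integration.integral_sum)
          (intro integrable_mult_right int[of "\<lambda>z. \<bar>h (z + _)\<bar>"] test_function_abs test_function_shift h, simp, simp only: integral_mult_right_zero)
      also have "\<dots> \<le> (\<Sum>j\<le>M. real (M choose j) * (C1 / \<bar>det S\<bar> * ?I))"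
        by (intro sum_mono mult_left_mono order_trans[OF den[OF tr test_function_shift[OF h]]]) (auto simp: sh C1)
      also have "\<dots> = 2 ^ M * (C1 / \<bar>det S\<bar> * ?I)"
        by (simp only: sum_distrib_right[symmetric] sum_choose_real)
      also have "\<dots> \<le> C1 * 2 ^ M * ((2 * real M) ^ M * (r / \<sigma>) powr t) / \<bar>det S\<bar> * ?I"
      proof -
        have "1 \<le> (2 * real M * (r / \<sigma>)) powr t"
          using False t by (intro ge_one_powr_ge_zero) auto
        also have "\<dots> = (2 * real M) powr t * (r / \<sigma>) powr t"
          using w \<sigma> by (subst powr_mult) auto
        also have "\<dots> \<le> (2 * real M) powr real M * (r / \<sigma>) powr t"
          using t \<open>M \<ge> 1\<close> by (intro mult_right_mono powr_mono) auto
        also have "(2 * real M) powr real M = (2 * real M) ^ M"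
          using \<open>M \<ge> 1\<close> by (subst powr_realpow) auto
        finally have "C1 * 2 ^ M / \<bar>det S\<bar> * ?I * 1 \<le> C1 * 2 ^ M / \<bar>det S\<bar> * ?I * ((2 * real M) ^ M * (r / \<sigma>) powr t)"
          using C1 I0 by (intro mult_left_mono) auto
        then show ?thesis by (simp add: field_simps)
      qed
      also have "\<dots> \<le> C * (r / \<sigma>) powr t / \<bar>det S\<bar> * ?I"
        unfolding C_def using C1 C2 I0 
        by (intro mult_right_mono divide_right_mono) (auto simp: algebra_simps)
      finally show ?thesis .
    next
      case True
      obtain S' where "S ** S' = mat 1"
        using a(5) invertible_det_nz[of S] unfolding invertible_def by blast
      then have "S *v (S' *v w) = w" by (simp add: matrix_vector_mul_assoc)
      then obtain v where v: "S *v v = w" by blast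
      have nv: "norm v \<le> r / \<sigma>"
        using \<sigma>(2)[of v] \<sigma>(1) w by (simp add: v field_simps)
      define u where "u = - \<iota> v"
      have \<zeta>u: "\<zeta> u = - w" using a(2) v by (simp add: u_def linear_neg[OF a(1)])
      have nu: "norm u \<le> 2 * (r / \<sigma>)" using a(4)[of v] nv by (simp add: u_def)
      have "real M * norm u \<le> real M * (2 * (r / \<sigma>))" by (intro mult_left_mono nu) simp
      also have "\<dots> \<le> 1" using True by (simp add: algebra_simps)
      finally have Mu: "real M * norm u \<le> 1" .
      have shift: "(LBINT a. ?\<psi> a * h (\<zeta> a + real j *\<^sub>R w))
          = (LBINT a. ?\<psi> (a + real j *\<^sub>R u) * h (\<zeta> a))" for j
      proof -
        have "\<zeta> (a + real j *\<^sub>R u) + real j *\<^sub>R w = \<zeta> a" for a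
          using \<zeta>u by (simp add: linear_add[OF a(1)] linear_cmul[OF a(1)])
        then show ?thesis
          using integral_lborel_shift[of "\<lambda>a. ?\<psi> a * h (\<zeta> a + real j *\<^sub>R w)" "real j *\<^sub>R u"] by simp
      qed
      have intu: "integrable lborel (\<lambda>a. ?\<psi> (a + real j *\<^sub>R u) * h (\<zeta> a))" for j
      proof -
        have "integrable lborel (\<lambda>a. ?\<psi> a * h (\<zeta> a + real j *\<^sub>R w))"
          by (intro int[of "\<lambda>z. h (z + _)"] test_function_shift h) simp
        then have "integrable (distr lborel borel ((+) (real j *\<^sub>R u))) (\<lambda>a. ?\<psi> a * h (\<zeta> a + real j *\<^sub>R w))"
          by (simp add: lborel_distr_plus)
        then have "integrable lborel (\<lambda>a. ?\<psi> (real j *\<^sub>R u + a) * h (\<zeta> (real j *\<^sub>R u + a) + real j *\<^sub>R w))"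
          by (subst (asm) integrable_distr_eq) auto
        moreover have "\<zeta> (real j *\<^sub>R u + a) + real j *\<^sub>R w = \<zeta> a" for a
          using \<zeta>u by (simp add: linear_add[OF a(1)] linear_cmul[OF a(1)])
        ultimately show ?thesis by (simp add: add.commute)
      qed
      have "(LBINT a. ?\<psi> a * fdiff M w h (\<zeta> a))
          = (LBINT a. (\<Sum>j\<le>M. (-1) ^ j * real (M choose j) * (?\<psi> a * h (\<zeta> a + real j *\<^sub>R w))))"
        unfolding fdiff_def sum_distrib_left by (simp only: mult.left_commute)
      also have "\<dots> = (\<Sum>j\<le>M. (-1) ^ j * real (M choose j) * (LBINT a. ?\<psi> a * h (\<zeta> a + real j *\<^sub>R w)))"
        by (subst Bochner_Integration.integral_sum)
          (intro integrable_mult_right int[of "\<lambda>z. h (z + _)"] test_function_shift h, simp, simp only: integral_mult_right_zero)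
      also have "\<dots> = (LBINT a. (\<Sum>j\<le>M. (-1) ^ j * real (M choose j) * (?\<psi> (a + real j *\<^sub>R u) * h (\<zeta> a))))"
        unfolding shift
        by (subst Bochner_Integration.integral_sum)
          (intro integrable_mult_right intu, simp only: integral_mult_right_zero)
      also have "\<dots> = (LBINT a. fdiff M u ?\<psi> a * h (\<zeta> a))"
        unfolding fdiff_def sum_distrib_right by (simp only: mult.assoc)
      finally have eq: "(LBINT a. ?\<psi> a * fdiff M w h (\<zeta> a)) = (LBINT a. fdiff M u ?\<psi> a * h (\<zeta> a))" .
      have "\<bar>LBINT a. fdiff M u ?\<psi> a * h (\<zeta> a)\<bar>
          \<le> (LBINT a. C2 * (2 * (r / \<sigma>)) ^ M * (exp (- (1/4) * (norm a)\<^sup>2) * \<bar>h (\<zeta> a)\<bar>))"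
      proof (rule integral_abs_bound[THEN order_trans], rule integral_mono)
        show "integrable lborel (\<lambda>a. \<bar>fdiff M u ?\<psi> a * h (\<zeta> a)\<bar>)"
          unfolding fdiff_def sum_distrib_right mult.assoc
          by (intro integrable_abs Bochner_Integration.integrable_sum integrable_mult_right intu)
        show "integrable lborel (\<lambda>a. C2 * (2 * (r / \<sigma>)) ^ M * (exp (- (1/4) * (norm a)\<^sup>2) * \<bar>h (\<zeta> a)\<bar>))"
          by (intro integrable_mult_right int[of "\<lambda>z. \<bar>h z\<bar>"] test_function_abs h) simp
        show "\<bar>fdiff M u ?\<psi> a * h (\<zeta> a)\<bar> \<le> C2 * (2 * (r / \<sigma>)) ^ M * (exp (- (1/4) * (norm a)\<^sup>2) * \<bar>h (\<zeta> a)\<bar>)" for a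
        proof -
          have "\<bar>fdiff M u ?\<psi> a\<bar> \<le> C2 * norm u ^ M * exp (- (1/4) * (norm a)\<^sup>2)"
            using fd[OF Mu, of a] by simp
          also have "\<dots> \<le> C2 * (2 * (r / \<sigma>)) ^ M * exp (- (1/4) * (norm a)\<^sup>2)"
            using C2 nu by (intro mult_right_mono mult_left_mono power_mono) auto
          finally show ?thesis unfolding abs_mult mult.assoc[symmetric] by (rule mult_right_mono) simp
        qed
      qed
      also have "\<dots> = C2 * (2 * (r / \<sigma>)) ^ M * (LBINT a. exp (- (1/4) * (norm a)\<^sup>2) * \<bar>h (\<zeta> a)\<bar>)"
        by (rule integral_mult_right_zero)
      also have "\<dots> \<le> C2 * (2 * (r / \<sigma>)) ^ M * (C1 / \<bar>det S\<bar> * ?I)"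
        using C2 w \<sigma> by (intro mult_left_mono den[OF tr h]) auto
      finally have le1: "\<bar>LBINT a. fdiff M u ?\<psi> a * h (\<zeta> a)\<bar>
          \<le> C2 * (2 * (r / \<sigma>)) ^ M * (C1 / \<bar>det S\<bar> * ?I)" .
      have le2: "(2 * (r / \<sigma>)) ^ M \<le> 2 ^ M * (r / \<sigma>) powr t"
      proof -
        have "r / \<sigma> \<le> 1"
        proof (rule ccontr)
          assume "\<not> r / \<sigma> \<le> 1"
          then have "2 * real M * 1 \<le> 2 * real M * (r / \<sigma>)" by (intro mult_left_mono) auto
          then show False using True \<open>M \<ge> 1\<close> by linarith
        qed
        then have "(r / \<sigma>) powr real M \<le> (r / \<sigma>) powr t"
          using w \<sigma> t by (intro powr_mono') auto
        moreover have "(r / \<sigma>) powr real M = (r / \<sigma>) ^ M" using w \<sigma> by (intro powr_realpow) auto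
        ultimately show ?thesis unfolding power_mult_distrib by simp
      qed
      note le1
      also have "C2 * (2 * (r / \<sigma>)) ^ M * (C1 / \<bar>det S\<bar> * ?I)
          \<le> C2 * (2 ^ M * (r / \<sigma>) powr t) * (C1 / \<bar>det S\<bar> * ?I)"
        using C1 C2 I0 by (intro mult_right_mono mult_left_mono le2) auto
      also have "\<dots> = C1 * (C2 * 2 ^ M) * (r / \<sigma>) powr t / \<bar>det S\<bar> * ?I" by simp
      also have "\<dots> \<le> C * (r / \<sigma>) powr t / \<bar>det S\<bar> * ?I"
        unfolding C_def using C1 C2 I0
        by (intro mult_right_mono divide_right_mono) (auto simp: algebra_simps)
      finally show ?thesis unfolding eq .
    qed
    also have "C * (r / \<sigma>) powr t / \<bar>det S\<bar> = C * r powr t / singular_weight t S"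
      using w \<sigma>(1) by (simp add: powr_divide singular_weight_def \<sigma>_def)
    finally show ?thesis .
  qed
  then show thesis using C0 that by blast
qed

section \<open>Mollifiers that reproduce polynomials to high order\<close>

lemma integral_lborel_scale:
  fixes f :: "'a::euclidean_space \<Rightarrow> real"
  assumes [measurable]: "f \<in> borel_measurable borel" and "c \<noteq> 0"
  shows "(LBINT u. f u) = \<bar>c\<bar> ^ DIM('a) * (LBINT u. f (c *\<^sub>R u))"
proof -
  have "(LBINT u. f u) = (\<integral>u. f u \<partial>density (distr lborel borel (\<lambda>x. 0 + c *\<^sub>R x)) (\<lambda>_. ennreal (\<bar>c\<bar> ^ DIM('a))))"
    using lborel_affine[OF \<open>c \<noteq> 0\<close>, of "0::'a"] by (simp add: ennreal_power)
  also have "\<dots> = (\<integral>u. \<bar>c\<bar> ^ DIM('a) * f u \<partial>distr lborel borel (\<lambda>x::'a. c *\<^sub>R x))"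
    by (subst integral_density) auto
  also have "\<dots> = (LBINT u. \<bar>c\<bar> ^ DIM('a) * f (c *\<^sub>R u))"
    by (subst integral_distr) auto
  finally show ?thesis by simp
qed

lemma integral_lborel_reflect:
  fixes f :: "'a::euclidean_space \<Rightarrow> real"
  assumes "f \<in> borel_measurable borel"
  shows "(LBINT u. f (- u)) = (LBINT u. f u)"
  using integral_lborel_scale[OF assms, of "-1"] by simp

definition tent :: "'a::euclidean_space \<Rightarrow> real" where
  "tent u = max 0 (1 - norm u)"

lemma tent_bounds: "0 \<le> tent u" "tent u \<le> 1"
  by (auto simp: tent_def)

lemma tent_eq_0: "1 < norm u \<Longrightarrow> tent u = 0"
  by (auto simp: tent_def)

lemma tent_lipschitz: "\<bar>tent u - tent v\<bar> \<le> norm (u - v)"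
proof -
  have "\<bar>norm u - norm v\<bar> \<le> norm (u - v)" by (rule norm_triangle_ineq3)
  then show ?thesis by (auto simp: tent_def)
qed

lemma test_function_tent: "test_function tent"
  unfolding test_function_def
proof (intro conjI exI allI impI)
  show "continuous_on UNIV tent" unfolding tent_def by (intro continuous_intros)
qed (rule tent_eq_0)

lemma integral_tent_pos: "(\<integral>u. tent u \<partial>(lborel :: 'a::euclidean_space measure)) > 0"
proof -
  have m: "measure lborel (ball (0::'a) (1/2)) > 0"
    using content_ball_pos[of "1/2" "0::'a"] by simp
  have fin: "emeasure lborel (ball (0::'a) (1/2)) < \<infinity>" by (rule emeasure_lborel_ball_finite)
  have "0 < 1/2 * measure lborel (ball (0::'a) (1/2))" using m by simp
  also have "\<dots> = (\<integral>u. 1/2 * indicator (ball 0 (1/2)) u \<partial>(lborel :: 'a measure))" by simp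
  also have "\<dots> \<le> (\<integral>u. tent u \<partial>(lborel :: 'a measure))"
  proof (rule integral_mono)
    show "integrable lborel (\<lambda>u::'a. 1/2 * indicator (ball 0 (1/2)) u :: real)"
      using fin by (intro integrable_mult_right integrable_real_indicator) auto
    show "1/2 * indicator (ball 0 (1/2)) u \<le> tent u" for u :: 'a
      by (auto simp: tent_def indicator_def)
  qed (rule test_function_integrable[OF test_function_tent])
  finally show ?thesis .
qed

definition bump :: "'a::euclidean_space \<Rightarrow> real" where
  "bump u = tent u / (\<integral>v. tent v \<partial>(lborel :: 'a measure))"

lemma test_function_bump: "test_function bump"
  unfolding bump_def[abs_def] divide_inverse mult.commute[of _ "inverse _"]
  by (intro test_function_cmult test_function_tent)

lemma bump_nonneg: "bump u \<ge> 0"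
  unfolding bump_def by (intro divide_nonneg_nonneg tent_bounds(1) less_imp_le integral_tent_pos)

lemma bump_eq_0: "1 < norm u \<Longrightarrow> bump u = 0"
  by (simp add: bump_def tent_eq_0)

lemma integral_bump: "(\<integral>u. bump u \<partial>(lborel :: 'a::euclidean_space measure)) = 1"
  using integral_tent_pos[where 'a='a] by (simp add: bump_def)

lemma bump_minus: "bump (- u) = bump u"
  by (simp add: bump_def tent_def)

definition scaled_bump :: "real \<Rightarrow> 'a::euclidean_space \<Rightarrow> real" where
  "scaled_bump r u = bump ((1 / r) *\<^sub>R u) / r ^ DIM('a)"

lemma test_function_scaled_bump: "r > 0 \<Longrightarrow> test_function (scaled_bump r)"
  unfolding scaled_bump_def[abs_def] divide_inverse[of "bump _"] mult.commute[of _ "inverse _"]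
  by (intro test_function_cmult test_function_scale test_function_bump) auto

lemma scaled_bump_nonneg: "r > 0 \<Longrightarrow> scaled_bump r u \<ge> 0"
  by (simp add: scaled_bump_def bump_nonneg)

lemma integral_scaled_bump:
  fixes g :: "'a::euclidean_space \<Rightarrow> real"
  assumes "r > 0" and g: "g \<in> borel_measurable borel"
  shows "(LBINT u. scaled_bump r u * g u) = (LBINT w. bump w * g (r *\<^sub>R w))"
proof -
  note [measurable] = test_function_measurable[OF test_function_scaled_bump[OF \<open>r > 0\<close>]] g
  have "(LBINT u. scaled_bump r u * g u)
     = \<bar>r\<bar> ^ DIM('a) * (LBINT u. scaled_bump r (r *\<^sub>R u) * g (r *\<^sub>R u))"
    by (rule integral_lborel_scale) (use assms in auto)
  also have "\<dots> = (LBINT u. \<bar>r\<bar> ^ DIM('a) * (scaled_bump r (r *\<^sub>R u) * g (r *\<^sub>R u)))" by simp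
  also have "\<dots> = (LBINT w. bump w * g (r *\<^sub>R w))"
    using assms(1) by (intro Bochner_Integration.integral_cong) (auto simp: scaled_bump_def)
  finally show ?thesis .
qed

lemma scaled_bump_bound:
  fixes u :: "'a::euclidean_space"
  assumes "r > 0"
  shows "scaled_bump r u \<le> 1 / (\<integral>v. tent v \<partial>(lborel :: 'a measure)) / r ^ DIM('a)"
  unfolding scaled_bump_def bump_def using assms integral_tent_pos[where 'a='a]
  by (intro divide_right_mono) (auto simp: tent_bounds)

lemma scaled_bump_lipschitz:
  fixes u v :: "'a::euclidean_space"
  assumes "r > 0"
  shows "\<bar>scaled_bump r u - scaled_bump r v\<bar>
    \<le> 1 / (\<integral>v. tent v \<partial>(lborel :: 'a measure)) / r ^ (DIM('a) + 1) * norm (u - v)"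
proof -
  define Z where "Z = (\<integral>v. tent v \<partial>(lborel :: 'a measure))"
  have Z: "Z > 0" using integral_tent_pos by (simp add: Z_def)
  have "\<bar>scaled_bump r u - scaled_bump r v\<bar>
      = \<bar>tent ((1 / r) *\<^sub>R u) - tent ((1 / r) *\<^sub>R v)\<bar> / (Z * r ^ DIM('a))"
    using Z assms by (simp add: scaled_bump_def bump_def Z_def[symmetric] diff_divide_distrib[symmetric] abs_mult)
  also have "\<dots> \<le> norm ((1 / r) *\<^sub>R u - (1 / r) *\<^sub>R v) / (Z * r ^ DIM('a))"
    using Z assms by (intro divide_right_mono tent_lipschitz) auto
  also have "\<dots> = (1 / r) * norm (u - v) / (Z * r ^ DIM('a))"
    using assms by (simp add: scaleR_diff_right[symmetric])
  finally show ?thesis using Z assms by (simp add: Z_def field_simps)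
qed

text \<open>The coefficients are those of \<open>fdiff M\<close> with the term \<open>j = 0\<close> removed and the sign reversed. Averaging
with this kernel therefore reproduces a function up to its differences of order \<open>M\<close>
(\<open>integral_mollifier_mult\<close>), at the price of negative values.\<close>

definition mollifier :: "nat \<Rightarrow> real \<Rightarrow> 'a::euclidean_space \<Rightarrow> real" where
  "mollifier M r u = (\<Sum>j=1..M. - ((-1) ^ j) * real (M choose j) * scaled_bump (real j * r) u)"

lemma test_function_mollifier: "r > 0 \<Longrightarrow> test_function (mollifier M r)"
  unfolding mollifier_def[abs_def]
  by (intro test_function_sum test_function_cmult test_function_scaled_bump) auto

lemma mollifier_minus: "mollifier M r (- u) = mollifier M r u"
  by (simp add: mollifier_def scaled_bump_def bump_minus)

lemma sum_choose_le: "(\<Sum>j=1..M. real (M choose j)) \<le> 2 ^ M"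
  unfolding sum_choose_real[symmetric] by (rule sum_mono2) auto

lemma mollifier_support: 
  assumes "r > 0" "real M * r < norm u" shows "mollifier M r u = 0"
  unfolding mollifier_def
proof (rule sum.neutral, rule ballI)
  fix j assume j: "j \<in> {1..M}"
  have "real j * r \<le> real M * r" using j assms by (intro mult_right_mono) auto
  also have "\<dots> < norm u" by fact
  finally have "1 < norm ((1 / (real j * r)) *\<^sub>R u)" using j assms by (simp add: field_simps)
  then show "- ((-1) ^ j) * real (M choose j) * scaled_bump (real j * r) u = 0"
    by (simp add: scaled_bump_def bump_eq_0)
qed

lemma mollifier_bound:
  fixes u :: "'a::euclidean_space"
  assumes "r > 0"
  shows "\<bar>mollifier M r u\<bar> \<le> 2 ^ M / (\<integral>v. tent v \<partial>(lborel :: 'a measure)) / r ^ DIM('a)"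
proof -
  define K where "K = 1 / (\<integral>v. tent v \<partial>(lborel :: 'a measure)) / r ^ DIM('a)"
  have K0: "K \<ge> 0" using integral_tent_pos[where 'a='a] assms by (simp add: K_def)
  have "\<bar>mollifier M r u\<bar> \<le> (\<Sum>j=1..M. real (M choose j) * K)"
    unfolding mollifier_def
  proof (rule order_trans[OF sum_abs], rule sum_mono)
    fix j assume j: "j \<in> {1..M}"
    have "r ^ DIM('a) \<le> (real j * r) ^ DIM('a)" using j assms by (intro power_mono) auto
    then have "1 / (\<integral>v. tent v \<partial>(lborel :: 'a measure)) / (real j * r) ^ DIM('a) \<le> K"
      unfolding K_def using j assms integral_tent_pos[where 'a='a] by (intro divide_left_mono) auto
    then have "scaled_bump (real j * r) u \<le> K"
      using scaled_bump_bound[of "real j * r" u] j assms by auto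
    then show "\<bar>- ((-1) ^ j) * real (M choose j) * scaled_bump (real j * r) u\<bar> \<le> real (M choose j) * K"
      using scaled_bump_nonneg[of "real j * r" u] j assms by (auto simp: abs_mult power_abs intro!: mult_left_mono)
  qed
  also have "\<dots> \<le> 2 ^ M * K"
    unfolding sum_distrib_right[symmetric] by (intro mult_right_mono sum_choose_le K0)
  finally show ?thesis by (simp add: K_def)
qed

lemma mollifier_lipschitz:
  fixes u v :: "'a::euclidean_space"
  assumes "r > 0"
  shows "\<bar>mollifier M r u - mollifier M r v\<bar>
    \<le> 2 ^ M / (\<integral>v. tent v \<partial>(lborel :: 'a measure)) / r ^ (DIM('a) + 1) * norm (u - v)"
proof -
  define K where "K = 1 / (\<integral>v. tent v \<partial>(lborel :: 'a measure)) / r ^ (DIM('a) + 1) * norm (u - v)"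
  have K0: "K \<ge> 0" using integral_tent_pos[where 'a='a] assms by (simp add: K_def)
  have "\<bar>mollifier M r u - mollifier M r v\<bar> \<le> (\<Sum>j=1..M. real (M choose j) * K)"
    unfolding mollifier_def sum_subtractf[symmetric] right_diff_distrib[symmetric]
  proof (rule order_trans[OF sum_abs], rule sum_mono)
    fix j assume j: "j \<in> {1..M}"
    have "r ^ (DIM('a) + 1) \<le> (real j * r) ^ (DIM('a) + 1)" using j assms by (intro power_mono) auto
    then have "1 / (\<integral>v. tent v \<partial>(lborel :: 'a measure)) / (real j * r) ^ (DIM('a) + 1) * norm (u - v) \<le> K"
      unfolding K_def using j assms integral_tent_pos[where 'a='a]
      by (intro mult_right_mono divide_left_mono) auto
    then have "\<bar>scaled_bump (real j * r) u - scaled_bump (real j * r) v\<bar> \<le> K"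
      using scaled_bump_lipschitz[of "real j * r" u v] j assms by auto
    then show "\<bar>- ((-1) ^ j) * real (M choose j) * (scaled_bump (real j * r) u - scaled_bump (real j * r) v)\<bar>
        \<le> real (M choose j) * K"
      using j assms by (auto simp: abs_mult power_abs intro!: mult_left_mono)
  qed
  also have "\<dots> \<le> 2 ^ M * K"
    unfolding sum_distrib_right[symmetric] by (intro mult_right_mono sum_choose_le K0)
  finally show ?thesis by (simp add: K_def)
qed

lemma integral_scaled_bump_1:
  "r > 0 \<Longrightarrow> (\<integral>u. scaled_bump r u \<partial>(lborel :: 'a::euclidean_space measure)) = 1"
  using integral_scaled_bump[of r "\<lambda>_::'a. 1"] by (simp add: integral_bump)

lemma integral_abs_mollifier:
  assumes "r > 0"
  shows "(\<integral>u. \<bar>mollifier M r u\<bar> \<partial>(lborel :: 'a::euclidean_space measure)) \<le> 2 ^ M"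
proof -
  have int: "integrable lborel (\<lambda>u::'a. scaled_bump (real j * r) u)" if "j \<in> {1..M}" for j
    using that assms by (intro test_function_integrable test_function_scaled_bump) auto
  have "(\<integral>u. \<bar>mollifier M r u\<bar> \<partial>(lborel :: 'a measure))
     \<le> (\<integral>u. (\<Sum>j=1..M. real (M choose j) * scaled_bump (real j * r) u) \<partial>(lborel :: 'a measure))"
  proof (rule integral_mono)
    show "\<bar>mollifier M r u\<bar> \<le> (\<Sum>j=1..M. real (M choose j) * scaled_bump (real j * r) u)" for u :: 'a
      unfolding mollifier_def
    proof (rule order_trans[OF sum_abs], rule sum_mono)
      fix j assume "j \<in> {1..M}"
      then have "scaled_bump (real j * r) u \<ge> 0" using assms by (intro scaled_bump_nonneg) auto
      then show "\<bar>- ((-1) ^ j) * real (M choose j) * scaled_bump (real j * r) u\<bar>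
          \<le> real (M choose j) * scaled_bump (real j * r) u"
        by (simp add: abs_mult power_abs)
    qed
    show "integrable lborel (\<lambda>u::'a. \<Sum>j=1..M. real (M choose j) * scaled_bump (real j * r) u)"
      by (intro Bochner_Integration.integrable_sum integrable_mult_right int)
  qed (intro test_function_integrable test_function_abs test_function_mollifier assms)
  also have "\<dots> = (\<Sum>j=1..M. real (M choose j))"
    using assms int by (subst Bochner_Integration.integral_sum) (auto simp: integral_scaled_bump_1)
  finally show ?thesis using sum_choose_le[of M] by linarith
qed

lemma integral_mollifier:
  assumes "r > 0" "M \<ge> 1"
  shows "(\<integral>u. mollifier M r u \<partial>(lborel :: 'a::euclidean_space measure)) = 1"
proof -
  have int: "integrable lborel (\<lambda>u::'a. scaled_bump (real j * r) u)" if "j \<in> {1..M}" for j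
    using that assms by (intro test_function_integrable test_function_scaled_bump) auto
  have "(\<integral>u. mollifier M r u \<partial>(lborel :: 'a measure)) = (\<Sum>j=1..M. - ((-1) ^ j) * real (M choose j))"
    unfolding mollifier_def
    using assms int by (subst Bochner_Integration.integral_sum) (auto simp: integral_scaled_bump_1)
  also have "\<dots> = 1 - (\<Sum>j\<le>M. (-1) ^ j * real (M choose j))"
    by (simp add: atMost_atLeast0 sum.atLeast_Suc_atMost[of 0 M] sum_negf)
  also have "(\<Sum>j\<le>M. (-1) ^ j * real (M choose j)) = 0"
    using choose_alternating_sum[of M, where 'a=real] \<open>M \<ge> 1\<close> by simp
  finally show ?thesis by simp
qed

lemma integral_mollifier_mult:
  fixes h :: "'a::euclidean_space \<Rightarrow> real"
  assumes "r > 0" and h: "test_function h"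
  shows "(LBINT u. mollifier M r u * h (z + u)) = h z - (LBINT w. bump w * fdiff M (r *\<^sub>R w) h z)"
proof -
  have hm: "(\<lambda>u. h (z + c *\<^sub>R u)) \<in> borel_measurable borel" for c
    by (rule borel_measurable_continuous_onI, rule continuous_on_compose2[OF test_function_continuous[OF h]])
      (auto intro!: continuous_intros)
  have hc: "continuous_on UNIV (\<lambda>u. h (z + c *\<^sub>R u))" for c
    by (rule continuous_on_compose2[OF test_function_continuous[OF h]]) (auto intro!: continuous_intros)
  have i1: "integrable lborel (\<lambda>u. scaled_bump (real j * r) u * h (z + u))" if "j \<in> {1..M}" for j
    using that assms hc[of 1] by (intro test_function_integrable test_function_mult test_function_scaled_bump) auto
  have i2: "integrable lborel (\<lambda>w. bump w * h (z + c *\<^sub>R w))" for c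
    by (intro test_function_integrable test_function_mult test_function_bump hc)
  have "(LBINT u. mollifier M r u * h (z + u))
     = (LBINT u. (\<Sum>j=1..M. - ((-1) ^ j) * real (M choose j) * (scaled_bump (real j * r) u * h (z + u))))"
    unfolding mollifier_def sum_distrib_right by (simp only: mult.assoc)
  also have "\<dots> = (\<Sum>j=1..M. - ((-1) ^ j) * real (M choose j) * (LBINT u. scaled_bump (real j * r) u * h (z + u)))"
    by (subst Bochner_Integration.integral_sum) (use i1 in \<open>auto intro!: integrable_mult_right\<close>)
  also have "\<dots> = (\<Sum>j=1..M. - ((-1) ^ j) * real (M choose j) * (LBINT w. bump w * h (z + (real j * r) *\<^sub>R w)))"
    by (rule sum.cong, simp, subst integral_scaled_bump) (use assms hm[of 1] in auto)
  finally have 1: "(LBINT u. mollifier M r u * h (z + u)) = \<dots>" .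
  have "(LBINT w. bump w * fdiff M (r *\<^sub>R w) h z)
      = (LBINT w. (\<Sum>j\<le>M. (-1) ^ j * real (M choose j) * (bump w * h (z + (real j * r) *\<^sub>R w))))"
    unfolding fdiff_def sum_distrib_left by (simp only: mult.left_commute scaleR_scaleR)
  also have "\<dots> = (\<Sum>j\<le>M. (-1) ^ j * real (M choose j) * (LBINT w. bump w * h (z + (real j * r) *\<^sub>R w)))"
    by (subst Bochner_Integration.integral_sum) (use i2 in \<open>auto intro!: integrable_mult_right\<close>)
  also have "\<dots> = h z + (\<Sum>j=1..M. (-1) ^ j * real (M choose j) * (LBINT w. bump w * h (z + (real j * r) *\<^sub>R w)))"
    by (simp add: atMost_atLeast0 sum.atLeast_Suc_atMost[of 0 M] integral_bump)
  finally show ?thesis unfolding 1 by (simp add: sum_negf)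
qed

section \<open>Correlations\<close>

text \<open>For even kernels this is convolution. Correlation is the form in which inner products of
translates appear, and it needs no reflections.\<close>

definition corr :: "('a::euclidean_space \<Rightarrow> real) \<Rightarrow> ('a \<Rightarrow> real) \<Rightarrow> 'a \<Rightarrow> real" where
  "corr f g z = (LBINT u. f u * g (z + u))"

lemma continuous_shift: "test_function g \<Longrightarrow> continuous_on UNIV (\<lambda>u. g (z + u))"
  by (rule continuous_on_compose2[OF test_function_continuous]) (auto intro!: continuous_intros)

lemma integrable_corr:
  assumes "test_function f" "test_function g"
  shows "integrable lborel (\<lambda>u. f u * g (z + u))"
  using assms by (intro test_function_integrable test_function_mult continuous_shift)

lemma corr_diff_left:
  assumes "test_function f" "test_function f'" "test_function g"
  shows "corr (\<lambda>u. f u - f' u) g z = corr f g z - corr f' g z"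
  unfolding corr_def left_diff_distrib using assms by (intro Bochner_Integration.integral_diff integrable_corr)

lemma corr_add_right:
  assumes "test_function f" "test_function g" "test_function g'"
  shows "corr f (\<lambda>u. g u + g' u) z = corr f g z + corr f g' z"
  unfolding corr_def distrib_left using assms by (intro Bochner_Integration.integral_add integrable_corr)

lemma corr_commute:
  assumes f: "test_function f" and g: "test_function g"
    and "\<And>u. f (- u) = f u" "\<And>u. g (- u) = g u"
  shows "corr f g z = corr g f z"
proof -
  note [measurable] = test_function_measurable[OF f] test_function_measurable[OF g]
  have "corr f g z = (LBINT u. f (u - z) * g u)"
    unfolding corr_def using integral_lborel_shift[of "\<lambda>u. f (u - z) * g u" z] by (simp add: add.commute)
  also have "\<dots> = (LBINT u. f (- u - z) * g (- u))"
    using integral_lborel_reflect[of "\<lambda>u. f (u - z) * g u"] by simp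
  also have "\<dots> = (LBINT u. g u * f (z + u))"
  proof (rule Bochner_Integration.integral_cong)
    fix u
    have "- u - z = - (z + u)" by simp
    then show "f (- u - z) * g (- u) = g u * f (z + u)" by (simp only: assms(3,4) mult.commute)
  qed simp
  finally show ?thesis unfolding corr_def .
qed

lemma corr_bound:
  assumes f: "test_function f" and g: "test_function g" and B: "\<And>u. \<bar>g u\<bar> \<le> B"
  shows "\<bar>corr f g z\<bar> \<le> B * (LBINT u. \<bar>f u\<bar>)"
proof -
  have "\<bar>corr f g z\<bar> \<le> (LBINT u. B * \<bar>f u\<bar>)"
    unfolding corr_def
  proof (rule integral_abs_bound[THEN order_trans], rule integral_mono)
    show "\<bar>f u * g (z + u)\<bar> \<le> B * \<bar>f u\<bar>" for u
      unfolding abs_mult using mult_left_mono[OF B[of "z + u"], of "\<bar>f u\<bar>"] by (simp add: mult_ac)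
  qed (intro integrable_abs integrable_corr f g integrable_mult_right test_function_integrable test_function_abs)+
  then show ?thesis by simp
qed

lemma corr_lipschitz:
  assumes f: "test_function f" and g: "test_function g" and L: "\<And>u v. \<bar>g u - g v\<bar> \<le> L * norm (u - v)"
  shows "\<bar>corr f g y - corr f g z\<bar> \<le> L * (LBINT u. \<bar>f u\<bar>) * norm (y - z)"
proof -
  have "corr f g y - corr f g z = (LBINT u. f u * g (y + u) - f u * g (z + u))"
    unfolding corr_def by (intro Bochner_Integration.integral_diff[symmetric] integrable_corr f g)
  also have "\<bar>\<dots>\<bar> \<le> (LBINT u. (L * norm (y - z)) * \<bar>f u\<bar>)"
  proof (rule integral_abs_bound[THEN order_trans], rule integral_mono)
    show "\<bar>f u * g (y + u) - f u * g (z + u)\<bar> \<le> L * norm (y - z) * \<bar>f u\<bar>" for u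
      unfolding right_diff_distrib[symmetric] abs_mult
      using mult_left_mono[OF L[of "y + u" "z + u"], of "\<bar>f u\<bar>"] by (simp add: mult_ac)
  qed (intro integrable_abs integrable_corr f g integrable_mult_right test_function_integrable test_function_abs
       Bochner_Integration.integrable_diff)+
  finally show ?thesis by (simp add: mult_ac)
qed

text \<open>If \<open>norm z\<close> exceeds the sum of the two radii, then for no \<open>u\<close> are both \<open>u\<close> and \<open>z + u\<close> in the supports.\<close>

lemma corr_eq_0:
  assumes "\<And>u. R < norm u \<Longrightarrow> f u = 0" "\<And>u. R' < norm u \<Longrightarrow> g u = 0" "R + R' < norm z"
  shows "corr f g z = 0"
proof -
  have "f u * g (z + u) = 0" for u
  proof (cases "R < norm u")
    case False
    then have "R' < norm (z + u)" using assms(3) norm_triangle_ineq4[of "z + u" u] by simp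
    then show ?thesis using assms(2) by simp
  qed (use assms in simp)
  then have "(\<lambda>u. f u * g (z + u)) = (\<lambda>_. 0)" by (rule ext)
  then show ?thesis unfolding corr_def by simp
qed

lemma integral_product_swap:
  fixes F :: "'a::euclidean_space \<Rightarrow> 'b::euclidean_space \<Rightarrow> real"
  assumes m: "(\<lambda>(x, y). F x y) \<in> borel_measurable (borel \<Otimes>\<^sub>M borel)"
    and f: "integrable lborel f" and g: "integrable lborel g"
    and b: "\<And>x y. \<bar>F x y\<bar> \<le> f x * g y"
  shows "(LBINT x. (LBINT y. F x y)) = (LBINT y. (LBINT x. F x y))"
    and "integrable lborel (\<lambda>y. LBINT x. F x y)"
proof -
  have "integrable (lborel \<Otimes>\<^sub>M lborel) (\<lambda>(x, y). f x * g y)"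
  proof (rule lborel_pair.Fubini_integrable)
    show "integrable lborel (\<lambda>x. LBINT y. norm (case (x, y) of (x, y) \<Rightarrow> f x * g y))"
      using f by (simp add: abs_mult)
    show "AE x in lborel. integrable lborel (\<lambda>y. case (x, y) of (x, y) \<Rightarrow> f x * g y)"
      using g by simp
    show "(\<lambda>(x, y). f x * g y) \<in> borel_measurable (lborel \<Otimes>\<^sub>M lborel)"
      using f g by measurable
  qed
  then have *: "integrable (lborel \<Otimes>\<^sub>M lborel) (\<lambda>(x, y). F x y)"
  proof (rule Bochner_Integration.integrable_bound)
    have "borel_measurable (lborel \<Otimes>\<^sub>M lborel) = (borel_measurable (borel \<Otimes>\<^sub>M borel) :: ('a \<times> 'b \<Rightarrow> real) set)"
      by (intro measurable_cong_sets sets_pair_measure_cong) auto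
    then show "(\<lambda>(x, y). F x y) \<in> borel_measurable (lborel \<Otimes>\<^sub>M lborel)"
      using m by simp
    show "AE x in lborel \<Otimes>\<^sub>M lborel. norm (case x of (x, y) \<Rightarrow> F x y) \<le> norm (case x of (x, y) \<Rightarrow> f x * g y)"
      using b by (auto intro!: order_trans[OF b])
  qed
  from lborel_pair.Fubini_integral[OF this]
  show "(LBINT x. (LBINT y. F x y)) = (LBINT y. (LBINT x. F x y))" by simp
  show "integrable lborel (\<lambda>y. LBINT x. F x y)"
    using lborel_pair.integrable_snd[OF *] by simp
qed

lemma integral_corr:
  fixes f g :: "'a::euclidean_space \<Rightarrow> real"
  assumes f: "test_function f" and g: "test_function g"
  shows "(LBINT z. corr f g z) = (LBINT u. f u) * (LBINT u. g u)"
proof -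
  note [measurable] = test_function_measurable[OF f] test_function_measurable[OF g]
  obtain R where R: "\<And>u. R < norm u \<Longrightarrow> f u = 0" using test_function_support[OF f] by metis
  obtain R' where R': "\<And>u. R' < norm u \<Longrightarrow> g u = 0" using test_function_support[OF g] by metis
  obtain B where B: "B \<ge> 0" "\<And>u. \<bar>g u\<bar> \<le> B" using test_function_bounded[OF g] by metis
  have ind: "integrable lborel (\<lambda>z::'a. B * indicator (cball 0 (R + R')) z)"
    using emeasure_lborel_cball_finite[of "0::'a" "R + R'"]
    by (intro integrable_mult_right integrable_real_indicator) auto
  have "\<bar>f u * g (z + u)\<bar> \<le> \<bar>f u\<bar> * (B * indicator (cball 0 (R + R')) z)" for u z
  proof (cases "norm z \<le> R + R'")
    case True
    then show ?thesis using B by (auto simp: abs_mult intro!: mult_left_mono)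
  next
    case False
    have "f u * g (z + u) = 0"
    proof (cases "R < norm u")
      case False
      then have "R' < norm (z + u)" using \<open>\<not> norm z \<le> R + R'\<close> norm_triangle_ineq4[of "z + u" u] by simp
      then show ?thesis using R' by simp
    qed (use R in simp)
    then have "\<bar>f u * g (z + u)\<bar> = 0" by (simp only: abs_zero)
    also have "0 \<le> \<bar>f u\<bar> * (B * indicator (cball 0 (R + R')) z)" using B by simp
    finally show ?thesis .
  qed
  then have "(LBINT u. (LBINT z. f u * g (z + u))) = (LBINT z. (LBINT u. f u * g (z + u)))"
    by (intro integral_product_swap(1)[where f="\<lambda>u. \<bar>f u\<bar>" and g="\<lambda>z. B * indicator (cball 0 (R + R')) z"]
        ind test_function_integrable test_function_abs f) measurable
  moreover have "(LBINT z. g (z + u)) = (LBINT z. g z)" for u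
    by (rule integral_lborel_shift) measurable
  ultimately show ?thesis by (simp add: corr_def)
qed

section \<open>Differences between consecutive scales\<close>

definition band :: "nat \<Rightarrow> real \<Rightarrow> 'a::euclidean_space \<Rightarrow> real" where
  "band M r u = mollifier M r u - mollifier M (r / 2) u"

lemma test_function_band: "r > 0 \<Longrightarrow> test_function (band M r)"
  unfolding band_def[abs_def] by (intro test_function_diff test_function_mollifier) auto

lemma integral_abs_band:
  assumes "r > 0"
  shows "(\<integral>u. \<bar>band M r u\<bar> \<partial>(lborel :: 'a::euclidean_space measure)) \<le> 2 * 2 ^ M"
proof -
  have i: "integrable lborel (\<lambda>u::'a. \<bar>mollifier M s u\<bar>)" if "s > 0" for s
    using that by (intro test_function_integrable test_function_abs test_function_mollifier)
  have "(\<integral>u. \<bar>band M r u\<bar> \<partial>(lborel :: 'a measure))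
      \<le> (\<integral>u. \<bar>mollifier M r u\<bar> + \<bar>mollifier M (r / 2) u\<bar> \<partial>(lborel :: 'a measure))"
    using assms by (intro integral_mono test_function_integrable test_function_abs test_function_band
        Bochner_Integration.integrable_add i) (auto simp: band_def)
  also have "\<dots> \<le> 2 ^ M + 2 ^ M"
  proof -
    have "(\<integral>u. \<bar>mollifier M r u\<bar> + \<bar>mollifier M (r / 2) u\<bar> \<partial>(lborel :: 'a measure))
        = (\<integral>u. \<bar>mollifier M r u\<bar> \<partial>(lborel :: 'a measure)) + (\<integral>u. \<bar>mollifier M (r / 2) u\<bar> \<partial>(lborel :: 'a measure))"
      by (intro Bochner_Integration.integral_add i) (use assms in auto)
    then show ?thesis
      using integral_abs_mollifier[of r M, where 'a='a] integral_abs_mollifier[of "r / 2" M, where 'a='a] assms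
      by simp
  qed
  finally show ?thesis by simp
qed

lemma integrable_bump_mult:
  assumes "test_function h"
  shows "integrable lborel (\<lambda>w. bump w * fdiff M (c *\<^sub>R w) h z)"
proof -
  have "continuous_on UNIV (\<lambda>w. h (z + d *\<^sub>R w))" for d
    by (rule continuous_on_compose2[OF test_function_continuous[OF assms]]) (auto intro!: continuous_intros)
  then have "continuous_on UNIV (\<lambda>w. fdiff M (c *\<^sub>R w) h z)"
    unfolding fdiff_def scaleR_scaleR by (intro continuous_intros) auto
  then show ?thesis by (intro test_function_integrable test_function_mult test_function_bump)
qed

text \<open>The values \<open>h z\<close> reproduced at the two scales cancel, and only differences of order \<open>M\<close> remain.\<close>

lemma corr_band:
  assumes "r > 0" "test_function h"
  shows "corr (band M r) h z = (LBINT w. bump w * (fdiff M ((r / 2) *\<^sub>R w) h z - fdiff M (r *\<^sub>R w) h z))"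
proof -
  have "corr (band M r) h z = corr (mollifier M r) h z - corr (mollifier M (r / 2)) h z"
    unfolding band_def using assms by (intro corr_diff_left test_function_mollifier) auto
  also have "\<dots> = (LBINT w. bump w * fdiff M ((r / 2) *\<^sub>R w) h z) - (LBINT w. bump w * fdiff M (r *\<^sub>R w) h z)"
    unfolding corr_def using assms by (subst (1 2) integral_mollifier_mult) auto
  also have "\<dots> = (LBINT w. bump w * (fdiff M ((r / 2) *\<^sub>R w) h z - fdiff M (r *\<^sub>R w) h z))"
    unfolding right_diff_distrib
    by (intro Bochner_Integration.integral_diff[symmetric] integrable_bump_mult assms)
  finally show ?thesis .
qed

lemma fdiff_bound:
  assumes "\<And>u. \<bar>h u\<bar> \<le> B"
  shows "\<bar>fdiff M w h z\<bar> \<le> 2 ^ M * B"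
proof -
  have "\<bar>fdiff M w h z\<bar> \<le> (\<Sum>j\<le>M. real (M choose j) * B)"
    unfolding fdiff_def
    by (rule order_trans[OF sum_abs], rule sum_mono) (auto simp: abs_mult power_abs intro!: mult_left_mono assms)
  then show ?thesis unfolding sum_distrib_right[symmetric] sum_choose_real .
qed

text \<open>The estimate for finite differences, integrated over their steps. Only one of the two factors
\<open>band M r\<close> is used for cancellation; the other one serves as the test function.\<close>

lemma gaussian_average_corr_band:
  assumes "M \<ge> 1"
  obtains C where "C \<ge> 0" and "\<And>(\<zeta> :: 'p::euclidean_space \<Rightarrow> real ^ 'n) \<iota> S (t::real) r.
    transversal \<zeta> \<iota> S \<Longrightarrow>
    0 \<le> t \<Longrightarrow> t \<le> real M \<Longrightarrow> r > 0 \<Longrightarrow>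
    \<bar>LBINT a. exp (- 1 * (norm a)\<^sup>2) * corr (band M r) (band M r) (\<zeta> a)\<bar>
      \<le> C * r powr t / singular_weight t S"
proof -
  obtain C where C: "C \<ge> 0" and osc: "\<And>(\<zeta> :: 'p::euclidean_space \<Rightarrow> real ^ 'n) \<iota> S h (t::real) w r.
    transversal \<zeta> \<iota> S \<Longrightarrow> test_function h \<Longrightarrow>
    0 \<le> t \<Longrightarrow> t \<le> real M \<Longrightarrow> norm w \<le> r \<Longrightarrow> r > 0 \<Longrightarrow>
    \<bar>LBINT a. exp (- 1 * (norm a)\<^sup>2) * fdiff M w h (\<zeta> a)\<bar>
      \<le> C * r powr t / singular_weight t S * (LBINT v. \<bar>h v\<bar>)"
    using gaussian_average_fdiff[OF assms, where 'p='p and 'n='n] by blast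
  have "\<bar>LBINT a. exp (- 1 * (norm a)\<^sup>2) * corr (band M r) (band M r) (\<zeta> a)\<bar>
      \<le> (C * 4 * 2 ^ M) * r powr t / singular_weight t S"
    if a: "transversal \<zeta> \<iota> S" and t: "0 \<le> t" "t \<le> real M" and r: "r > 0"
    for \<zeta> :: "'p \<Rightarrow> real ^ 'n" and \<iota> S and t :: real and r
  proof -
    let ?h = "band M r :: real ^ 'n \<Rightarrow> real"
    have h: "test_function ?h" by (rule test_function_band[OF r])
    let ?\<psi> = "\<lambda>a::'p. exp (- 1 * (norm a)\<^sup>2)"
    let ?G = "\<lambda>w z. fdiff M ((r / 2) *\<^sub>R w) ?h z - fdiff M (r *\<^sub>R w) ?h z"
    let ?Q = "C * r powr t / singular_weight t S * (2 * 2 ^ M)"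
    obtain B where B: "B \<ge> 0" "\<And>u. \<bar>?h u\<bar> \<le> B" using test_function_bounded[OF h] by metis
    have [measurable]: "\<zeta> \<in> borel_measurable borel"
      using a by (simp add: transversal_def borel_measurable_linear)
    note [measurable] = test_function_measurable[OF h] test_function_measurable[OF test_function_bump]
    have GB: "\<bar>?G w z\<bar> \<le> 2 * 2 ^ M * B" for w z
      using fdiff_bound[of ?h B M "(r/2) *\<^sub>R w" z] fdiff_bound[of ?h B M "r *\<^sub>R w" z] B by auto
    have bb: "\<bar>?\<psi> a * (bump w * ?G w (\<zeta> a))\<bar> \<le> ?\<psi> a * (2 * 2 ^ M * B * bump w)" for a w
    proof -
      have "\<bar>?G w (\<zeta> a)\<bar> * bump w \<le> 2 * 2 ^ M * B * bump w"
        by (intro mult_right_mono GB bump_nonneg)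
      from mult_left_mono[OF this, of "?\<psi> a"] show ?thesis by (simp add: abs_mult bump_nonneg mult_ac)
    qed
    have meas: "(\<lambda>(a, w). ?\<psi> a * (bump w * ?G w (\<zeta> a))) \<in> borel_measurable (borel \<Otimes>\<^sub>M borel)"
      unfolding fdiff_def by measurable
    note swap = integral_product_swap[OF meas integrable_gaussian[of 1, where 'p='p]
        integrable_mult_right[OF test_function_integrable[OF test_function_bump]] bb, simplified zero_less_one, OF TrueI]
    have intf: "integrable lborel (\<lambda>a. ?\<psi> a * fdiff M w ?h (\<zeta> a))" for w
    proof -
      have "(\<lambda>a. fdiff M w ?h (\<zeta> a)) \<in> borel_measurable borel" unfolding fdiff_def by measurable
      then show ?thesis
        by (rule integrable_gaussian_mult[where B="2 ^ M * B", rotated]) (auto intro: fdiff_bound B)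
    qed
    have inner: "\<bar>LBINT a. ?\<psi> a * ?G w (\<zeta> a)\<bar> \<le> 2 * ?Q" if w: "norm w \<le> 1" for w
    proof -
      have split: "(LBINT a. ?\<psi> a * ?G w (\<zeta> a))
          = (LBINT a. ?\<psi> a * fdiff M ((r / 2) *\<^sub>R w) ?h (\<zeta> a)) - (LBINT a. ?\<psi> a * fdiff M (r *\<^sub>R w) ?h (\<zeta> a))"
        unfolding right_diff_distrib by (intro Bochner_Integration.integral_diff intf)
      have each: "\<bar>LBINT a. ?\<psi> a * fdiff M u ?h (\<zeta> a)\<bar> \<le> ?Q" if "norm u \<le> r" for u
      proof (rule order_trans[OF osc[OF a h t that r]])
        show "C * r powr t / singular_weight t S * (LBINT v. \<bar>?h v\<bar>) \<le> ?Q"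
          using C r singular_weight_nonneg[of t S] by (intro mult_left_mono integral_abs_band) auto
      qed
      have "norm (r *\<^sub>R w) \<le> r" "norm ((r / 2) *\<^sub>R w) \<le> r"
        using w r mult_left_mono[OF w, of r] by auto
      from each[OF this(1)] each[OF this(2)] show ?thesis unfolding split by linarith
    qed
    have "(LBINT a. ?\<psi> a * corr ?h ?h (\<zeta> a))
        = (LBINT a. (LBINT w. ?\<psi> a * (bump w * ?G w (\<zeta> a))))"
      unfolding corr_band[OF r h] by simp
    also have "\<dots> = (LBINT w. (LBINT a. ?\<psi> a * (bump w * ?G w (\<zeta> a))))"
      by (rule swap(1))
    finally have eq: "(LBINT a. ?\<psi> a * corr ?h ?h (\<zeta> a)) = \<dots>" .
    have "\<bar>LBINT w. (LBINT a. ?\<psi> a * (bump w * ?G w (\<zeta> a)))\<bar>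
        \<le> (\<integral>w. 2 * ?Q * bump w \<partial>(lborel :: (real^'n) measure))"
    proof (rule integral_abs_bound[THEN order_trans], rule integral_mono)
      show "integrable lborel (\<lambda>w. \<bar>LBINT a. ?\<psi> a * (bump w * ?G w (\<zeta> a))\<bar>)"
        by (intro integrable_abs swap(2))
      show "integrable lborel (\<lambda>w::real^'n. 2 * ?Q * bump w)"
        by (intro integrable_mult_right test_function_integrable test_function_bump)
      show "\<bar>LBINT a. ?\<psi> a * (bump w * ?G w (\<zeta> a))\<bar> \<le> 2 * ?Q * bump w" for w
      proof (cases "norm w \<le> 1")
        case True
        have "(LBINT a. ?\<psi> a * (bump w * ?G w (\<zeta> a))) = bump w * (LBINT a. ?\<psi> a * ?G w (\<zeta> a))"
          by (simp only: mult.left_commute[of _ "bump w"] integral_mult_right_zero)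
        then have "\<bar>LBINT a. ?\<psi> a * (bump w * ?G w (\<zeta> a))\<bar> = bump w * \<bar>LBINT a. ?\<psi> a * ?G w (\<zeta> a)\<bar>"
          by (simp only: abs_mult abs_of_nonneg[OF bump_nonneg])
        also have "\<dots> \<le> bump w * (2 * ?Q)" by (intro mult_left_mono inner True bump_nonneg)
        finally show ?thesis by (simp only: mult.commute)
      next
        case False
        then have "bump w = 0" by (intro bump_eq_0) simp
        then show ?thesis by simp
      qed
    qed
    also have "\<dots> = 2 * ?Q" by (simp add: integral_bump)
    finally show ?thesis unfolding eq by (simp add: mult_ac)
  qed
  moreover have "C * 4 * 2 ^ M \<ge> 0" using C by simp
  ultimately show thesis using that by blast
qed

section \<open>Energy of a weighted point configuration\<close>

text \<open>The squared \<open>L\<^sup>2\<close> norm of a sum of weighted translates of \<open>f\<close> (\<open>energy_eq\<close>), written as a double sum so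
that its expectation can be taken pair by pair.\<close>

definition energy :: "('a::euclidean_space \<Rightarrow> real) \<Rightarrow> 'i set \<Rightarrow> ('i \<Rightarrow> real) \<Rightarrow> ('i \<Rightarrow> 'a) \<Rightarrow> real" where
  "energy f A p x = (\<Sum>i\<in>A. \<Sum>j\<in>A. p i * p j * corr f f (x j - x i))"

lemma corr_diff_shift:
  assumes f: "test_function f" and g: "test_function g"
  shows "corr f g (z - c) = (LBINT v. f (v + c) * g (z + v))"
proof -
  note [measurable] = test_function_measurable[OF f] test_function_measurable[OF g]
  have "(LBINT v. f (v + c) * g (z + v)) = (LBINT v. f (v + c) * g (z - c + (v + c)))"
    by (simp add: algebra_simps)
  also have "\<dots> = corr f g (z - c)"
    unfolding corr_def by (rule integral_lborel_shift[of "\<lambda>v. f v * g (z - c + v)"]) measurable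
  finally show ?thesis by simp
qed

lemma energy_eq:
  assumes f: "test_function f"
  shows "energy f A p x = (LBINT v. (\<Sum>i\<in>A. p i * f (v + x i))\<^sup>2)"
proof -
  have c: "corr f f (x j - x i) = (LBINT v. f (v + x i) * f (v + x j))" for i j
    by (simp add: corr_diff_shift[OF f f] add.commute)
  have int: "integrable lborel (\<lambda>v. f (v + x i) * f (v + x j))" for i j
    by (intro test_function_integrable test_function_mult test_function_shift f
        test_function_continuous[OF test_function_shift[OF f]])
  have "(LBINT v. (\<Sum>i\<in>A. p i * f (v + x i))\<^sup>2)
      = (LBINT v. (\<Sum>i\<in>A. \<Sum>j\<in>A. p i * p j * (f (v + x i) * f (v + x j))))"
    unfolding power2_eq_square sum_product by (simp only: mult_ac)
  also have "\<dots> = energy f A p x"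
    unfolding energy_def c
    by (simp add: Bochner_Integration.integral_sum Bochner_Integration.integrable_sum int)
  finally show ?thesis by simp
qed

text \<open>The Cauchy-Schwarz inequality in additive form. With a free parameter \<open>lam\<close> in place of a square root,
the bound stays linear in the energy, whose expectation is the accessible quantity.\<close>

lemma sum_corr_le_energy:
  assumes f: "test_function f" and g: "test_function g" and "lam > 0" "finite A"
  shows "\<bar>\<Sum>i\<in>A. p i * corr f g (z - x i)\<bar> \<le> lam * energy f A p x + (LBINT v. (g v)\<^sup>2) / lam"
proof -
  let ?F = "\<lambda>v. \<Sum>i\<in>A. p i * f (v + x i)"
  have F: "test_function ?F"
    by (intro test_function_sum test_function_cmult test_function_shift f \<open>finite A\<close>)
  have gz: "test_function (\<lambda>v. g (z + v))" using test_function_shift[OF g, of z] by (simp add: add.commute)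
  have sq: "integrable lborel (\<lambda>v. (h v)\<^sup>2)" if "test_function h" for h :: "'a \<Rightarrow> real"
    unfolding power2_eq_square
    using that by (intro test_function_integrable test_function_mult test_function_continuous)
  have int: "integrable lborel (\<lambda>v. ?F v * g (z + v))"
    by (intro test_function_integrable test_function_mult F continuous_shift g)
  have "(\<Sum>i\<in>A. p i * corr f g (z - x i)) = (\<Sum>i\<in>A. (LBINT v. p i * (f (v + x i) * g (z + v))))"
    by (simp add: corr_diff_shift[OF f g])
  also have "\<dots> = (LBINT v. (\<Sum>i\<in>A. p i * (f (v + x i) * g (z + v))))"
    by (intro Bochner_Integration.integral_sum[symmetric] integrable_mult_right test_function_integrable
        test_function_mult test_function_shift f continuous_shift g)
  also have "\<dots> = (LBINT v. ?F v * g (z + v))"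
    by (simp add: sum_distrib_right mult.assoc)
  also have "\<bar>\<dots>\<bar> \<le> (LBINT v. lam * (?F v)\<^sup>2 + (g (z + v))\<^sup>2 / lam)"
  proof (rule integral_abs_bound[THEN order_trans], rule integral_mono)
    show "integrable lborel (\<lambda>v. \<bar>?F v * g (z + v)\<bar>)" by (intro integrable_abs int)
    show "integrable lborel (\<lambda>v. lam * (?F v)\<^sup>2 + (g (z + v))\<^sup>2 / lam)"
      by (intro Bochner_Integration.integrable_add integrable_mult_right integrable_divide sq F gz)
    show "\<bar>?F v * g (z + v)\<bar> \<le> lam * (?F v)\<^sup>2 + (g (z + v))\<^sup>2 / lam" for v
    proof -
      have "\<bar>a * b\<bar> \<le> lam * a\<^sup>2 + b\<^sup>2 / lam" for a b :: real
      proof -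
        have "0 \<le> (lam * \<bar>a\<bar> - \<bar>b\<bar>)\<^sup>2 / lam" using \<open>lam > 0\<close> by simp
        also have "\<dots> = lam * a\<^sup>2 + b\<^sup>2 / lam - 2 * \<bar>a * b\<bar>"
          using \<open>lam > 0\<close> by (simp add: power2_diff power_mult_distrib abs_mult field_simps power2_eq_square)
        finally show ?thesis using abs_ge_zero[of "a * b"] by linarith
      qed
      then show ?thesis .
    qed
  qed
  also have "\<dots> = lam * energy f A p x + (LBINT v. (g (z + v))\<^sup>2) / lam"
    by (subst Bochner_Integration.integral_add)
      (auto intro!: integrable_mult_right integrable_divide sq F gz simp: energy_eq[OF f])
  also have "(LBINT v. (g (z + v))\<^sup>2) = (LBINT v. (g v)\<^sup>2)"
    using integral_lborel_shift[of "\<lambda>v. (g v)\<^sup>2" z] test_function_measurable[OF g] by (simp add: add.commute)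
  finally show ?thesis .
qed

text \<open>Smoothing twice with the same kernel makes the difference of two scales factor like a
difference of squares (\<open>smoother_telescope\<close>).\<close>

definition smoother :: "nat \<Rightarrow> real \<Rightarrow> 'a::euclidean_space \<Rightarrow> real" where
  "smoother M r = corr (mollifier M r) (mollifier M r)"

lemma smoother_telescope:
  assumes "r > 0"
  shows "smoother M r z - smoother M (r / 2) z
    = corr (band M r) (\<lambda>u. mollifier M r u + mollifier M (r / 2) u) z"
proof -
  let ?k = "mollifier M r" and ?l = "mollifier M (r / 2)"
  have kl: "test_function ?k" "test_function ?l"
    using assms by (auto intro!: test_function_mollifier)
  have "corr (band M r) (\<lambda>u. ?k u + ?l u) z
     = corr ?k (\<lambda>u. ?k u + ?l u) z - corr ?l (\<lambda>u. ?k u + ?l u) z"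
    unfolding band_def by (intro corr_diff_left test_function_add kl)
  also have "\<dots> = (corr ?k ?k z + corr ?k ?l z) - (corr ?l ?k z + corr ?l ?l z)"
    by (simp add: corr_add_right kl)
  also have "corr ?k ?l z = corr ?l ?k z"
    by (intro corr_commute kl mollifier_minus)
  finally show ?thesis by (simp add: smoother_def)
qed

text \<open>A constant large enough for all bounds, in units of \<open>r ^ -d\<close>, on the kernels at the scales \<open>r\<close> and \<open>r / 2\<close>.\<close>

definition band_const :: "'a::euclidean_space itself \<Rightarrow> nat \<Rightarrow> real" where
  "band_const _ M = 4 * 2 ^ M * 2 ^ M * 2 ^ DIM('a) / (\<integral>v. tent v \<partial>(lborel :: 'a measure))"

lemma band_const_nonneg: "band_const TYPE('a::euclidean_space) M \<ge> 0"
  unfolding band_const_def using integral_tent_pos[where 'a='a] by (intro divide_nonneg_pos) auto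

lemma mollifier_pair_bound:
  fixes u :: "'a::euclidean_space"
  assumes "r > 0"
  shows "\<bar>mollifier M r u\<bar> + \<bar>mollifier M (r / 2) u\<bar>
     \<le> band_const TYPE('a) M / (2 * 2 ^ M) / r ^ DIM('a)"
proof -
  define Z where "Z = (\<integral>v. tent v \<partial>(lborel :: 'a measure))"
  have Z: "Z > 0" using integral_tent_pos by (simp add: Z_def)
  have "\<bar>mollifier M r u\<bar> \<le> 2 ^ M / Z / r ^ DIM('a)"
    unfolding Z_def by (rule mollifier_bound[OF assms])
  also have "\<dots> \<le> 2 ^ M / Z / (r / 2) ^ DIM('a)"
    using Z assms by (intro divide_left_mono power_mono) auto
  finally have "\<bar>mollifier M r u\<bar> + \<bar>mollifier M (r / 2) u\<bar> \<le> 2 * (2 ^ M / Z / (r / 2) ^ DIM('a))"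
    using mollifier_bound[of "r / 2" M u] assms by (simp add: Z_def)
  also have "\<dots> = band_const TYPE('a) M / (2 * 2 ^ M) / r ^ DIM('a)"
    using Z assms by (simp add: band_const_def Z_def[symmetric] field_simps power_divide)
  finally show ?thesis .
qed

lemma integral_mollifier_pair_sq:
  assumes "r > 0"
  shows "(\<integral>u. (mollifier M r u + mollifier M (r / 2) u)\<^sup>2 \<partial>(lborel :: 'a::euclidean_space measure))
     \<le> band_const TYPE('a) M / r ^ DIM('a)"
proof -
  let ?K = "band_const TYPE('a) M / (2 * 2 ^ M) / r ^ DIM('a)"
  let ?g = "\<lambda>u::'a. mollifier M r u + mollifier M (r / 2) u"
  have K0: "?K \<ge> 0" using band_const_nonneg[of M, where 'a='a] assms by simp
  have g: "test_function ?g" using assms by (auto intro!: test_function_add test_function_mollifier)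
  have i: "integrable lborel (\<lambda>u::'a. \<bar>mollifier M s u\<bar>)" if "s > 0" for s
    using that by (intro test_function_integrable test_function_abs test_function_mollifier)
  have "(LBINT u. (?g u)\<^sup>2) \<le> (\<integral>u. ?K * (\<bar>mollifier M r u\<bar> + \<bar>mollifier M (r / 2) u\<bar>) \<partial>(lborel :: 'a measure))"
  proof (rule integral_mono)
    show "integrable lborel (\<lambda>u. (?g u)\<^sup>2)"
      unfolding power2_eq_square by (intro test_function_integrable test_function_mult g test_function_continuous)
    show "integrable lborel (\<lambda>u::'a. ?K * (\<bar>mollifier M r u\<bar> + \<bar>mollifier M (r / 2) u\<bar>))"
      using assms by (intro integrable_mult_right Bochner_Integration.integrable_add i) auto
    show "(?g u)\<^sup>2 \<le> ?K * (\<bar>mollifier M r u\<bar> + \<bar>mollifier M (r / 2) u\<bar>)" for u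
    proof -
      have "(?g u)\<^sup>2 = \<bar>?g u\<bar> * \<bar>?g u\<bar>" by (simp add: power2_eq_square)
      also have "\<dots> \<le> ?K * (\<bar>mollifier M r u\<bar> + \<bar>mollifier M (r / 2) u\<bar>)"
        using mollifier_pair_bound[OF assms, of M u] K0
        by (intro mult_mono) (auto intro: order_trans[OF abs_triangle_ineq])
      finally show ?thesis .
    qed
  qed
  also have "\<dots> = ?K * ((\<integral>u. \<bar>mollifier M r u\<bar> \<partial>(lborel :: 'a measure)) + (\<integral>u. \<bar>mollifier M (r / 2) u\<bar> \<partial>(lborel :: 'a measure)))"
    using i assms by (simp add: Bochner_Integration.integral_add)
  also have "\<dots> \<le> ?K * (2 ^ M + 2 ^ M)"
    using assms K0 by (intro mult_left_mono add_mono integral_abs_mollifier) auto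
  finally show ?thesis by simp
qed

lemma corr_band_bound:
  fixes z :: "'a::euclidean_space"
  assumes "r > 0"
  shows "\<bar>corr (band M r) (band M r) z\<bar> \<le> band_const TYPE('a) M / r ^ DIM('a)"
proof -
  let ?K = "band_const TYPE('a) M / (2 * 2 ^ M) / r ^ DIM('a)"
  have K0: "?K \<ge> 0" using band_const_nonneg[of M, where 'a='a] assms by simp
  have b: "\<bar>band M r u\<bar> \<le> ?K" for u :: 'a
    using mollifier_pair_bound[OF assms, of M u] unfolding band_def by linarith
  have "\<bar>corr (band M r) (band M r) z\<bar> \<le> ?K * (\<integral>u. \<bar>band M r u\<bar> \<partial>(lborel :: 'a measure))"
    by (intro corr_bound test_function_band assms b)
  also have "\<dots> \<le> ?K * (2 * 2 ^ M)"
    using assms K0 by (intro mult_left_mono integral_abs_band) auto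
  finally show ?thesis by simp
qed

lemma smoother_difference_le_energy:
  fixes z :: "'a::euclidean_space"
  assumes "r > 0" "lam > 0" "finite A"
  shows "\<bar>(\<Sum>i\<in>A. p i * smoother M r (z - x i)) - (\<Sum>i\<in>A. p i * smoother M (r / 2) (z - x i))\<bar>
     \<le> lam * energy (band M r) A p x + band_const TYPE('a) M / r ^ DIM('a) / lam"
proof -
  let ?g = "\<lambda>u::'a. mollifier M r u + mollifier M (r / 2) u"
  have g: "test_function ?g" using assms by (auto intro!: test_function_add test_function_mollifier)
  have "(\<Sum>i\<in>A. p i * smoother M r (z - x i)) - (\<Sum>i\<in>A. p i * smoother M (r / 2) (z - x i))
     = (\<Sum>i\<in>A. p i * corr (band M r) ?g (z - x i))"
    unfolding sum_subtractf[symmetric] right_diff_distrib[symmetric] smoother_telescope[OF assms(1)] by simp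
  also have "\<bar>\<dots>\<bar> \<le> lam * energy (band M r) A p x + (LBINT v. (?g v)\<^sup>2) / lam"
    by (intro sum_corr_le_energy test_function_band assms g)
  also have "(LBINT v. (?g v)\<^sup>2) / lam \<le> band_const TYPE('a) M / r ^ DIM('a) / lam"
    using assms by (intro divide_right_mono integral_mollifier_pair_sq) auto
  finally show ?thesis by simp
qed

section \<open>Sums over block words\<close>

definition block_words :: "'b set \<Rightarrow> nat \<Rightarrow> 'b list set" where
  "block_words B n = {X. set X \<subseteq> B \<and> length X = n}"

lemma finite_block_words: "finite B \<Longrightarrow> finite (block_words B n)"
  unfolding block_words_def by (rule finite_lists_length_eq)

lemma block_words_0: "block_words B 0 = {[]}"
  by (auto simp: block_words_def)

lemma sum_block_words_Suc:
  "(\<Sum>X\<in>block_words B (Suc n). f X) = (\<Sum>b\<in>B. \<Sum>X\<in>block_words B n. f (b # X))"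
proof -
  have "block_words B (Suc n) = (\<lambda>(b, X). b # X) ` (B \<times> block_words B n)"
    by (force simp: block_words_def length_Suc_conv)
  moreover have "inj_on (\<lambda>(b, X). b # X) (B \<times> block_words B n)"
    by (auto simp: inj_on_def)
  ultimately have "(\<Sum>X\<in>block_words B (Suc n). f X) = (\<Sum>(b, X)\<in>B \<times> block_words B n. f (b # X))"
    by (simp only: sum.reindex) (simp add: case_prod_unfold o_def)
  then show ?thesis by (simp add: sum.cartesian_product)
qed

lemma sum_block_words_add:
  "(\<Sum>X\<in>block_words B (n + m). f X) = (\<Sum>X\<in>block_words B n. \<Sum>Y\<in>block_words B m. f (X @ Y))"
proof (induction n arbitrary: f)
  case 0
  then show ?case by (simp add: block_words_0)
next
  case (Suc n)
  then show ?case by (simp add: sum_block_words_Suc)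
qed

text \<open>The reciprocal of the product of the weights over the longest common prefix of two words that differ.
On equal words the value is \<open>0\<close>, because the diagonal of a double sum is treated separately.\<close>

fun split_weight :: "('b \<Rightarrow> real) \<Rightarrow> 'b list \<Rightarrow> 'b list \<Rightarrow> real" where
  "split_weight w (x # X) (y # Y) = (if x = y then split_weight w X Y / w x else 1)"
| "split_weight w X Y = 0"

lemma split_weight_append:
  assumes "x \<noteq> y" shows "split_weight w (J @ x # X) (J @ y # Y) = 1 / prod_list (map w J)"
  using assms by (induction J) auto

definition word_prob :: "('b \<Rightarrow> real) \<Rightarrow> 'b list \<Rightarrow> real" where
  "word_prob p X = prod_list (map p X)"

lemma word_prob_simps [simp]:
  "word_prob p [] = 1" "word_prob p (x # X) = p x * word_prob p X" "word_prob p (X @ Y) = word_prob p X * word_prob p Y"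
  by (auto simp: word_prob_def)

locale block_weights =
  fixes B :: "'b set" and w :: "'b \<Rightarrow> real"
  assumes finite_B: "finite B" and w_pos: "b \<in> B \<Longrightarrow> w b > 0" and w_le_1: "b \<in> B \<Longrightarrow> w b \<le> 1"
    and sum_w: "(\<Sum>b\<in>B. w b) > 1"
begin

abbreviation "S \<equiv> \<Sum>b\<in>B. w b"

definition "p b = w b / S"

lemma sum_p: "(\<Sum>b\<in>B. p b) = 1"
  using sum_w by (simp add: p_def sum_divide_distrib[symmetric])

lemma p_nonneg: "b \<in> B \<Longrightarrow> p b \<ge> 0"
  using w_pos[of b] sum_w by (simp add: p_def)

lemma word_prob_nonneg: "X \<in> block_words B n \<Longrightarrow> word_prob p X \<ge> 0"
proof (induction X arbitrary: n)
  case (Cons b X)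
  then have "b \<in> B" "X \<in> block_words B (length X)" by (auto simp: block_words_def)
  with Cons.IH p_nonneg show ?case by simp
qed simp

lemma sum_word_prob: "(\<Sum>X\<in>block_words B n. word_prob p X) = 1"
proof (induction n)
  case (Suc n)
  then show ?case by (simp add: sum_block_words_Suc sum_distrib_left[symmetric] sum_p)
qed (simp add: block_words_0)

lemma word_prob_le: "X \<in> block_words B n \<Longrightarrow> word_prob p X \<le> (1 / S) ^ n"
proof (induction X arbitrary: n)
  case (Cons b X)
  then obtain m where n: "n = Suc m" "b \<in> B" "X \<in> block_words B m" by (auto simp: block_words_def)
  have "p b \<le> 1 / S" using w_le_1[OF n(2)] sum_w by (simp add: p_def divide_right_mono)
  then have "p b * word_prob p X \<le> (1 / S) * (1 / S) ^ m"
    using Cons.IH[OF n(3)] p_nonneg[OF n(2)] word_prob_nonneg[OF n(3)] sum_w by (intro mult_mono) auto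
  then show ?case by (simp add: n)
qed (auto simp: block_words_def)

lemma sum_word_prob_sq: "(\<Sum>X\<in>block_words B n. word_prob p X * word_prob p X) \<le> (1 / S) ^ n"
proof -
  have "(\<Sum>X\<in>block_words B n. word_prob p X * word_prob p X) \<le> (\<Sum>X\<in>block_words B n. (1 / S) ^ n * word_prob p X)"
    by (intro sum_mono mult_right_mono word_prob_le word_prob_nonneg)
  then show ?thesis by (simp only: sum_distrib_left[symmetric] sum_word_prob mult_1_right)
qed

text \<open>Let \<open>A n\<close> be the double sum. Pairs with different first blocks contribute at most \<open>1\<close>. For pairs that begin
with the same block \<open>b\<close> the factor \<open>p b * p b / w b = p b / S\<close> splits off, so
\<open>A (Suc n) \<le> 1 + A n / S\<close>, and \<open>S / (S - 1)\<close> is the fixed point of this recursion.\<close>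

lemma sum_split_weight:
  "(\<Sum>X\<in>block_words B n. \<Sum>Y\<in>block_words B n. word_prob p X * word_prob p Y * split_weight w X Y) \<le> S / (S - 1)"
    (is "?A n \<le> _")
proof (induction n)
  case 0
  then show ?case using sum_w by (simp add: block_words_0)
next
  case (Suc n)
  have "?A (Suc n) = (\<Sum>b\<in>B. \<Sum>b'\<in>B. \<Sum>X\<in>block_words B n. \<Sum>Y\<in>block_words B n.
      word_prob p (b # X) * word_prob p (b' # Y) * split_weight w (b # X) (b' # Y))"
    unfolding sum_block_words_Suc by (rule sum.cong[OF refl], rule sum.swap)
  also have "\<dots> \<le> (\<Sum>b\<in>B. \<Sum>b'\<in>B. p b * p b' + (if b = b' then p b / S * ?A n else 0))"
  proof (intro sum_mono)
    fix b b' assume b: "b \<in> B" "b' \<in> B"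
    show "(\<Sum>X\<in>block_words B n. \<Sum>Y\<in>block_words B n.
        word_prob p (b # X) * word_prob p (b' # Y) * split_weight w (b # X) (b' # Y))
      \<le> p b * p b' + (if b = b' then p b / S * ?A n else 0)"
    proof (cases "b = b'")
      case True
      have "p b * p b / w b = p b / S" using w_pos[OF b(1)] by (simp add: p_def)
      have "(\<Sum>X\<in>block_words B n. \<Sum>Y\<in>block_words B n.
        word_prob p (b # X) * word_prob p (b' # Y) * split_weight w (b # X) (b' # Y))
        = (\<Sum>X\<in>block_words B n. \<Sum>Y\<in>block_words B n. (p b * p b / w b) * (word_prob p X * word_prob p Y * split_weight w X Y))"
        using True by (intro sum.cong refl) (simp add: mult_ac)
      also have "\<dots> = p b / S * ?A n"
        unfolding \<open>p b * p b / w b = p b / S\<close> by (simp only: sum_distrib_left)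
      finally show ?thesis using True p_nonneg[OF b(1)] by simp
    next
      case False
      have "(\<Sum>X\<in>block_words B n. \<Sum>Y\<in>block_words B n.
        word_prob p (b # X) * word_prob p (b' # Y) * split_weight w (b # X) (b' # Y))
        = (\<Sum>X\<in>block_words B n. \<Sum>Y\<in>block_words B n. p b * p b' * (word_prob p X * word_prob p Y))"
        using False by (intro sum.cong refl) (simp add: mult_ac)
      also have "\<dots> = p b * p b' * ((\<Sum>X\<in>block_words B n. word_prob p X) * (\<Sum>X\<in>block_words B n. word_prob p X))"
        by (simp only: sum_distrib_left[symmetric] sum_product)
      finally show ?thesis using False by (simp add: sum_word_prob)
    qed
  qed
  also have "\<dots> = (\<Sum>b\<in>B. p b) * (\<Sum>b\<in>B. p b) + (\<Sum>b\<in>B. p b) / S * ?A n"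
    unfolding sum.distrib sum_product
    using finite_B by (simp add: sum_distrib_right sum_divide_distrib)
  also have "\<dots> = 1 + ?A n / S" by (simp add: sum_p)
  also have "\<dots> \<le> 1 + (S / (S - 1)) / S" using Suc sum_w by (intro add_left_mono divide_right_mono) auto
  also have "\<dots> = S / (S - 1)" using sum_w by (simp add: field_simps)
  finally show ?case .
qed

end

section \<open>Words of contractions and transversality\<close>

text \<open>The image of \<open>0\<close> under the composition of the maps \<open>\<lambda>x. T i *v x + a $ i\<close> along the word.\<close>

fun word_point :: "('m \<Rightarrow> real ^ 'd ^ 'd) \<Rightarrow> real ^ 'd ^ 'm \<Rightarrow> 'm list \<Rightarrow> real ^ 'd" where
  "word_point T a [] = 0"
| "word_point T a (i # I) = T i *v word_point T a I + a $ i"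

lemma word_matrix_append: "word_matrix T (I @ J) = word_matrix T I ** word_matrix T J"
  by (induction I) (auto simp: matrix_mul_assoc)

lemma word_point_append:
  "word_point T a (I @ J) = word_point T a I + word_matrix T I *v word_point T a J"
  by (induction I) (auto simp: matrix_vector_right_distrib matrix_vector_mul_assoc)

lemma word_point_add: "word_point T (a + b) I = word_point T a I + word_point T b I"
  by (induction I) (auto simp: matrix_vector_right_distrib)

lemma word_point_scale: "word_point T (c *\<^sub>R a) I = c *\<^sub>R word_point T a I"
  by (induction I) (auto simp: scaleR_add_right matrix_vector_mult_scaleR)

lemma linear_word_point: "linear (\<lambda>a. word_point T a I)"
  by (rule linearI) (auto simp: word_point_add word_point_scale)

text \<open>Moving two translation vectors in opposite directions moves the difference of two points whose words begin with
\<open>i\<close> and \<open>j\<close> by \<open>2 v\<close> to leading order. At each later position a word contains only one letter,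
so that the error is bounded by two geometric series.\<close>

definition opposite_shift :: "'m \<Rightarrow> 'm \<Rightarrow> real ^ 'd \<Rightarrow> real ^ 'd ^ ('m::finite)" where
  "opposite_shift i j v = (\<chi> l. if l = i then v else if l = j then - v else 0)"

lemma linear_opposite_shift: "linear (opposite_shift i j)"
  by (rule linearI) (auto simp: opposite_shift_def vec_eq_iff)

lemma opposite_shift_component: "norm (opposite_shift i j v $ l) \<le> norm v"
  by (simp add: opposite_shift_def)

lemma norm_opposite_shift: "norm (opposite_shift i j v) \<le> 2 * norm v"
proof -
  have "norm (opposite_shift i j v) \<le> (\<Sum>l\<in>UNIV. norm (opposite_shift i j v $ l))"
    unfolding norm_vec_def by (rule L2_set_le_sum) simp
  also have "\<dots> \<le> (\<Sum>l\<in>UNIV. (if l = i then norm v else 0) + (if l = j then norm v else 0))"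
    by (rule sum_mono) (simp add: opposite_shift_def)
  also have "\<dots> = 2 * norm v" by (simp add: sum.distrib)
  finally show ?thesis .
qed

locale short_contractions =
  fixes T :: "'m::finite \<Rightarrow> real ^ 'd ^ 'd"
  assumes inv: "\<And>i. invertible (T i)" and short: "\<And>i. onorm ((*v) (T i)) < 1 / 2"
begin

definition "rho = Max (range (\<lambda>i. onorm ((*v) (T i))))"

lemma rho_ge: "onorm ((*v) (T i)) \<le> rho"
  unfolding rho_def by (rule Max_ge) auto

lemma rho_less: "rho < 1 / 2"
  unfolding rho_def using short by (subst Max_less_iff) auto

lemma rho_nonneg: "rho \<ge> 0"
  using rho_ge[of undefined] onorm_pos_le[OF matrix_vector_mul_bounded_linear[of "T undefined"]] by linarith

lemma norm_contraction: "norm (T i *v x) \<le> rho * norm x"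
  using onorm[OF matrix_vector_mul_bounded_linear, of "T i" x] rho_ge[of i]
  by (meson mult_right_mono norm_ge_zero order_trans)

lemma invertible_word_matrix: "invertible (word_matrix T I)"
proof (induction I)
  case Nil
  show ?case by (auto simp: invertible_def intro!: exI[of _ "mat 1"])
next
  case (Cons i I)
  then show ?case using inv[of i] by (simp add: invertible_det_nz det_mul)
qed

lemma norm_word_matrix: "norm (word_matrix T I *v x) \<le> rho ^ length I * norm x"
proof (induction I)
  case (Cons i I)
  have "norm (word_matrix T (i # I) *v x) \<le> rho * norm (word_matrix T I *v x)"
    by (simp add: matrix_vector_mul_assoc[symmetric] norm_contraction)
  also have "\<dots> \<le> rho * (rho ^ length I * norm x)" by (intro mult_left_mono Cons rho_nonneg)
  finally show ?case by (simp add: mult_ac)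
qed simp

lemma norm_word_matrix_le: "norm (word_matrix T I *v x) \<le> norm x"
proof -
  have "rho ^ length I * norm x \<le> 1 * norm x"
    using rho_nonneg rho_less by (intro mult_right_mono power_le_one) auto
  then show ?thesis using norm_word_matrix[of I x] by simp
qed

lemma norm_word_point:
  assumes "\<And>i. norm (a $ i) \<le> c"
  shows "norm (word_point T a I) \<le> c / (1 - rho)"
proof (induction I)
  case Nil
  have "c \<ge> 0" using assms[of undefined] norm_ge_zero order_trans by blast
  then show ?case using rho_less by simp
next
  case (Cons i I)
  have "norm (word_point T a (i # I)) \<le> rho * norm (word_point T a I) + c"
    using norm_contraction[of i "word_point T a I"] assms[of i]
    by (simp add: norm_triangle_le add_mono)
  also have "\<dots> \<le> rho * (c / (1 - rho)) + c" by (intro add_mono mult_left_mono Cons rho_nonneg order_refl)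
  also have "\<dots> = c / (1 - rho)" using rho_less by (simp add: field_simps)
  finally show ?case .
qed

definition "gap = 2 - 2 * rho / (1 - rho)"

lemma gap_pos: "gap > 0"
  using rho_less rho_nonneg by (simp add: gap_def field_simps)

text \<open>The later letters contribute at most \<open>rho / (1 - rho) * norm v\<close> for each word, and twice this is less than
\<open>2 * norm v\<close> exactly because \<open>rho < 1/2\<close>.\<close>

lemma transversality:
  assumes "i \<noteq> j"
  shows "gap * norm v \<le> norm (word_point T (opposite_shift i j v) (i # I) - word_point T (opposite_shift i j v) (j # J))"
proof -
  let ?a = "opposite_shift i j v"
  let ?q = "norm v / (1 - rho)"
  have q: "norm (T k *v word_point T ?a L) \<le> rho * ?q" for k L
    using norm_contraction[of k "word_point T ?a L"] norm_word_point[of ?a "norm v" L, OF opposite_shift_component]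
      rho_nonneg by (meson mult_left_mono order_trans)
  have d: "word_point T ?a (i # I) - word_point T ?a (j # J)
      = 2 *\<^sub>R v + (T i *v word_point T ?a I - T j *v word_point T ?a J)"
    using assms by (simp add: opposite_shift_def scaleR_2)
  have "norm (T i *v word_point T ?a I - T j *v word_point T ?a J) \<le> rho * ?q + rho * ?q"
    by (rule order_trans[OF norm_triangle_ineq4 add_mono]) (rule q)+
  moreover have "norm (2 *\<^sub>R v) - norm (T i *v word_point T ?a I - T j *v word_point T ?a J)
      \<le> norm (word_point T ?a (i # I) - word_point T ?a (j # J))"
    unfolding d by (rule norm_diff_ineq)
  ultimately show ?thesis by (simp add: gap_def algebra_simps)
qed

lemma singular_weight_le_1: "singular_weight t (word_matrix T I) \<le> 1" if "t \<ge> 0"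
proof -
  let ?A = "word_matrix T I"
  obtain v where "norm v = 1" "norm (?A *v v) = smallest_singular_value ?A"
    using smallest_singular_value_attained by metis
  then have "smallest_singular_value ?A \<le> 1" using norm_word_matrix_le[of I v] by simp
  then have 1: "smallest_singular_value ?A powr t \<le> 1"
    using powr_mono2[OF \<open>t \<ge> 0\<close> smallest_singular_value_nonneg[of ?A]] by fastforce
  obtain A' where A': "?A ** A' = mat 1"
    using invertible_word_matrix[of I] invertible_def by blast
  have "1 * norm v \<le> norm (A' *v v)" for v
  proof -
    have "v = ?A *v (A' *v v)" by (simp add: matrix_vector_mul_assoc A')
    then show ?thesis using norm_word_matrix_le[of I "A' *v v"] by simp
  qed
  then have "1 ^ CARD('d) \<le> \<bar>det A'\<bar>" by (intro abs_det_ge_power) auto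
  then have d1: "1 \<le> \<bar>det A'\<bar>" by simp
  have "\<bar>det ?A\<bar> * \<bar>det A'\<bar> = 1"
    using arg_cong[OF A', of det] by (simp add: det_mul abs_mult[symmetric])
  then have "\<bar>det ?A\<bar> \<le> 1" using d1 by (metis abs_ge_zero mult_left_mono mult.right_neutral)
  then show ?thesis unfolding singular_weight_def using 1 by (intro mult_le_one) auto
qed

text \<open>Hence a product of block weights bounds the singular weight of the concatenated word from below.\<close>

lemma singular_weight_concat:
  assumes "t \<ge> 0"
  shows "prod_list (map (\<lambda>b. singular_weight t (word_matrix T b)) J) \<le> singular_weight t (word_matrix T (concat J))"
proof (induction J)
  case Nil
  have "singular_weight t (word_matrix T []) = smallest_singular_value (mat 1 :: real^'d^'d) powr t"
    by (simp add: singular_weight_def)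
  moreover have "1 \<le> smallest_singular_value (mat 1 :: real^'d^'d)"
    by (rule smallest_singular_value_greatest) simp
  ultimately show ?case using ge_one_powr_ge_zero assms by simp
next
  case (Cons b J)
  have "singular_weight t (word_matrix T b) * prod_list (map (\<lambda>b. singular_weight t (word_matrix T b)) J)
     \<le> singular_weight t (word_matrix T b) * singular_weight t (word_matrix T (concat J))"
    by (intro mult_left_mono Cons less_imp_le singular_weight_pos invertible_word_matrix)
  also have "\<dots> \<le> singular_weight t (word_matrix T (b @ concat J))"
    unfolding word_matrix_append by (rule singular_weight_mult[OF assms])
  finally show ?case by simp
qed

end

section \<open>Pairs of words with random translation vectors\<close>

lemma split_weight_same [simp]: "split_weight w X X = 0"
  by (induction X) auto

lemma finite_words: "finite (words N :: ('m::finite) list set)"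
  using finite_lists_length_eq[of "UNIV :: 'm set" N] by (simp add: words_def)

context short_contractions
begin

text \<open>The common prefix of \<open>X\<close> and \<open>Y\<close> consists of the common blocks \<open>J\<close> and a common part \<open>u\<close> of the
first blocks that differ. The matrix of the shift is the product of the word matrix of
\<open>concat J @ u\<close> and a matrix that is bounded below by \<open>gap\<close>. There are finitely many words \<open>u\<close>, so up to
a constant its singular weight is at least the product of the block weights over \<open>J\<close>.\<close>

lemma pair_average:
  assumes "M \<ge> 1" "0 \<le> t" "t \<le> real M"
  obtains C where "C \<ge> 0" and "\<And>r X Y. r > 0 \<Longrightarrow> length X = length Y \<Longrightarrow> X \<noteq> Y \<Longrightarrow>
     set X \<subseteq> words N \<Longrightarrow> set Y \<subseteq> words N \<Longrightarrow>
     \<bar>LBINT a. exp (- 1 * (norm a)\<^sup>2) *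
         corr (band M r) (band M r) (word_point T a (concat Y) - word_point T a (concat X))\<bar>
       \<le> C * r powr t * split_weight (\<lambda>b. singular_weight t (word_matrix T b)) X Y"
proof -
  obtain C0 where C0: "C0 \<ge> 0" and avg: "\<And>(\<zeta> :: real ^ 'd ^ 'm \<Rightarrow> real ^ 'd) \<iota> S (t::real) r.
    transversal \<zeta> \<iota> S \<Longrightarrow>
    0 \<le> t \<Longrightarrow> t \<le> real M \<Longrightarrow> r > 0 \<Longrightarrow>
    \<bar>LBINT a. exp (- 1 * (norm a)\<^sup>2) * corr (band M r) (band M r) (\<zeta> a)\<bar>
      \<le> C0 * r powr t / singular_weight t S"
    using gaussian_average_corr_band[OF assms(1), where 'p="real ^ 'd ^ 'm" and 'n='d] by blast
  let ?\<phi> = "\<lambda>b. singular_weight t (word_matrix T b)"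
  let ?U = "{u :: 'm list. length u \<le> N}"
  define c where "c = Min (?\<phi> ` ?U)"
  have finU: "finite ?U" using finite_lists_length_le[of "UNIV :: 'm set" N] by simp
  have "c \<in> ?\<phi> ` ?U" unfolding c_def by (intro Min_in) (use finU in \<open>auto intro: exI[of _ "[]"]\<close>)
  then have c0: "c > 0" using singular_weight_pos[OF invertible_word_matrix] by auto
  have c_le: "c \<le> ?\<phi> u" if "length u \<le> N" for u
    unfolding c_def using that finU by (intro Min_le) auto
  define C where "C = C0 / (c * gap powr t * gap ^ CARD('d))"
  have Cn: "C \<ge> 0" using C0 c0 gap_pos by (simp add: C_def)
  have "\<bar>LBINT a. exp (- 1 * (norm a)\<^sup>2) *
         corr (band M r) (band M r) (word_point T a (concat Y) - word_point T a (concat X))\<bar>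
       \<le> C * r powr t * split_weight ?\<phi> X Y"
    if r: "r > 0" and XY: "length X = length Y" "X \<noteq> Y" "set X \<subseteq> words N" "set Y \<subseteq> words N" for r X Y
  proof -
    obtain J b X' b' Y' where J: "b \<noteq> b'" "X = J @ [b] @ X'" "Y = J @ [b'] @ Y'"
      using same_length_different[OF XY(2,1)] by blast
    have lb: "length b = N" "length b' = N" using XY(3,4) J by (auto simp: words_def)
    then have "length b = length b'" by simp
    from same_length_different[OF J(1) this]
    obtain u i x j y where u: "i \<noteq> j" "b = u @ [i] @ x" "b' = u @ [j] @ y"
      by blast
    let ?I = "concat J @ u"
    let ?W = "word_matrix T ?I"
    let ?x = "x @ concat X'" and ?y = "y @ concat Y'"
    let ?\<iota> = "opposite_shift j i"
    let ?\<zeta> = "\<lambda>a. word_point T a (concat Y) - word_point T a (concat X)"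
    define L where "L v = word_point T (?\<iota> v) (j # ?y) - word_point T (?\<iota> v) (i # ?x)" for v :: "real ^ 'd"
    have cX: "concat X = ?I @ i # ?x" "concat Y = ?I @ j # ?y" by (simp_all add: J u)
    have \<zeta>: "?\<zeta> a = ?W *v (word_point T a (j # ?y) - word_point T a (i # ?x))" for a
      unfolding cX word_point_append[of T _ ?I] matrix_vector_mult_diff_distrib by simp
    have lin\<zeta>: "linear ?\<zeta>"
      by (intro linear_compose_sub linear_word_point)
    have linL: "linear L"
      unfolding L_def
      by (intro linear_compose_sub linear_compose[OF linear_opposite_shift linear_word_point, unfolded o_def])
    have matL: "matrix L *v v = L v" for v
      using fun_cong[OF matrix_vector_mul(2)[OF linL]] by simp
    define S where "S = ?W ** matrix L"
    have S: "S *v v = ?W *v L v" for v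
      by (simp add: S_def matrix_vector_mul_assoc[symmetric] matL)
    have gapL: "gap * norm v \<le> norm (L v)" for v
      unfolding L_def using transversality[of j i v] u(1) by blast
    have \<phi>L: "gap powr t * gap ^ CARD('d) \<le> singular_weight t (matrix L)"
      unfolding singular_weight_def
    proof (intro mult_mono)
      show "gap ^ CARD('d) \<le> \<bar>det (matrix L)\<bar>"
        by (rule abs_det_ge_power[OF gap_pos]) (simp add: matL gapL)
      have "gap \<le> smallest_singular_value (matrix L)"
        by (rule smallest_singular_value_greatest) (simp add: matL gapL)
      then show "gap powr t \<le> smallest_singular_value (matrix L) powr t"
        using assms(2) gap_pos by (intro powr_mono2) auto
    qed (use gap_pos in auto)
    have pJ: "prod_list (map ?\<phi> J) > 0"
      by (induction J) (auto simp: singular_weight_pos[OF invertible_word_matrix])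
    have "prod_list (map ?\<phi> J) * c * (gap powr t * gap ^ CARD('d))
        \<le> (?\<phi> (concat J) * ?\<phi> u) * singular_weight t (matrix L)"
      using c0 lb(1) u(2) pJ assms(2) \<phi>L gap_pos
      by (intro mult_mono singular_weight_concat c_le mult_nonneg_nonneg singular_weight_nonneg) auto
    also have "\<dots> \<le> ?\<phi> ?I * singular_weight t (matrix L)"
      unfolding word_matrix_append
      by (intro mult_right_mono singular_weight_mult assms(2) singular_weight_nonneg)
    also have "\<dots> \<le> singular_weight t S"
      unfolding S_def by (rule singular_weight_mult[OF assms(2)])
    finally have \<phi>S: "prod_list (map ?\<phi> J) * c * (gap powr t * gap ^ CARD('d)) \<le> singular_weight t S" .
    have pos: "prod_list (map ?\<phi> J) * c * (gap powr t * gap ^ CARD('d)) > 0"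
      using pJ c0 gap_pos by simp
    then have "singular_weight t S > 0" using \<phi>S by linarith
    then have "det S \<noteq> 0" by (auto simp: singular_weight_def)
    then have "transversal ?\<zeta> ?\<iota> S"
      unfolding transversal_def using lin\<zeta> \<zeta> S
      by (auto simp: L_def linear_opposite_shift norm_opposite_shift)
    then have "\<bar>LBINT a. exp (- 1 * (norm a)\<^sup>2) * corr (band M r) (band M r) (?\<zeta> a)\<bar>
        \<le> C0 * r powr t / singular_weight t S"
      using assms(2,3) r by (rule avg)
    also have "\<dots> \<le> C0 * r powr t / (prod_list (map ?\<phi> J) * c * (gap powr t * gap ^ CARD('d)))"
      using C0 \<open>singular_weight t S > 0\<close> by (intro divide_left_mono[OF \<phi>S _ mult_pos_pos[OF _ pos]]) auto
    also have "\<dots> = C * r powr t * split_weight ?\<phi> X Y"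
    proof -
      have "split_weight ?\<phi> X Y = 1 / prod_list (map ?\<phi> J)"
        using split_weight_append[OF J(1), of ?\<phi> J X' Y'] J(2,3) by simp
      then show ?thesis by (simp add: C_def mult_ac)
    qed
    finally show ?thesis .
  qed
  then show thesis using that Cn by blast
qed

end

text \<open>Here \<open>words N\<close> is the alphabet of blocks, with the singular weights of its word matrices as
weights; the bounds on \<open>t\<close> allow differences of order \<open>Suc CARD('d)\<close> to be used throughout.\<close>

locale affine_blocks = short_contractions T for T :: "'m::finite \<Rightarrow> real ^ 'd ^ 'd" +
  fixes t :: real and N :: nat
  assumes t_gt: "real CARD('d) < t" and t_le: "t \<le> real (Suc CARD('d))" and N_pos: "N \<ge> 1"
    and sum_gt_1: "(\<Sum>b\<in>words N. singular_weight t (word_matrix T b)) > 1"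
begin

definition "block_weight b = singular_weight t (word_matrix T b)"

sublocale block_weights "words N" block_weight
proof
  have t0: "t \<ge> 0" using t_gt of_nat_0_le_iff[of "CARD('d)", where 'a=real] by linarith
  show "finite (words N :: 'm list set)" by (rule finite_words)
  show "block_weight b > 0" for b
    unfolding block_weight_def by (intro singular_weight_pos invertible_word_matrix)
  show "block_weight b \<le> 1" for b
    unfolding block_weight_def by (rule singular_weight_le_1[OF t0])
  show "1 < (\<Sum>b\<in>words N. block_weight b)" using sum_gt_1 by (simp add: block_weight_def)
qed

abbreviation "blocks \<equiv> block_words (words N)"

abbreviation "prob \<equiv> word_prob p"

definition "site a X = word_point T a (concat X)"

definition "block_energy r n a = energy (band (Suc CARD('d)) r) (blocks n) prob (site a)"

lemma t_nonneg: "t \<ge> 0"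
  using t_gt of_nat_0_le_iff[of "CARD('d)", where 'a=real] by linarith

lemma block_energy_nonneg: "r > 0 \<Longrightarrow> block_energy r n a \<ge> 0"
  unfolding block_energy_def
  by (subst energy_eq) (auto intro!: test_function_band integral_nonneg_AE)

lemma integrable_corr_site:
  assumes "r > 0"
  shows "integrable lborel (\<lambda>a. exp (- 1 * (norm a)\<^sup>2) * corr (band (Suc CARD('d)) r) (band (Suc CARD('d)) r) (site a Y - site a X))"
proof (rule integrable_gaussian_mult)
  let ?f = "band (Suc CARD('d)) r :: real ^ 'd \<Rightarrow> real"
  have lin: "linear (\<lambda>a. site a Y - site a X)"
    unfolding site_def by (intro linear_compose_sub linear_word_point)
  have f: "test_function ?f" by (rule test_function_band[OF assms])
  note [measurable] = test_function_measurable[OF f]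
  have "(\<lambda>z. corr ?f ?f z) \<in> borel_measurable borel"
    unfolding corr_def by measurable
  moreover have "(\<lambda>a. site a Y - site a X) \<in> borel_measurable borel"
    by (rule borel_measurable_linear[OF lin])
  ultimately show "(\<lambda>a. corr ?f ?f (site a Y - site a X)) \<in> borel_measurable borel"
    by measurable
  show "\<bar>corr ?f ?f (site a Y - site a X)\<bar> \<le> band_const TYPE(real ^ 'd) (Suc CARD('d)) / r ^ DIM(real ^ 'd)" for a
    by (rule corr_band_bound[OF assms])
qed simp

text \<open>Pairs of distinct words give the term \<open>r powr t\<close>. The diagonal gives the other term, which is
negligible when the number \<open>n\<close> of blocks is large compared to the logarithm of \<open>1 / r\<close>.\<close>

lemma expected_energy:
  obtains C where "C \<ge> 0" and
    "\<And>r n. r > 0 \<Longrightarrow> integrable lborel (\<lambda>a. exp (- 1 * (norm a)\<^sup>2) * block_energy r n a)" and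
    "\<And>r n. r > 0 \<Longrightarrow> (LBINT a. exp (- 1 * (norm a)\<^sup>2) * block_energy r n a)
        \<le> C * (r powr t + (1 / S) ^ n / r ^ CARD('d))"
proof -
  obtain C1 where C1: "C1 \<ge> 0" and pair: "\<And>r X Y. r > 0 \<Longrightarrow> length X = length Y \<Longrightarrow> X \<noteq> Y \<Longrightarrow>
     set X \<subseteq> words N \<Longrightarrow> set Y \<subseteq> words N \<Longrightarrow>
     \<bar>LBINT a. exp (- 1 * (norm a)\<^sup>2) * corr (band (Suc CARD('d)) r) (band (Suc CARD('d)) r) (site a Y - site a X)\<bar>
       \<le> C1 * r powr t * split_weight block_weight X Y"
    using pair_average[of "Suc CARD('d)" t N] t_nonneg t_le unfolding site_def block_weight_def[abs_def] by auto
  let ?\<psi> = "\<lambda>a::real^'d^'m. exp (- 1 * (norm a)\<^sup>2)"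
  define G where "G = (LBINT a. ?\<psi> a)"
  have G0: "G \<ge> 0" by (simp add: G_def integral_nonneg_AE)
  define K where "K = band_const TYPE(real ^ 'd) (Suc CARD('d))"
  have K0: "K \<ge> 0" using band_const_nonneg by (simp add: K_def)
  define C where "C = C1 * (S / (S - 1)) + G * K"
  have S: "S > 1" by (rule sum_w)
  have C: "C \<ge> 0" "C1 * (S / (S - 1)) \<le> C" "G * K \<le> C" using C1 G0 K0 S by (auto simp: C_def)
  have expand: "?\<psi> a * block_energy r n a = (\<Sum>X\<in>blocks n. \<Sum>Y\<in>blocks n.
      prob X * prob Y * (?\<psi> a * corr (band (Suc CARD('d)) r) (band (Suc CARD('d)) r) (site a Y - site a X)))" for a r n
    unfolding block_energy_def energy_def sum_distrib_left by (simp only: mult_ac)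
  have int: "integrable lborel (\<lambda>a. ?\<psi> a * block_energy r n a)" if "r > 0" for r n
    unfolding expand by (intro Bochner_Integration.integrable_sum integrable_mult_right integrable_corr_site that)
  have "(LBINT a. ?\<psi> a * block_energy r n a) \<le> C * (r powr t + (1 / S) ^ n / r ^ CARD('d))"
    if r: "r > 0" for r n
  proof -
    let ?I = "\<lambda>X Y. LBINT a. ?\<psi> a * corr (band (Suc CARD('d)) r) (band (Suc CARD('d)) r) (site a Y - site a X)"
    have I: "?I X Y \<le> C1 * r powr t * split_weight block_weight X Y + (if X = Y then G * K / r ^ CARD('d) else 0)"
      if "X \<in> blocks n" "Y \<in> blocks n" for X Y
    proof (cases "X = Y")
      case False
      with pair[OF r, of X Y] that show ?thesis by (auto simp: block_words_def)
    next
      case True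
      have "?I X Y \<le> (LBINT a. ?\<psi> a * (K / r ^ CARD('d)))"
      proof (rule integral_mono)
        show "integrable lborel (\<lambda>a. ?\<psi> a * (K / r ^ CARD('d)))"
          using integrable_gaussian[of 1, where 'p="real^'d^'m"] by (intro integrable_mult_left) simp
        show "?\<psi> a * corr (band (Suc CARD('d)) r) (band (Suc CARD('d)) r) (site a Y - site a X) \<le> ?\<psi> a * (K / r ^ CARD('d))" for a
          using corr_band_bound[OF r, of "Suc CARD('d)" "site a Y - site a X"] by (intro mult_left_mono) (auto simp: K_def)
      qed (rule integrable_corr_site[OF r])
      also have "\<dots> = G * K / r ^ CARD('d)" by (simp add: G_def)
      finally show ?thesis using True by simp
    qed
    have "(LBINT a. ?\<psi> a * block_energy r n a) = (\<Sum>X\<in>blocks n. \<Sum>Y\<in>blocks n. prob X * prob Y * ?I X Y)"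
      unfolding expand
      by (subst Bochner_Integration.integral_sum, intro Bochner_Integration.integrable_sum integrable_mult_right integrable_corr_site r,
          subst Bochner_Integration.integral_sum, intro integrable_mult_right integrable_corr_site r)
        (simp only: integral_mult_right_zero)
    also have "\<dots> \<le> (\<Sum>X\<in>blocks n. \<Sum>Y\<in>blocks n. prob X * prob Y *
       (C1 * r powr t * split_weight block_weight X Y + (if X = Y then G * K / r ^ CARD('d) else 0)))"
      by (intro sum_mono mult_left_mono I mult_nonneg_nonneg word_prob_nonneg)
    also have "\<dots> = (\<Sum>X\<in>blocks n. \<Sum>Y\<in>blocks n. C1 * r powr t * (prob X * prob Y * split_weight block_weight X Y)
       + (if X = Y then G * K / r ^ CARD('d) * (prob X * prob Y) else 0))"
      by (intro sum.cong refl) (simp add: algebra_simps)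
    also have "\<dots> = C1 * r powr t * (\<Sum>X\<in>blocks n. \<Sum>Y\<in>blocks n. prob X * prob Y * split_weight block_weight X Y)
       + G * K / r ^ CARD('d) * (\<Sum>X\<in>blocks n. prob X * prob X)"
      using finite_block_words[OF finite_B] by (simp add: sum.distrib sum_distrib_left)
    also have "\<dots> \<le> C1 * r powr t * (S / (S - 1)) + G * K / r ^ CARD('d) * (1 / S) ^ n"
      using C1 G0 K0 r by (intro add_mono mult_left_mono sum_split_weight sum_word_prob_sq) auto
    also have "\<dots> = (C1 * (S / (S - 1))) * r powr t + (G * K) * ((1 / S) ^ n / r ^ CARD('d))" by simp
    also have "\<dots> \<le> C * r powr t + C * ((1 / S) ^ n / r ^ CARD('d))"
      using C S r by (intro add_mono mult_right_mono) auto
    finally show ?thesis by (simp add: distrib_left)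
  qed
  then show thesis using that C(1) int by blast
qed

end

section \<open>Almost sure uniform convergence\<close>

lemma AE_summable_of_geometric_integrals:
  fixes g :: "nat \<Rightarrow> 'a \<Rightarrow> real"
  assumes int: "\<And>k. integrable M (g k)" and nonneg: "\<And>k x. g k x \<ge> 0"
    and le: "\<And>k. (\<integral>x. g k x \<partial>M) \<le> C * \<theta> ^ k" and \<theta>: "0 \<le> \<theta>" "\<theta> < 1"
  shows "AE x in M. summable (\<lambda>k. g k x)"
proof -
  have [measurable]: "g k \<in> borel_measurable M" for k using int by auto
  have C0: "C * \<theta> ^ k \<ge> 0" for k
  proof -
    have "0 \<le> (\<integral>x. g k x \<partial>M)" by (rule integral_nonneg_AE) (simp add: nonneg)
    then show ?thesis using le[of k] by linarith
  qed
  have sumC: "summable (\<lambda>k. C * \<theta> ^ k)" using \<theta> by (intro summable_mult summable_geometric) auto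
  have "(\<integral>\<^sup>+x. (\<Sum>k. ennreal (g k x)) \<partial>M) = (\<Sum>k. \<integral>\<^sup>+x. ennreal (g k x) \<partial>M)"
    by (rule nn_integral_suminf) measurable
  also have "\<dots> = (\<Sum>k. ennreal (\<integral>x. g k x \<partial>M))"
    by (subst nn_integral_eq_integral[OF int]) (auto simp: nonneg)
  also have "\<dots> \<le> (\<Sum>k. ennreal (C * \<theta> ^ k))"
    by (intro suminf_le ennreal_leI le) auto
  also have "\<dots> = ennreal (\<Sum>k. C * \<theta> ^ k)"
    by (rule suminf_ennreal2[OF C0 sumC])
  also have "\<dots> < \<infinity>" by simp
  finally have "AE x in M. (\<Sum>k. ennreal (g k x)) \<noteq> \<infinity>"
    by (intro nn_integral_PInf_AE) auto
  then show ?thesis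
    by (rule AE_mp) (auto intro!: AE_I2 summable_suminf_not_top nonneg)
qed

lemma smoother_lipschitz:
  fixes y z :: "'a::euclidean_space"
  assumes "r > 0"
  shows "\<bar>smoother M r y - smoother M r z\<bar>
    \<le> 2 ^ M * 2 ^ M / (\<integral>v. tent v \<partial>(lborel :: 'a measure)) / r ^ (DIM('a) + 1) * norm (y - z)"
proof -
  let ?L = "2 ^ M / (\<integral>v. tent v \<partial>(lborel :: 'a measure)) / r ^ (DIM('a) + 1)"
  have L: "?L \<ge> 0" using integral_tent_pos[where 'a='a] assms by (intro divide_nonneg_pos) auto
  have "\<bar>smoother M r y - smoother M r z\<bar> \<le> ?L * (\<integral>u. \<bar>mollifier M r u\<bar> \<partial>(lborel :: 'a measure)) * norm (y - z)"
    unfolding smoother_def by (intro corr_lipschitz test_function_mollifier assms mollifier_lipschitz)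
  also have "\<dots> \<le> ?L * 2 ^ M * norm (y - z)"
    by (intro mult_right_mono mult_left_mono integral_abs_mollifier assms L) auto
  finally show ?thesis by simp
qed

lemma smoother_support:
  assumes "r > 0" "2 * real M * r < norm z" shows "smoother M r z = 0"
  unfolding smoother_def
  by (rule corr_eq_0[of "real M * r" _ "real M * r"]) (use assms mollifier_support in \<open>auto simp: algebra_simps\<close>)

lemma test_function_smoother:
  assumes "r > 0"
  shows "test_function (smoother M r :: 'a::euclidean_space \<Rightarrow> real)"
  unfolding test_function_def
proof (intro conjI exI allI impI)
  let ?L = "2 ^ M * 2 ^ M / (\<integral>v. tent v \<partial>(lborel :: 'a measure)) / r ^ (DIM('a) + 1)"
  have "?L \<ge> 0" using integral_tent_pos[where 'a='a] assms by (intro divide_nonneg_pos) auto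
  then have "?L-lipschitz_on UNIV (smoother M r :: 'a \<Rightarrow> real)"
    unfolding lipschitz_on_def dist_norm real_norm_def by (intro conjI ballI smoother_lipschitz[OF assms])
  then show "continuous_on UNIV (smoother M r :: 'a \<Rightarrow> real)" by (rule lipschitz_on_continuous_on)
qed (use smoother_support[OF assms] in blast)

lemma integral_smoother:
  assumes "r > 0" "M \<ge> 1"
  shows "(\<integral>z. smoother M r z \<partial>(lborel :: 'a::euclidean_space measure)) = 1"
  unfolding smoother_def using assms by (simp add: integral_corr test_function_mollifier integral_mollifier)

context affine_blocks
begin

text \<open>
The energy at scale \<open>2 ^ -k\<close> is of size \<open>2 powr (- k * t)\<close> in expectation, and the squared norm of the other factor is of
size \<open>2 ^ (k * d)\<close>. The weight \<open>lam k\<close> balances the two: \<open>lam k\<close> times the former and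
the latter divided by \<open>lam k\<close> are both of size \<open>decay ^ k\<close>.\<close>

definition "decay = 2 powr (- ((t - real CARD('d)) / 2))"

lemma decay: "0 < decay" "decay < 1"
  using t_gt by (auto simp: decay_def intro: powr_less_one)

definition "lam k = (2 ^ CARD('d)) ^ k / decay ^ k"

lemma lam_pos: "lam k > 0"
  using decay by (simp add: lam_def)

text \<open>
Number of blocks added when the scale is halved. The first condition makes the diagonal of the energy
negligible, the second one makes the points of consecutive levels indistinguishable at the current scale.\<close>

definition "block_rate = (SOME c::nat. (1 / S) ^ c \<le> (1 / 2) ^ (2 * CARD('d) + 1) \<and> rho ^ c \<le> (1 / 2) ^ (CARD('d) + 2))"

lemma block_rate: "(1 / S) ^ block_rate \<le> (1 / 2) ^ (2 * CARD('d) + 1)" "rho ^ block_rate \<le> (1 / 2) ^ (CARD('d) + 2)"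
proof -
  have S1: "0 \<le> 1 / S" "1 / S < 1" using sum_w by auto
  have r1: "0 \<le> rho" "rho < 1" using rho_nonneg rho_less by auto
  obtain c1 where c1: "(1 / S) ^ c1 < (1 / 2) ^ (2 * CARD('d) + 1)"
    using real_arch_pow_inv[OF _ S1(2), of "(1 / 2) ^ (2 * CARD('d) + 1)"] by auto
  obtain c2 where c2: "rho ^ c2 < (1 / 2) ^ (CARD('d) + 2)"
    using real_arch_pow_inv[OF _ r1(2), of "(1 / 2) ^ (CARD('d) + 2)"] by auto
  have "(1 / S) ^ max c1 c2 \<le> (1 / S) ^ c1" "rho ^ max c1 c2 \<le> rho ^ c2"
    using S1 r1 by (auto intro!: power_decreasing)
  with c1 c2 have "\<exists>c. (1 / S) ^ c \<le> (1 / 2) ^ (2 * CARD('d) + 1) \<and> rho ^ c \<le> (1 / 2) ^ (CARD('d) + 2)"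
    by (intro exI[of _ "max c1 c2"]) auto
  from someI_ex[OF this] show "(1 / S) ^ block_rate \<le> (1 / 2) ^ (2 * CARD('d) + 1)" "rho ^ block_rate \<le> (1 / 2) ^ (CARD('d) + 2)"
    by (simp_all add: block_rate_def)
qed

lemma half_powr: "((1 / 2) ^ k) powr t = (2 powr - t) ^ k"
  by (simp add: powr_power powr_realpow[symmetric] powr_powr powr_divide powr_minus_divide power_one_over mult.commute)

lemma lam_half_powr: "lam k * ((1 / 2) ^ k) powr t = decay ^ k"
proof -
  have "2 ^ CARD('d) * 2 powr - t = decay * decay"
    unfolding decay_def by (simp add: powr_realpow[symmetric] powr_add[symmetric])
  then have "((2 ^ CARD('d)) ^ k * (2 powr - t) ^ k) = decay ^ k * decay ^ k"
    by (simp add: power_mult_distrib[symmetric])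
  then show ?thesis unfolding lam_def half_powr using decay by simp
qed

text \<open>The positive Gaussian factor that is present in the expectation can be divided out for each fixed \<open>a\<close>.\<close>

lemma AE_summable_energy:
  "AE a in lborel. summable (\<lambda>k. lam k * block_energy ((1 / 2) ^ k) (block_rate * Suc k) a)"
proof -
  let ?\<psi> = "\<lambda>a::real^'d^'m. exp (- 1 * (norm a)\<^sup>2)"
  let ?r = "\<lambda>k. (1 / 2 :: real) ^ k"
  obtain C where C: "C \<ge> 0" and
    int: "\<And>r n. r > 0 \<Longrightarrow> integrable lborel (\<lambda>a. ?\<psi> a * block_energy r n a)" and
    le: "\<And>r n. r > 0 \<Longrightarrow> (LBINT a. ?\<psi> a * block_energy r n a)
        \<le> C * (r powr t + (1 / S) ^ n / r ^ CARD('d))"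
    using expected_energy by blast
  define g where "g k a = lam k * (?\<psi> a * block_energy (?r k) (block_rate * Suc k) a)" for k a
  have rk: "?r k > 0" for k by simp
  have "AE a in lborel. summable (\<lambda>k. g k a)"
  proof (rule AE_summable_of_geometric_integrals)
    show "integrable lborel (g k)" for k
      unfolding g_def[abs_def] by (intro integrable_mult_right int) simp
    show "g k a \<ge> 0" for k a
      unfolding g_def using lam_pos[of k] block_energy_nonneg[OF rk, of k "block_rate * Suc k" a] by simp
    show "(LBINT a. g k a) \<le> (2 * C) * decay ^ k" for k
    proof -
      have "(1 / S) ^ (block_rate * Suc k) \<le> (1 / S) ^ (block_rate * k)"
        using sum_w by (intro power_decreasing) auto
      also have "\<dots> = ((1 / S) ^ block_rate) ^ k" by (rule power_mult)
      also have "\<dots> \<le> ((1 / 2) ^ (2 * CARD('d) + 1)) ^ k"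
        using sum_w by (intro power_mono block_rate(1)) auto
      also have "\<dots> = (?r k) ^ (CARD('d) + 1) * (?r k) ^ CARD('d)"
        by (simp only: power_add[symmetric] power_mult[symmetric]) (simp add: algebra_simps mult_2_right)
      finally have "(1 / S) ^ (block_rate * Suc k) / (?r k) ^ CARD('d) \<le> (?r k) ^ (CARD('d) + 1)"
        by (simp add: field_simps)
      also have "\<dots> = ?r k powr real (CARD('d) + 1)" by (rule powr_realpow[symmetric]) simp
      also have "\<dots> \<le> ?r k powr t" using t_le by (intro powr_mono') (auto simp: power_le_one)
      finally have e: "(1 / S) ^ (block_rate * Suc k) / (?r k) ^ CARD('d) \<le> ?r k powr t" .
      have "(LBINT a. g k a) = lam k * (LBINT a. ?\<psi> a * block_energy (?r k) (block_rate * Suc k) a)"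
        unfolding g_def by (rule integral_mult_right_zero)
      also have "\<dots> \<le> lam k * (C * (?r k powr t + ?r k powr t))"
        using lam_pos[of k] C e
        by (intro mult_left_mono order_trans[OF le]) (auto intro!: mult_left_mono)
      also have "\<dots> = (2 * C) * (lam k * ?r k powr t)" by simp
      also have "\<dots> = (2 * C) * decay ^ k" by (simp only: lam_half_powr)
      finally show ?thesis .
    qed
  qed (use decay in auto)
  then show ?thesis
  proof (rule AE_mp, intro AE_I2 impI)
    fix a assume "summable (\<lambda>k. g k a)"
    then have "summable (\<lambda>k. inverse (?\<psi> a) * g k a)" by (rule summable_mult)
    moreover have "inverse (?\<psi> a) * g k a = lam k * block_energy (?r k) (block_rate * Suc k) a" for k
      by (simp add: g_def)
    ultimately show "summable (\<lambda>k. lam k * block_energy (?r k) (block_rate * Suc k) a)" by (simp only:)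
  qed
qed

definition "approx_density a k z = (\<Sum>X\<in>blocks (block_rate * k). prob X * smoother (Suc CARD('d)) ((1 / 2) ^ k) (z - site a X))"

lemma test_function_shifted_smoother: "r > 0 \<Longrightarrow> test_function (\<lambda>z. smoother M r (z - c))"
  using test_function_shift[OF test_function_smoother, of r M "- c"] by simp

lemma test_function_approx_density: "test_function (approx_density a k)"
  unfolding approx_density_def[abs_def]
  by (intro test_function_sum test_function_cmult test_function_shifted_smoother finite_block_words finite_B) simp

lemma integral_approx_density: "(LBINT z. approx_density a k z) = 1"
proof -
  have i: "integrable lborel (\<lambda>z::real^'d. smoother (Suc CARD('d)) ((1 / 2) ^ k) (z - c))" for c
    by (intro test_function_integrable test_function_shifted_smoother) simp
  have "(\<integral>z. smoother (Suc CARD('d)) ((1 / 2) ^ k) (z - c) \<partial>(lborel :: (real^'d) measure)) = 1" for c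
  proof -
    have "(\<integral>z. smoother (Suc CARD('d)) ((1 / 2) ^ k) (z + (- c)) \<partial>(lborel :: (real^'d) measure))
        = (\<integral>z. smoother (Suc CARD('d)) ((1 / 2) ^ k) z \<partial>(lborel :: (real^'d) measure))"
      by (intro integral_lborel_shift test_function_measurable test_function_smoother) simp
    then show ?thesis by (simp add: integral_smoother)
  qed
  then show ?thesis
    unfolding approx_density_def
    by (subst Bochner_Integration.integral_sum) (auto intro!: integrable_mult_right i simp: sum_word_prob)
qed

lemma length_concat_blocks: "X \<in> blocks n \<Longrightarrow> length (concat X) = N * n"
proof (induction X arbitrary: n)
  case (Cons b X)
  then obtain m where "n = Suc m" "X \<in> blocks m" "length b = N"
    by (auto simp: block_words_def words_def)
  with Cons.IH show ?case by simp
qed (simp add: block_words_def)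

lemma rho_power_blocks: "rho ^ (N * (block_rate * k)) \<le> ((1 / 2) ^ k) ^ (CARD('d) + 2)"
proof -
  have "rho ^ (N * (block_rate * k)) \<le> rho ^ (block_rate * k)"
    using rho_nonneg rho_less N_pos by (intro power_decreasing) auto
  also have "\<dots> = (rho ^ block_rate) ^ k" by (rule power_mult)
  also have "\<dots> \<le> ((1 / 2) ^ (CARD('d) + 2)) ^ k"
    using rho_nonneg by (intro power_mono block_rate(2)) auto
  finally show ?thesis by (simp only: power_mult[symmetric] mult.commute)
qed

lemma norm_word_point': "norm (word_point T a I) \<le> norm a / (1 - rho)"
  by (rule norm_word_point) (rule Finite_Cartesian_Product.norm_nth_le)

text \<open>Lengthening a word by further blocks moves its point by at most \<open>rho\<close> to the length of the word, times a constant.\<close>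

lemma refine_blocks:
  assumes L: "\<And>y z. \<bar>h y - h z\<bar> \<le> L * norm (y - z)" and "L \<ge> 0"
  shows "\<bar>(\<Sum>X\<in>blocks (n + m). prob X * h (z - site a X)) - (\<Sum>X\<in>blocks n. prob X * h (z - site a X))\<bar>
     \<le> L * (rho ^ (N * n) * (norm a / (1 - rho)))"
proof -
  let ?R = "L * (rho ^ (N * n) * (norm a / (1 - rho)))"
  have "(\<Sum>X\<in>blocks n. prob X * h (z - site a X)) = (\<Sum>X\<in>blocks n. \<Sum>Y\<in>blocks m. prob X * prob Y * h (z - site a X))"
  proof (rule sum.cong[OF refl])
    fix X
    have "(\<Sum>Y\<in>blocks m. prob X * prob Y * h (z - site a X)) = prob X * h (z - site a X) * (\<Sum>Y\<in>blocks m. prob Y)"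
      unfolding sum_distrib_left by (simp only: mult_ac)
    then show "prob X * h (z - site a X) = (\<Sum>Y\<in>blocks m. prob X * prob Y * h (z - site a X))"
      by (simp add: sum_word_prob)
  qed
  then have "(\<Sum>X\<in>blocks (n + m). prob X * h (z - site a X)) - (\<Sum>X\<in>blocks n. prob X * h (z - site a X))
     = (\<Sum>X\<in>blocks n. \<Sum>Y\<in>blocks m. prob X * prob Y * (h (z - site a (X @ Y)) - h (z - site a X)))"
    unfolding sum_block_words_add by (simp add: sum_subtractf right_diff_distrib)
  also have "\<bar>\<dots>\<bar> \<le> (\<Sum>X\<in>blocks n. \<Sum>Y\<in>blocks m. prob X * prob Y * ?R)"
  proof (rule order_trans[OF sum_abs], rule sum_mono, rule order_trans[OF sum_abs], rule sum_mono)
    fix X Y :: "'m list list" assume X: "X \<in> blocks n" and Y: "Y \<in> blocks m"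
    have "\<bar>h (z - site a (X @ Y)) - h (z - site a X)\<bar> \<le> L * norm (word_matrix T (concat X) *v site a Y)"
      using L[of "z - site a (X @ Y)" "z - site a X"] by (simp add: site_def word_point_append)
    also have "\<dots> \<le> L * (rho ^ (N * n) * (norm a / (1 - rho)))"
    proof (intro mult_left_mono \<open>L \<ge> 0\<close>)
      have "norm (word_matrix T (concat X) *v site a Y) \<le> rho ^ (N * n) * norm (site a Y)"
        using norm_word_matrix[of "concat X" "site a Y"] by (simp add: length_concat_blocks[OF X])
      also have "\<dots> \<le> rho ^ (N * n) * (norm a / (1 - rho))"
        unfolding site_def using rho_nonneg by (intro mult_left_mono norm_word_point') auto
      finally show "norm (word_matrix T (concat X) *v site a Y) \<le> rho ^ (N * n) * (norm a / (1 - rho))" .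
    qed
    finally have "\<bar>h (z - site a (X @ Y)) - h (z - site a X)\<bar> \<le> ?R" .
    moreover have nn: "0 \<le> prob X * prob Y"
      using word_prob_nonneg[OF X] word_prob_nonneg[OF Y] by simp
    ultimately show "\<bar>prob X * prob Y * (h (z - site a (X @ Y)) - h (z - site a X))\<bar> \<le> prob X * prob Y * ?R"
      unfolding abs_mult[of "prob X * prob Y"] abs_of_nonneg[OF nn] by (rule mult_left_mono)
  qed
  also have "\<dots> = ((\<Sum>X\<in>blocks n. prob X) * (\<Sum>Y\<in>blocks m. prob Y)) * ?R"
    by (simp only: sum_distrib_right[symmetric] sum_product)
  finally show ?thesis by (simp add: sum_word_prob)
qed

text \<open>From level \<open>k\<close> to level \<open>Suc k\<close>, first the words are lengthened while the scale is kept, which costs the last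
term, and then the scale is halved for the longer words, which costs the first two.\<close>

lemma approx_density_step:
  obtains C where "C \<ge> 0" and "\<And>a k z. \<bar>approx_density a (Suc k) z - approx_density a k z\<bar>
     \<le> lam k * block_energy ((1 / 2) ^ k) (block_rate * Suc k) a + C * decay ^ k + C * norm a * (1 / 2) ^ k"
proof -
  let ?M = "Suc CARD('d)"
  define K where "K = band_const TYPE(real ^ 'd) ?M"
  have K0: "K \<ge> 0" using band_const_nonneg by (simp add: K_def)
  define L where "L = 2 ^ ?M * 2 ^ ?M / (\<integral>v. tent v \<partial>(lborel :: (real ^ 'd) measure))"
  have L0: "L \<ge> 0" using integral_tent_pos[where 'a="real^'d"] unfolding L_def by (intro divide_nonneg_pos) auto
  define C where "C = max K (L / (1 - rho))"
  have C: "C \<ge> 0" "K \<le> C" "L / (1 - rho) \<le> C" using K0 by (auto simp: C_def)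
  have "\<bar>approx_density a (Suc k) z - approx_density a k z\<bar>
     \<le> lam k * block_energy ((1 / 2) ^ k) (block_rate * Suc k) a + C * decay ^ k + C * norm a * (1 / 2) ^ k" for a k z
  proof -
    let ?r = "(1 / 2 :: real) ^ k"
    have r: "?r > 0" by simp
    let ?F = "\<Sum>X\<in>blocks (block_rate * Suc k). prob X * smoother ?M ?r (z - site a X)"
    have "?r / 2 = (1 / 2) ^ Suc k" by simp
    then have "\<bar>?F - approx_density a (Suc k) z\<bar>
       \<le> lam k * block_energy ?r (block_rate * Suc k) a + K / ?r ^ CARD('d) / lam k"
      unfolding approx_density_def block_energy_def K_def
      using smoother_difference_le_energy[OF r lam_pos finite_block_words[OF finite_B], of prob ?M z "site a" "block_rate * Suc k" k]
      by simp
    also have "K / ?r ^ CARD('d) / lam k = K * decay ^ k"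
    proof -
      have "?r ^ CARD('d) * (2 ^ CARD('d)) ^ k = 1"
        by (simp add: power_mult[symmetric] mult.commute power_one_over)
      then have "?r ^ CARD('d) * lam k = 1 / decay ^ k" by (simp add: lam_def)
      then have "K / (?r ^ CARD('d) * lam k) = K * decay ^ k" by simp
      then show ?thesis by simp
    qed
    also have "K * decay ^ k \<le> C * decay ^ k" using C decay by (intro mult_right_mono) auto
    finally have 1: "\<bar>?F - approx_density a (Suc k) z\<bar> \<le> lam k * block_energy ?r (block_rate * Suc k) a + C * decay ^ k"
      by simp
    have sk: "block_rate * Suc k = block_rate * k + block_rate" by simp
    have "\<bar>?F - approx_density a k z\<bar> \<le> L / ?r ^ (CARD('d) + 1) * (rho ^ (N * (block_rate * k)) * (norm a / (1 - rho)))"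
      unfolding approx_density_def sk
    proof (rule refine_blocks)
      show "\<bar>smoother ?M ?r x - smoother ?M ?r y\<bar> \<le> L / ?r ^ (CARD('d) + 1) * norm (x - y)" for x y :: "real ^ 'd"
        using smoother_lipschitz[OF r, of ?M x y] by (simp add: L_def)
      show "L / ?r ^ (CARD('d) + 1) \<ge> 0" using L0 by simp
    qed
    also have "\<dots> \<le> L / ?r ^ (CARD('d) + 1) * (?r ^ (CARD('d) + 2) * (norm a / (1 - rho)))"
      using L0 rho_less by (intro mult_left_mono mult_right_mono rho_power_blocks) auto
    also have "?r ^ (CARD('d) + 2) = ?r ^ (CARD('d) + 1) * ?r" by simp
    also have "L / ?r ^ (CARD('d) + 1) * (?r ^ (CARD('d) + 1) * ?r * (norm a / (1 - rho))) = L / (1 - rho) * norm a * ?r"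
      by simp
    also have "\<dots> \<le> C * norm a * ?r" using C by (intro mult_right_mono) auto
    finally have 2: "\<bar>?F - approx_density a k z\<bar> \<le> C * norm a * ?r" .
    from 1 2 show ?thesis by linarith
  qed
  then show thesis using that C(1) by blast
qed

lemma approx_density_uniform_limit:
  assumes "summable (\<lambda>k. lam k * block_energy ((1 / 2) ^ k) (block_rate * Suc k) a)"
  obtains f where "uniform_limit UNIV (approx_density a) f sequentially"
proof -
  obtain C where C: "C \<ge> 0" and step: "\<And>a k z. \<bar>approx_density a (Suc k) z - approx_density a k z\<bar>
     \<le> lam k * block_energy ((1 / 2) ^ k) (block_rate * Suc k) a + C * decay ^ k + C * norm a * (1 / 2) ^ k"
    using approx_density_step by blast
  let ?d = "\<lambda>k z. approx_density a (Suc k) z - approx_density a k z"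
  have "summable (\<lambda>k. lam k * block_energy ((1 / 2) ^ k) (block_rate * Suc k) a + C * decay ^ k + C * norm a * (1 / 2) ^ k)"
    using decay by (intro summable_add assms summable_mult summable_geometric) auto
  then have "uniform_limit UNIV (\<lambda>n z. \<Sum>k<n. ?d k z) (\<lambda>z. suminf (\<lambda>k. ?d k z)) sequentially"
    by (rule Weierstrass_m_test[rotated]) (use step in auto)
  then have "uniform_limit UNIV (\<lambda>n z. approx_density a 0 z + (\<Sum>k<n. ?d k z))
      (\<lambda>z. approx_density a 0 z + suminf (\<lambda>k. ?d k z)) sequentially"
    by (intro uniform_limit_intros)
  moreover have "approx_density a 0 z + (\<Sum>k<n. ?d k z) = approx_density a n z" for n z
    by (simp add: sum_lessThan_telescope[of "\<lambda>k. approx_density a k z"])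
  ultimately show thesis using that by (simp add: eta_contract_eq)
qed

end

section \<open>The self-affine set\<close>

context short_contractions
begin

abbreviation "hutchinson a K \<equiv> \<Union>i. (\<lambda>x. T i *v x + a $ i) ` K"

lemma contraction_dist:
  "dist (T i *v x + a $ i) (T i *v y + a $ i) \<le> rho * dist x y"
  using norm_contraction[of i "x - y"] by (simp add: dist_norm matrix_vector_mult_diff_distrib)

text \<open>A ball that the maps send into itself has nested images, and their intersection is invariant: a point in
every image has, for one and the same letter and infinitely many levels, a preimage under the map of that letter, and this preimage
is unique because the map is injective.\<close>

lemma ex_invariant_compact:
  obtains K where "K \<noteq> {}" "compact K" "K = hutchinson a K"
proof -
  define R where "R = norm a / (1 - rho)"
  have R: "R \<ge> 0" "rho * R + norm a = R" using rho_less by (auto simp: R_def field_simps)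
  define Q where "Q n = (hutchinson a ^^ n) (cball 0 R)" for n
  have Q0: "Q 0 = cball 0 R" and QS: "Q (Suc n) = hutchinson a (Q n)" for n by (simp_all add: Q_def)
  have Q1: "Q 1 \<subseteq> Q 0"
  proof -
    have "norm (T i *v x + a $ i) \<le> R" if "norm x \<le> R" for i x
    proof -
      have "norm (T i *v x + a $ i) \<le> rho * norm x + norm a"
        by (rule order_trans[OF norm_triangle_ineq add_mono[OF norm_contraction Finite_Cartesian_Product.norm_nth_le]])
      also have "\<dots> \<le> rho * R + norm a" using that rho_nonneg by (simp add: mult_left_mono)
      finally show ?thesis using R by simp
    qed
    then show ?thesis unfolding One_nat_def QS Q0 by auto
  qed
  have Qdec: "Q (Suc n) \<subseteq> Q n" for n
  proof (induction n)
    case 0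
    then show ?case using Q1 by simp
  next
    case (Suc n)
    then show ?case unfolding QS[of "Suc n"] QS[of n] by blast
  qed
  have Qmono: "Q n \<subseteq> Q m" if "m \<le> n" for m n
    by (rule lift_Suc_antimono_le[OF _ that]) (rule Qdec)
  have cont: "continuous_on S (\<lambda>x. T i *v x + a $ i)" for i S
    by (intro continuous_on_add continuous_on_const linear_continuous_on matrix_vector_mul_bounded_linear)
  have Qc: "compact (Q n) \<and> Q n \<noteq> {}" for n
  proof (induction n)
    case 0
    then show ?case using R by (simp add: Q0)
  next
    case (Suc n)
    then show ?case unfolding QS by (auto intro!: compact_UN compact_continuous_image cont)
  qed
  define K where "K = (\<Inter>n. Q n)"
  have "K \<noteq> {}" unfolding K_def by (rule compact_nest) (use Qc Qmono in auto)
  moreover have "compact K"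
    unfolding K_def using Qc by (intro compact_Inter) auto
  moreover have "K = hutchinson a K"
  proof (intro equalityI subsetI)
    fix y assume "y \<in> hutchinson a K"
    then obtain i x where "x \<in> K" "y = T i *v x + a $ i" by auto
    then have "y \<in> Q (Suc n)" for n unfolding QS K_def by auto
    then show "y \<in> K" unfolding K_def using Qdec by blast
  next
    fix y assume y: "y \<in> K"
    then have "\<forall>n. \<exists>i. \<exists>x\<in>Q n. y = T i *v x + a $ i"
      unfolding K_def using QS by blast
    then obtain i where i: "\<And>n. \<exists>x\<in>Q n. y = T (i n) *v x + a $ (i n)" by metis
    obtain j where j: "infinite {n. i n = j}"
      using pigeonhole_infinite[of "UNIV :: nat set" i] by auto
    obtain B where B: "B ** T j = mat 1" using inv[of j] invertible_def by blast
    define x where "x = B *v (y - a $ j)"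
    have xu: "x' = x" if "y = T j *v x' + a $ j" for x'
      using that by (simp add: x_def matrix_vector_mul_assoc B)
    have "x \<in> Q n" for n
    proof -
      obtain m where "m \<ge> n" "i m = j" using j unfolding infinite_nat_iff_unbounded_le by auto
      with i[of m] xu have "x \<in> Q m" by metis
      then show ?thesis using Qmono \<open>m \<ge> n\<close> by blast
    qed
    moreover obtain n where "i n = j" using j not_finite_existsD by auto
    ultimately have "x \<in> K" "y = T j *v x + a $ j"
      using i[of n] xu unfolding K_def by auto
    then show "y \<in> hutchinson a K" by blast
  qed
  ultimately show thesis using that by blast
qed

text \<open>A point of \<open>K\<close> at maximal distance from \<open>K'\<close> is the image of a point of \<open>K\<close>, and the contraction makes its
distance smaller than the maximum unless this is \<open>0\<close>.\<close>

lemma invariant_compact_subset: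
  assumes K: "K \<noteq> {}" "compact K" "K = hutchinson a K" and K': "K' \<noteq> {}" "compact K'" "K' = hutchinson a K'"
  shows "K \<subseteq> K'"
proof -
  have "continuous_on K (\<lambda>x. infdist x K')" by (intro continuous_intros)
  then obtain x where x: "x \<in> K" "\<And>y. y \<in> K \<Longrightarrow> infdist y K' \<le> infdist x K'"
    using continuous_attains_sup[OF K(2,1)] by blast
  obtain i y where y: "y \<in> K" "x = T i *v y + a $ i" using x(1) K(3) by blast
  obtain z where z: "z \<in> K'" "infdist y K' = dist y z"
    using infdist_attains_inf[OF compact_imp_closed[OF K'(2)] K'(1)] by metis
  have "T i *v z + a $ i \<in> K'" using z(1) K'(3) by blast
  then have "infdist x K' \<le> dist x (T i *v z + a $ i)" by (rule infdist_le)
  also have "\<dots> \<le> rho * infdist y K'" unfolding y(2) z(2) by (rule contraction_dist)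
  also have "\<dots> \<le> rho * infdist x K'" using x(2)[OF y(1)] rho_nonneg by (rule mult_left_mono)
  finally have "(1 - rho) * infdist x K' \<le> 0" by (simp add: algebra_simps)
  then have "infdist x K' \<le> 0" using rho_less by (simp add: mult_le_0_iff)
  then have "infdist y K' = 0" if "y \<in> K" for y
    using x(2)[OF that] infdist_nonneg[of y K'] by linarith
  then show ?thesis
    using in_closed_iff_infdist_zero[OF compact_imp_closed[OF K'(2)] K'(1)] by blast
qed

lemma self_affine_set:
  "self_affine_set T a \<noteq> {}" "compact (self_affine_set T a)" "self_affine_set T a = hutchinson a (self_affine_set T a)"
proof -
  obtain K where K: "K \<noteq> {}" "compact K" "K = hutchinson a K" using ex_invariant_compact by blast
  have "self_affine_set T a = K"
    unfolding self_affine_set_def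
  proof (rule the_equality)
    fix L assume "L \<noteq> {} \<and> compact L \<and> L = hutchinson a L"
    then show "L = K"
      using invariant_compact_subset[OF K, of L] invariant_compact_subset[of L a K] K by blast
  qed (use K in auto)
  with K show "self_affine_set T a \<noteq> {}" "compact (self_affine_set T a)" "self_affine_set T a = hutchinson a (self_affine_set T a)"
    by simp_all
qed

lemma word_map_self_affine_set:
  "x \<in> self_affine_set T a \<Longrightarrow> word_point T a I + word_matrix T I *v x \<in> self_affine_set T a"
proof (induction I)
  case (Cons i I)
  have "T i *v (word_point T a I + word_matrix T I *v x) + a $ i \<in> hutchinson a (self_affine_set T a)"
    using Cons by blast
  then have "T i *v (word_point T a I + word_matrix T I *v x) + a $ i \<in> self_affine_set T a"
    unfolding self_affine_set(3)[of a, symmetric] .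
  then show ?case
    by (simp add: matrix_vector_right_distrib matrix_vector_mul_assoc[symmetric] add_ac)
qed simp

end

section \<open>Interior points\<close>

context affine_blocks
begin

text \<open>The approximate densities have integral \<open>1\<close> and a common bounded support, so the limit cannot be
nonpositive everywhere. Near a point where it is positive, the approximate densities do not vanish at fine scales, and
this forces points of words, and hence points of the attractor, to come arbitrarily close.\<close>

lemma interior_nonempty_of_uniform_limit:
  assumes lim: "uniform_limit UNIV (approx_density a) f sequentially"
  shows "interior (self_affine_set T a) \<noteq> {}"
proof -
  let ?K = "self_affine_set T a"
  let ?M = "Suc CARD('d)"
  have r: "(1 / 2 :: real) ^ k > 0" "(1 / 2 :: real) ^ k \<le> 1" for k by (auto simp: power_le_one)
  have contf: "continuous_on UNIV f"
    by (rule uniform_limit_theorem[OF always_eventually lim])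
      (auto intro!: test_function_continuous test_function_approx_density)
  have near: "\<exists>X\<in>blocks (block_rate * k). norm (z - site a X) \<le> 2 * real ?M * (1 / 2) ^ k"
    if "approx_density a k z \<noteq> 0" for k z
  proof (rule ccontr)
    assume n: "\<not> ?thesis"
    have "prob X * smoother ?M ((1 / 2) ^ k) (z - site a X) = 0" if "X \<in> blocks (block_rate * k)" for X
      using n that smoother_support[OF r(1)[of k], of ?M "z - site a X"] by (auto simp: not_le)
    then have "approx_density a k z = 0" unfolding approx_density_def by (intro sum.neutral) blast
    with that show False by simp
  qed
  have "\<exists>z. f z > 0"
  proof (rule ccontr)
    assume "\<not> ?thesis"
    then have f0: "f z \<le> 0" for z by (simp add: not_less)
    define R where "R = norm a / (1 - rho) + 2 * real ?M"
    define V where "V = measure lborel (cball (0::real^'d) R)"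
    have V: "V \<ge> 0" by (simp add: V_def)
    have supp: "approx_density a k z = 0" if "z \<notin> cball 0 R" for k z
    proof (rule ccontr)
      assume "approx_density a k z \<noteq> 0"
      then obtain X where "norm (z - site a X) \<le> 2 * real ?M * (1 / 2) ^ k" using near by blast
      also have "\<dots> \<le> 2 * real ?M * 1" by (intro mult_left_mono r) auto
      finally have "norm z \<le> R"
        using norm_word_point'[of a "concat X"] norm_triangle_sub[of z "site a X"] by (simp add: R_def site_def)
      then show False using that by simp
    qed
    define e where "e = 1 / (V + 1)"
    have e: "e > 0" "e * V < 1" using V by (auto simp: e_def)
    have "\<forall>\<^sub>F k in sequentially. \<forall>z\<in>UNIV. dist (approx_density a k z) (f z) < e"
      using uniform_limitD[OF lim e(1)] .
    then obtain k where k: "\<And>z. dist (approx_density a k z) (f z) < e"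
      unfolding eventually_sequentially by auto
    have le: "approx_density a k z \<le> e * indicator (cball 0 R) z" for z
    proof (cases "z \<in> cball 0 R")
      case True
      then show ?thesis using k[of z] f0[of z] by (simp add: dist_real_def)
    qed (use supp in simp)
    have "(LBINT z. approx_density a k z) \<le> (\<integral>z. e * indicator (cball 0 R) z \<partial>(lborel :: (real^'d) measure))"
    proof (rule integral_mono[OF test_function_integrable[OF test_function_approx_density] _ le])
      show "integrable lborel (\<lambda>z::real^'d. e * indicator (cball 0 R) z)"
        using emeasure_lborel_cball_finite[of "0::real^'d" R]
        by (intro integrable_mult_right integrable_real_indicator) auto
    qed
    also have "\<dots> = e * V" by (simp add: V_def)
    finally show False using e(2) by (simp add: integral_approx_density)
  qed
  then obtain z0 where z0: "f z0 > 0" by blast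
  define U where "U = {z. f z > f z0 / 2}"
  have "open U" unfolding U_def by (rule open_Collect_less) (auto intro: contf)
  moreover have "z0 \<in> U" using z0 by (simp add: U_def)
  moreover have "U \<subseteq> ?K"
  proof
    fix z assume z: "z \<in> U"
    obtain x where x: "x \<in> ?K" using self_affine_set(1) by blast
    have "\<exists>y\<in>?K. dist y z < e" if "e > 0" for e
    proof -
      have "\<forall>\<^sub>F k in sequentially. \<forall>z\<in>UNIV. dist (approx_density a k z) (f z) < f z0 / 2"
        using z0 by (intro uniform_limitD[OF lim]) simp
      moreover have "(\<lambda>k. (2 * real ?M + norm x) * (1 / 2) ^ k) \<longlonglongrightarrow> (2 * real ?M + norm x) * 0"
        by (intro tendsto_mult tendsto_const LIMSEQ_power_zero) simp
      then have "\<forall>\<^sub>F k in sequentially. (2 * real ?M + norm x) * (1 / 2) ^ k < e"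
        using \<open>e > 0\<close> by (intro order_tendstoD(2)) auto
      ultimately have "\<forall>\<^sub>F k in sequentially. dist (approx_density a k z) (f z) < f z0 / 2 \<and>
          (2 * real ?M + norm x) * (1 / 2) ^ k < e"
        by eventually_elim auto
      then obtain k where k: "dist (approx_density a k z) (f z) < f z0 / 2" "(2 * real ?M + norm x) * (1 / 2) ^ k < e"
        unfolding eventually_sequentially by auto
      have "approx_density a k z > 0" using k(1) z unfolding U_def dist_real_def mem_Collect_eq by linarith
      then obtain X where X: "X \<in> blocks (block_rate * k)" "norm (z - site a X) \<le> 2 * real ?M * (1 / 2) ^ k"
        using near[of k z] by auto
      let ?y = "site a X + word_matrix T (concat X) *v x"
      have "?y \<in> ?K" unfolding site_def by (rule word_map_self_affine_set[OF x])
      moreover have "dist ?y z < e"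
      proof -
        have "norm (word_matrix T (concat X) *v x) \<le> rho ^ (N * (block_rate * k)) * norm x"
          using norm_word_matrix[of "concat X" x] by (simp add: length_concat_blocks[OF X(1)])
        also have "rho ^ (N * (block_rate * k)) \<le> (1 / 2) ^ k"
        proof -
          have "((1 / 2 :: real) ^ k) ^ (CARD('d) + 2) \<le> ((1 / 2) ^ k) ^ 1"
            by (rule power_decreasing) (auto simp: power_le_one)
          from order_trans[OF rho_power_blocks this] show ?thesis by simp
        qed
        finally have "norm (word_matrix T (concat X) *v x) \<le> (1 / 2) ^ k * norm x"
          by (simp add: mult_right_mono)
        moreover have "dist ?y z \<le> norm (z - site a X) + norm (word_matrix T (concat X) *v x)"
        proof -
          have "dist ?y z = norm ((z - site a X) - word_matrix T (concat X) *v x)"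
            by (simp add: dist_norm norm_minus_commute algebra_simps)
          then show ?thesis using norm_triangle_ineq4[of "z - site a X" "word_matrix T (concat X) *v x"] by simp
        qed
        ultimately show ?thesis using X(2) k(2) by (simp add: algebra_simps)
      qed
      ultimately show ?thesis by blast
    qed
    then have "z \<in> closure ?K" unfolding closure_approachable by blast
    then show "z \<in> ?K" using self_affine_set(2)[of a] by (simp add: compact_imp_closed)
  qed
  ultimately show ?thesis using interiorI by blast
qed

theorem AE_interior_nonempty: "AE a in lborel. interior (self_affine_set T a) \<noteq> {}"
  using AE_summable_energy
proof (rule AE_mp, intro AE_I2 impI)
  fix a assume "summable (\<lambda>k. lam k * block_energy ((1 / 2) ^ k) (block_rate * Suc k) a)"
  then obtain f where "uniform_limit UNIV (approx_density a) f sequentially"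
    using approx_density_uniform_limit by blast
  then show "interior (self_affine_set T a) \<noteq> {}" by (rule interior_nonempty_of_uniform_limit)
qed

end

theorem theorem1p1:
  fixes T :: "'m::finite \<Rightarrow> real ^ 'd ^ 'd"
  assumes "\<And>i. invertible (T i)"
    and "\<And>i. onorm ((*v) (T i)) < 1 / 2"
    and "critical_exponent T > ereal (real CARD('d))"
  shows "AE a in (lebesgue :: (real ^ 'd ^ 'm) measure). interior (self_affine_set T a) \<noteq> {}"
proof -
  let ?d = "real CARD('d)"
  \<comment> \<open>The exponent is kept at most \<open>d + 1\<close>, the order of the differences in use.\<close>
  obtain y where y: "ereal ?d < y" "y < critical_exponent T" using dense assms(3) by blast
  obtain t where t: "?d < t" "t \<le> ?d + 1" "ereal t < critical_exponent T"
  proof (cases y)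
    case (real s)
    show thesis
    proof (rule that[of "min s (?d + 1)"])
      have "ereal (min s (?d + 1)) \<le> ereal s" by simp
      then show "ereal (min s (?d + 1)) < critical_exponent T"
        using y(2) unfolding real by (rule order.strict_trans1)
    qed (use y real in auto)
  qed (use y in auto)
  have t0: "t \<ge> 0" using t(1) of_nat_0_le_iff[of "CARD('d)", where 'a=real] by linarith
  have "\<not> (SUP n\<in>{1..}. ereal (\<Sum>I\<in>words n.
        smallest_singular_value (word_matrix T I) powr t * \<bar>det (word_matrix T I)\<bar>)) \<le> 1"
  proof
    assume "(SUP n\<in>{1..}. ereal (\<Sum>I\<in>words n.
        smallest_singular_value (word_matrix T I) powr t * \<bar>det (word_matrix T I)\<bar>)) \<le> 1"
    then have "critical_exponent T \<le> ereal t"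
      unfolding critical_exponent_def using t0 by (intro Inf_lower) blast
    with t(3) show False by simp
  qed
  then obtain N where N: "N \<ge> 1" "\<not> ereal (\<Sum>I\<in>words N.
        smallest_singular_value (word_matrix T I) powr t * \<bar>det (word_matrix T I)\<bar>) \<le> 1"
    by (auto simp: SUP_le_iff)
  interpret affine_blocks T t N
  proof
    show "1 < (\<Sum>b\<in>words N. singular_weight t (word_matrix T b))"
      using N(2) by (simp add: singular_weight_def one_ereal_def)
  qed (use assms t N in auto)
  show ?thesis
    using AE_interior_nonempty by (rule AE_completion)
qed

end
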